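(* Let $m\in\frac12\mathbb N_{\rm odd}$. Then $$\begin{aligned} &\theta^{(-)}_{-2m,2m+1}\Big(\tau,\tfrac{2m(z_1-z_2)}{2m+1}\Big)\,\Phi^{[m,0]}(2\tau,2z_1,2z_2,0)\\ &=-i\,\eta(2\tau)^3\Bigg\{\frac{\theta^{(-)}_{2m,2m+1}\big(\tau,\frac{z_1-z_2}{2m+1}+z_1+z_2\big)}{\vartheta_{11}(2\tau,2z_1)}+\frac{\theta^{(-)}_{2m,2m+1}\big(\tau,\frac{z_1-z_2}{2m+1}-z_1-z_2\big)}{\vartheta_{11}(2\tau,2z_2)}\Bigg\}\\ &\quad-q^{-\frac{m}{2(2m+1)}}e^{\frac{2\pi im}{2m+1}(z_1-z_2)}\sum_{j=1}^{\infty}\sum_{r=1}^{j}\sum_{\substack{k=0\\ k\ {\rm even}}}^{2m-1}(-1)^jq^{(2m+1)j^2-\frac1{8m}(4m(j-r)+2m-k)^2}\\ &\qquad\times\big\{e^{\pi i(4mr-2m+k)(z_1-z_2)}q^{-\frac12(4mr-2m+k)}+e^{-\pi i(4mr-2m+k)(z_1-z_2)}q^{\frac12(4mr-2m+k)}\big\}\big[\theta_{k,2m}-\theta_{-k,2m}\big](\tau,z_1+z_2)\\ &\quad+q^{-\frac{m}{2(2m+1)}}e^{\frac{2\pi im}{2m+1}(z_1-z_2)}\sum_{j=1}^{\infty}\sum_{r=0}^{j-1}\sum_{\substack{k=0\\ k\ {\rm even}}}^{2m-1}(-1)^jq^{(2m+1)j^2-\frac1{8m}(4m(j-r)-2m+k)^2}\\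 &\qquad\times\big\{e^{\pi i(4mr+2m-k)(z_1-z_2)}q^{-\frac12(4mr+2m-k)}+e^{-\pi i(4mr+2m-k)(z_1-z_2)}q^{\frac12(4mr+2m-k)}\big\}\big[\theta_{k,2m}-\theta_{-k,2m}\big](\tau,z_1+z_2)\\ &\quad+\theta^{(-)}_{-2m,2m+1}\Big(\tau,\tfrac{2m(z_1-z_2)}{2m+1}\Big)\sum_{k=1}^{m-\frac12}e^{2\pi ik(z_1-z_2)}q^{-\frac{k^2}{2m}}\big[\theta_{k,m}-\theta_{-k,m}\big](2\tau,2z_1+2z_2). \end{aligned}$$
   Context: $\mathbb N_{\rm odd}$ is the set of positive odd integers (and $\mathbb N$ the positive integers). $\tau$ lies in the upper half-plane, $z_1,z_2,t\in\mathbb C$, $q=e^{2\pi i\tau}$, $q^a:=e^{2\pi i a\tau}$. For $m\in\frac12\mathbb N$, $s\in\frac12\mathbb Z$: $$\Phi^{[m,s]}_1(\tau,z_1,z_2,t)=e^{-2\pi imt}\sum_{j\in\mathbb Z}\frac{e^{2\pi imj(z_1+z_2)+2\pi isz_1}q^{mj^2+sj}}{1-e^{2\pi iz_1}q^j},\qquad \Phi^{[m,s]}_2(\tau,z_1,z_2,t)=e^{-2\pi imt}\sum_{j\in\mathbb Z}\frac{e^{-2\pi imj(z_1+z_2)-2\pi isz_2}q^{mj^2+sj}}{1-e^{-2\pi iz_2}q^j},$$ $\Phi^{[m,s]}=\Phi^{[m,s]}_1-\Phi^{[m,s]}_2$. Theta functions: $\theta_{k,m}(\tau,z)=\sum_{j\in\mathbb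 Z}e^{2\pi im(j+\frac{k}{2m})z}q^{m(j+\frac{k}{2m})^2}$ and $\theta^{(-)}_{k,m}(\tau,z)=\sum_{j\in\mathbb Z}(-1)^je^{2\pi im(j+\frac{k}{2m})z}q^{m(j+\frac{k}{2m})^2}$. In these definitions $q=e^{2\pi i\tau}$ for the first argument $\tau$ (so a first argument $2\tau$ means replacing $q$ by $q^2$). $[\theta_{k,m}-\theta_{-k,m}](\tau,z)$ means $\theta_{k,m}(\tau,z)-\theta_{-k,m}(\tau,z)$. $\eta$ is the Dedekind eta function and $\vartheta_{ab}(\tau,z)=\sum_{n\in\mathbb Z}e^{\pi i(n+\frac a2)^2\tau+2\pi i(n+\frac a2)(z+\frac b2)}$ ($a,b\in\{0,1\}$) are Mumford's theta functions. Empty sums are $0$. Identities are identities of meromorphic functions of the variables. *)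

theory Defs
  imports "HOL-Complex_Analysis.Complex_Analysis"
begin

(* qpow \<tau> a is q^a := e^{2 \<pi> i a \<tau>}; it depends on \<tau>, not just on q, so no branch of the logarithm
   is involved. *)
definition qpow :: "complex \<Rightarrow> real \<Rightarrow> complex" where
  "qpow \<tau> a = exp (2 * of_real pi * \<i> * of_real a * \<tau>)"

(* For Im \<tau> > 0 and m > 0 the bilateral series below converge absolutely (those of Phi1 and Phi2
   wherever no denominator vanishes), so infsum is the actual sum there. *)

definition Phi1 :: "real \<Rightarrow> real \<Rightarrow> complex \<Rightarrow> complex \<Rightarrow> complex \<Rightarrow> complex \<Rightarrow> complex" where
  "Phi1 m s \<tau> z1 z2 t =
     exp (- 2 * of_real pi * \<i> * of_real m * t) *
     (\<Sum>\<^sub>\<infinity>j::int.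
        exp (2 * of_real pi * \<i> * of_real m * of_int j * (z1 + z2) + 2 * of_real pi * \<i> * of_real s * z1)
        * qpow \<tau> (m * (of_int j)\<^sup>2 + s * of_int j)
        / (1 - exp (2 * of_real pi * \<i> * z1) * qpow \<tau> (of_int j)))"

definition Phi2 :: "real \<Rightarrow> real \<Rightarrow> complex \<Rightarrow> complex \<Rightarrow> complex \<Rightarrow> complex \<Rightarrow> complex" where
  "Phi2 m s \<tau> z1 z2 t =
     exp (- 2 * of_real pi * \<i> * of_real m * t) *
     (\<Sum>\<^sub>\<infinity>j::int.
        exp (- 2 * of_real pi * \<i> * of_real m * of_int j * (z1 + z2) - 2 * of_real pi * \<i> * of_real s * z2)
        * qpow \<tau> (m * (of_int j)\<^sup>2 + s * of_int j)
        / (1 - exp (- 2 * of_real pi * \<i> * z2) * qpow \<tau> (of_int j)))"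

definition Phi :: "real \<Rightarrow> real \<Rightarrow> complex \<Rightarrow> complex \<Rightarrow> complex \<Rightarrow> complex \<Rightarrow> complex" where
  "Phi m s \<tau> z1 z2 t = Phi1 m s \<tau> z1 z2 t - Phi2 m s \<tau> z1 z2 t"

definition theta :: "real \<Rightarrow> real \<Rightarrow> complex \<Rightarrow> complex \<Rightarrow> complex" where
  "theta k m \<tau> z =
     (\<Sum>\<^sub>\<infinity>j::int.
        exp (2 * of_real pi * \<i> * of_real (m * (of_int j + k / (2 * m))) * z)
        * qpow \<tau> (m * (of_int j + k / (2 * m))\<^sup>2))"

(* \<theta>^{(-)}_{k,m} *)
definition theta_minus :: "real \<Rightarrow> real \<Rightarrow> complex \<Rightarrow> complex \<Rightarrow> complex" where
  "theta_minus k m \<tau> z =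
     (\<Sum>\<^sub>\<infinity>j::int.
        (-1) powi j * exp (2 * of_real pi * \<i> * of_real (m * (of_int j + k / (2 * m))) * z)
        * qpow \<tau> (m * (of_int j + k / (2 * m))\<^sup>2))"

(* [\<theta>_{k,m} - \<theta>_{-k,m}](\<tau>,z) *)
definition theta_diff :: "real \<Rightarrow> real \<Rightarrow> complex \<Rightarrow> complex \<Rightarrow> complex" where
  "theta_diff k m \<tau> z = theta k m \<tau> z - theta (- k) m \<tau> z"

definition dedekind_eta :: "complex \<Rightarrow> complex" where
  "dedekind_eta \<tau> = qpow \<tau> (1 / 24) * (\<Prod>n. 1 - qpow \<tau> (real (Suc n)))"

(* Mumford's \<vartheta>_{ab}(\<tau>,z), meant for a, b \<in> {0, 1}. Here e^{\<pi> i \<tau>}, not e^{2 \<pi> i \<tau>}, is the nome. *)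
definition mumford_theta :: "nat \<Rightarrow> nat \<Rightarrow> complex \<Rightarrow> complex \<Rightarrow> complex" where
  "mumford_theta a b \<tau> z =
     (\<Sum>\<^sub>\<infinity>n::int.
        exp (of_real pi * \<i> * (of_int n + of_nat a / 2)\<^sup>2 * \<tau>
             + 2 * of_real pi * \<i> * (of_int n + of_nat a / 2) * (z + of_nat b / 2)))"

end

theory Submission
  imports Defs
begin

text \<open>
  Write \<open>n = 2 m\<close> (an odd integer), \<open>N = (n + 1) / 2\<close>, \<open>d = z1 - z2\<close>, \<open>s = z1 + z2\<close>,
  and \<open>v\<close>, \<open>w\<close>, \<open>q\<close> for the exponentials of \<open>d\<close>, \<open>s\<close>, \<open>\<tau>\<close>. Up to the common factor
  \<open>theta_factor\<close>, everything depends on \<open>v\<close>, \<open>w\<close>, \<open>q\<close> only, and \<open>\<Phi>\<close> is the difference of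
  the values at \<open>s\<close> and \<open>- s\<close> of a single Appell sum with denominators \<open>1 - v w q^(2 j)\<close>. The proof
  is a comparison of absolutely convergent series; no meromorphic continuation is involved.

  The eta and theta quotient also has denominators \<open>1 - v w q^(2 j)\<close>, because the reciprocal of
  \<open>\<vartheta>\<^sub>1\<^sub>1\<close> has the partial fraction expansion
  \<open>- i \<eta>(2 \<tau>)^3 / \<vartheta>\<^sub>1\<^sub>1(2 \<tau>, \<zeta>) = x^(1/2) \<Sum>\<^sub>j (-1)^j q^(j (j + 1)) / (1 - x q^(2 j))\<close> with \<open>x\<close> the exponential of
  \<open>\<zeta>\<close> (\<open>eta_cube_over_theta\<close>). Multiplying that expansion by the numerator theta series, and the Appell sum
  by \<open>\<theta>\<^sup>(\<^sup>-\<^sup>)\<close>, gives two double series whose numerators agree at each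
  pole \<open>v w = q^(- 2 j)\<close>: with \<open>X = v w q^(2 j)\<close> the terms that belong together differ by a common
  factor times \<open>(X^(n l) - X^(N + i)) / (1 - X)\<close>. This is a finite geometric sum, so the
  difference of the two products is a sum over \<open>(l, i, t)\<close> of monomials, supported where \<open>t\<close> lies between
  \<open>n l\<close> and \<open>N + i\<close>; the quadratic part of the exponent of \<open>q\<close> is bounded below by a positive definite form on that region.
  The cut at \<open>N + i\<close> can be moved to \<open>N\<close>, since for fixed \<open>i\<close> and \<open>t\<close> the full sum over \<open>l\<close> is
  \<open>\<Sum>\<^sub>l (-1)^l q^(l^2 - n l + 2 l t) = 0\<close>: the reflection \<open>l \<mapsto> n - 2 t - l\<close> changes the sign because
  \<open>n\<close> is odd. After that the sum over \<open>i\<close> is a complete theta series, and one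
  obtains \<open>appell_sum_expansion\<close>.

  Antisymmetrising in \<open>s\<close> turns these theta series into \<open>\<theta>\<^sub>2\<^sub>t - \<theta>\<^sub>-\<^sub>2\<^sub>t\<close>, which is odd in \<open>t\<close>
  and depends on \<open>t\<close> modulo \<open>n\<close> only, apart from a power of \<open>q\<close>. Writing \<open>t = n r + \<kappa>\<close> with
  \<open>\<bar>\<kappa>\<bar> < N\<close>, the region of summation becomes two cones in the \<open>(r, l)\<close> plane together with the
  diagonal \<open>r = l\<close> when \<open>\<kappa> \<ge> 0\<close> (\<open>appell_sum_difference\<close>). The cones are the two double sums of the theorem, each
  of which mixes the classes \<open>\<kappa>\<close> and \<open>- \<kappa>\<close>, and the diagonal is the last line.

  The partial fraction expansion is proved in the same way as the expansion of the Appell sum; the constant that it leaves is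
  \<open>\<Sum>\<^sub>h h (-1)^h q^(h (h + 1))\<close>, which Jacobi's identity (\<open>jacobi_cube_int\<close>) identifies with the
  cube of the Euler product. That identity is the limit of the derivative of the finite
  \<open>q\<close>-binomial theorem at one of its roots.
\<close>

section \<open>Exponentials and absolutely convergent sums\<close>

text \<open>
  The exponential with period 1 that is usually written \<open>e(z)\<close>.
\<close>

definition ee :: "complex \<Rightarrow> complex" where
  "ee z = exp (2 * of_real pi * \<i> * z)"

text \<open>
  The sign \<open>(-1)^k\<close>, which behaves better under case distinction on parity than an integer power.
\<close>

definition alt :: "int \<Rightarrow> complex" where
  "alt k = (if even k then 1 else -1)"

lemma ee_add: "ee (a + b) = ee a * ee b"
  by (simp add: ee_def distrib_left exp_add)

lemma ee_0 [simp]: "ee 0 = 1"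
  by (simp add: ee_def)

lemma ee_nonzero [simp]: "ee z \<noteq> 0"
  by (simp add: ee_def)

lemma ee_minus: "ee (- z) = 1 / ee z"
  by (simp add: ee_def exp_minus field_simps)

lemma ee_diff: "ee (a - b) = ee a / ee b"
  by (simp add: ee_def right_diff_distrib exp_diff)

lemma norm_ee: "norm (ee z) = exp (- 2 * pi * Im z)"
  by (simp add: ee_def)

lemma ee_powi: "ee z powi k = ee (of_int k * z)"
  by (simp add: ee_def exp_power_int algebra_simps)

lemma alt_add: "alt (a + b) = alt a * alt b"
  by (auto simp: alt_def)

lemma alt_minus [simp]: "alt (- a) = alt a"
  by (auto simp: alt_def)

lemma norm_alt [simp]: "norm (alt k) = 1"
  by (auto simp: alt_def)

lemma alt_eq_powi: "(-1) powi k = alt k"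
  by (cases "even k") (auto simp: alt_def power_int_minus_left)

lemma alt_eq_power: "(-1) ^ k = alt (int k)"
  by (auto simp: alt_def)

lemma qpow_eq_ee: "qpow \<tau> a = ee (of_real a * \<tau>)"
  by (simp add: qpow_def ee_def mult_ac)

text \<open>
  Completing the square bounds the Gaussian by a constant times \<open>exp (- \<bar>k\<bar>)\<close>.
\<close>

lemma gaussian_int_summable:
  fixes c A :: real
  assumes "c > 0"
  shows "(\<lambda>k::int. exp (A * \<bar>of_int k\<bar> - c * (of_int k)\<^sup>2)) summable_on UNIV"
proof -
  \<comment> \<open>The maximum of \<open>(A + 1) x - c x^2\<close>.\<close>
  define B where "B = (A + 1)\<^sup>2 / (4 * c)"
  have geo: "(\<lambda>k::nat. exp (B - real k)) summable_on UNIV"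
  proof (rule norm_summable_imp_summable_on)
    have "summable (\<lambda>k. exp B * exp (-1 :: real) ^ k)"
      by (intro summable_mult summable_geometric) simp
    then show "summable (\<lambda>k. norm (exp (B - real k)))"
      by (simp add: exp_diff exp_minus power_inverse flip: exp_of_nat_mult)
         (simp add: divide_inverse)
  qed
  have "(\<lambda>k::int. exp (B - \<bar>of_int k\<bar>)) summable_on (range int \<union> range (\<lambda>k. - int k))"
    by (intro summable_on_union)
       (use geo in \<open>auto simp: summable_on_reindex inj_on_def o_def\<close>)
  moreover have "range int \<union> range (\<lambda>k. - int k) = UNIV"
    by (auto intro: int_cases2)
  ultimately have *: "(\<lambda>k::int. exp (B - \<bar>of_int k\<bar>)) summable_on UNIV"
    by simp
  have bnd: "A * x - c * x\<^sup>2 \<le> B - x" for x :: real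
  proof -
    have "0 \<le> (2 * c * x - (A + 1))\<^sup>2 / (4 * c)"
      using assms by simp
    also have "\<dots> = B - (A + 1) * x + c * x\<^sup>2"
      using assms by (simp add: B_def field_simps power2_eq_square)
    finally show ?thesis by (simp add: algebra_simps)
  qed
  show ?thesis
  proof (rule summable_on_comparison_test[OF *])
    fix k :: int
    show "exp (A * \<bar>of_int k\<bar> - c * (of_int k)\<^sup>2) \<le> exp (B - \<bar>of_int k\<bar> :: real)"
      using bnd[of "\<bar>of_int k\<bar>"] by simp
  qed auto
qed

lemma abs_summable_times:
  fixes f :: "'a \<Rightarrow> 'c :: {real_normed_field, banach}" and g :: "'b \<Rightarrow> 'c"
  assumes f: "(\<lambda>x. norm (f x)) summable_on UNIV" and g: "(\<lambda>y. norm (g y)) summable_on UNIV"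
  shows "(\<lambda>z. norm ((\<lambda>(x, y). f x * g y) z)) summable_on UNIV"
proof -
  have "(\<lambda>x. norm (f x) * infsum (\<lambda>y. norm (g y)) UNIV) summable_on UNIV"
    by (rule summable_on_cmult_left[OF f])
  moreover have "0 \<le> infsum (\<lambda>y. norm (g y)) UNIV"
    by (rule infsum_nonneg) simp
  ultimately have "(\<lambda>z. norm ((\<lambda>(x, y). f x * g y) z)) summable_on UNIV \<times> UNIV"
    by (subst Infinite_Sum.abs_summable_on_Sigma_iff)
       (auto simp: norm_mult infsum_cmult_right' intro!: summable_on_cmult_right g)
  then show ?thesis by simp
qed

text \<open>
  All multiple series below are compared with a three-dimensional Gaussian. The new
  coordinates \<open>\<phi>\<close>, \<open>\<psi>\<close>, \<open>\<omega>\<close> only have to separate the index set, so the same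
  statement serves in dimensions one and two, with the remaining coordinates zero.
\<close>

lemma gaussian_summable:
  fixes f :: "'a \<Rightarrow> complex" and \<phi> \<psi> \<omega> :: "'a \<Rightarrow> int"
  assumes inj: "inj (\<lambda>x. (\<phi> x, \<psi> x, \<omega> x))" and C: "C > 0"
    and bound: "\<And>x. norm (f x) \<le> B * exp (A * of_int (\<bar>\<phi> x\<bar> + \<bar>\<psi> x\<bar> + \<bar>\<omega> x\<bar>)
                  - C * of_int ((\<phi> x)\<^sup>2 + (\<psi> x)\<^sup>2 + (\<omega> x)\<^sup>2))"
  shows "f summable_on UNIV"
proof -
  define h where "h = (\<lambda>k::int. exp (A * \<bar>of_int k\<bar> - C * (of_int k)\<^sup>2 :: real))"
  have h: "(\<lambda>k. norm (h k)) summable_on UNIV"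
    using gaussian_int_summable[OF C, of A] by (simp add: h_def)
  from abs_summable_times[OF h abs_summable_times[OF h h]]
  have "(\<lambda>(x,y,z). h x * (h y * h z)) summable_on UNIV"
    by (simp add: h_def case_prod_unfold)
  then have "(\<lambda>(x,y,z). h x * (h y * h z)) summable_on range (\<lambda>x. (\<phi> x, \<psi> x, \<omega> x))"
    by (rule summable_on_subset_banach) auto
  then have "(\<lambda>x. h (\<phi> x) * (h (\<psi> x) * h (\<omega> x))) summable_on UNIV"
    by (simp add: summable_on_reindex[OF inj] o_def)
  then have "(\<lambda>x. B * (h (\<phi> x) * (h (\<psi> x) * h (\<omega> x)))) summable_on UNIV"
    by (rule summable_on_cmult_right)
  then have "(\<lambda>x. norm (f x)) summable_on UNIV"
  proof (rule summable_on_comparison_test)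
    fix x
    show "norm (f x) \<le> B * (h (\<phi> x) * (h (\<psi> x) * h (\<omega> x)))"
      using bound[of x] by (simp add: h_def algebra_simps flip: exp_add)
  qed auto
  then show ?thesis by (rule abs_summable_summable)
qed

text \<open>
  The form in which convergence is checked in practice. The hypothesis \<open>Q\<close> asks for
  positive definiteness of the quadratic exponent up to linear terms, and only where the
  coefficient \<open>u\<close> is nonzero: the exponents that occur are indefinite forms, which become positive
  definite on the support of a sign factor.
\<close>

lemma ee_summable:
  fixes u :: "'a \<Rightarrow> complex" and \<phi> \<psi> \<omega> p r W :: "'a \<Rightarrow> int" and Q :: "'a \<Rightarrow> real"
  assumes tau: "Im \<tau> > 0" and inj: "inj (\<lambda>x. (\<phi> x, \<psi> x, \<omega> x))"
    and u: "\<And>x. norm (u x) \<le> U" and D: "D > 0" and E: "E \<ge> 0"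
    and pr: "\<And>x. \<bar>p x\<bar> + \<bar>r x\<bar> \<le> W x"
    and W: "\<And>x. W x \<le> F * (\<bar>\<phi> x\<bar> + \<bar>\<psi> x\<bar> + \<bar>\<omega> x\<bar>)"
    and Q: "\<And>x. u x \<noteq> 0 \<Longrightarrow>
          of_int ((\<phi> x)\<^sup>2 + (\<psi> x)\<^sup>2 + (\<omega> x)\<^sup>2) \<le> D * Q x + E * of_int (W x)"
  shows "(\<lambda>x. u x * ee (of_int (p x) * d + of_int (r x) * s + of_real (Q x) * \<tau>)) summable_on UNIV"
proof (rule gaussian_summable[OF inj])
  define c where "c = 2 * pi * Im \<tau> / D"
  define K where "K = 2 * pi * (\<bar>Im d\<bar> + \<bar>Im s\<bar>) + c * E"
  show c: "c > 0" using tau D by (simp add: c_def)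
  have K: "K \<ge> 0" using c E by (simp add: K_def)
  have U: "U \<ge> 0" using u norm_ge_zero order_trans by blast
  fix x
  let ?P = "of_int ((\<phi> x)\<^sup>2 + (\<psi> x)\<^sup>2 + (\<omega> x)\<^sup>2) :: real"
  let ?S = "of_int (\<bar>\<phi> x\<bar> + \<bar>\<psi> x\<bar> + \<bar>\<omega> x\<bar>) :: real"
  let ?z = "of_int (p x) * d + of_int (r x) * s + of_real (Q x) * \<tau>"
  show "norm (u x * ee ?z) \<le> U * exp (K * F * ?S - c * ?P)"
  proof (cases "u x = 0")
    case False
    have "\<bar>of_int (p x) * Im d\<bar> + \<bar>of_int (r x) * Im s\<bar>
          \<le> of_int (W x) * \<bar>Im d\<bar> + of_int (W x) * \<bar>Im s\<bar>"
      unfolding abs_mult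
      by (intro add_mono mult_right_mono) (use pr[of x] in linarith)+
    then have 1: "- (of_int (p x) * Im d + of_int (r x) * Im s)
          \<le> of_int (W x) * (\<bar>Im d\<bar> + \<bar>Im s\<bar>)"
      unfolding distrib_left by linarith
    have "c * ?P \<le> c * (D * Q x + E * of_int (W x))"
      by (rule mult_left_mono[OF Q[OF False]]) (use c in simp)
    also have "\<dots> = 2 * pi * Im \<tau> * Q x + c * E * of_int (W x)"
      using D by (simp add: c_def field_simps)
    finally have 2: "- (2 * pi * Im \<tau> * Q x) \<le> c * E * of_int (W x) - c * ?P"
      by linarith
    have "- 2 * pi * Im ?z = 2 * pi * - (of_int (p x) * Im d + of_int (r x) * Im s)
            + - (2 * pi * Im \<tau> * Q x)"
      by (simp add: algebra_simps)
    also have "\<dots> \<le> 2 * pi * (of_int (W x) * (\<bar>Im d\<bar> + \<bar>Im s\<bar>)) + (c * E * of_int (W x) - c * ?P)"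
      by (intro add_mono mult_left_mono 1 2) simp
    also have "\<dots> = K * of_int (W x) - c * ?P"
      by (simp add: K_def algebra_simps)
    also have "K * of_int (W x) \<le> K * (of_int (F * (\<bar>\<phi> x\<bar> + \<bar>\<psi> x\<bar> + \<bar>\<omega> x\<bar>)))"
      by (intro mult_left_mono K) (use W[of x] in linarith)
    finally have "- 2 * pi * Im ?z \<le> K * F * ?S - c * ?P"
      by (simp add: mult_ac)
    then show ?thesis
      unfolding norm_mult norm_ee by (intro mult_mono u) (use U in auto)
  qed (use U in simp)
qed

lemma infsum_times:
  fixes f :: "'a \<Rightarrow> complex" and g :: "'b \<Rightarrow> complex"
  assumes "f summable_on UNIV" "g summable_on UNIV"
  shows "(\<lambda>(x, y). f x * g y) summable_on UNIV"
    and "(\<Sum>\<^sub>\<infinity>(x, y). f x * g y) = infsum f UNIV * infsum g UNIV"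
proof -
  have "(\<lambda>z. norm ((\<lambda>(x, y). f x * g y) z)) summable_on UNIV"
    using assms by (intro abs_summable_times) (auto simp: summable_on_iff_abs_summable_on_complex)
  then show *: "(\<lambda>(x, y). f x * g y) summable_on UNIV"
    by (rule abs_summable_summable)
  have "(\<Sum>\<^sub>\<infinity>(x, y). f x * g y) = (\<Sum>\<^sub>\<infinity>x. \<Sum>\<^sub>\<infinity>y. f x * g y)"
    using infsum_Sigma'_banach[of "\<lambda>x y. f x * g y" UNIV "\<lambda>_. UNIV"] * by simp
  then show "(\<Sum>\<^sub>\<infinity>(x, y). f x * g y) = infsum f UNIV * infsum g UNIV"
    by (simp add: infsum_cmult_right' infsum_cmult_left')
qed

text \<open>
  Used for the alternating theta series at their zeros, where it replaces an appeal to oddness of a theta function.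
\<close>

lemma infsum_odd_reflection:
  fixes f :: "int \<Rightarrow> complex"
  assumes "\<And>l. f (k - l) = - f l"
  shows "infsum f UNIV = 0"
proof -
  have "bij_betw (\<lambda>l. k - l) UNIV (UNIV :: int set)"
    by (rule bij_betwI[where g = "\<lambda>l. k - l"]) auto
  from infsum_reindex_bij_betw[OF this, of f] have "infsum f UNIV = (\<Sum>\<^sub>\<infinity>l. - f l)"
    by (simp add: assms)
  then show ?thesis by (simp add: infsum_uminus)
qed

text \<open>
  The difference of the two indicators is the oriented indicator of the interval between
  \<open>a\<close> and \<open>b\<close>. Allowing both orientations keeps the order of \<open>a\<close> and \<open>b\<close> out of all
  later series.
\<close>

lemma has_sum_telescope_between:
  fixes g G :: "int \<Rightarrow> complex"
  assumes G: "\<And>t. G (t + 1) - G t = g t"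
  shows "((\<lambda>t. (of_bool (a \<le> t) - of_bool (b \<le> t)) * g t) has_sum G b - G a) UNIV"
proof -
  have up: "((\<lambda>t. (of_bool (a \<le> t) - of_bool (b \<le> t)) * g t) has_sum G b - G a) UNIV"
    if "a \<le> b" for a b
    using that
  proof (induction b rule: int_ge_induct)
    case base
    show ?case by simp
  next
    case (step b)
    have "((\<lambda>t. if t = b then g b else 0) has_sum g b) UNIV"
      by (rule has_sum_finite_neutralI[where B = "{b}"]) auto
    from has_sum_add[OF step.IH this]
    have "((\<lambda>t. (of_bool (a \<le> t) - of_bool (b \<le> t)) * g t + (if t = b then g b else 0))
        has_sum G b - G a + g b) UNIV" .
    also have "G b - G a + g b = G (b + 1) - G a"
      using G[of b] by (simp add: algebra_simps)
    also have "(\<lambda>t. (of_bool (a \<le> t) - of_bool (b \<le> t)) * g t + (if t = b then g b else 0))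
        = (\<lambda>t. (of_bool (a \<le> t) - of_bool (b + 1 \<le> t)) * g t)"
      using step.hyps by (auto simp: fun_eq_iff)
    finally show ?case .
  qed
  show ?thesis
  proof (cases "a \<le> b")
    case False
    then have "((\<lambda>t. - ((of_bool (b \<le> t) - of_bool (a \<le> t)) * g t)) has_sum G b - G a) UNIV"
      using up[of b a] unfolding has_sum_uminus by simp
    then show ?thesis by (simp add: algebra_simps)
  qed (rule up)
qed

lemma has_sum_geometric_between:
  fixes X :: complex
  assumes "X \<noteq> 0" "X \<noteq> 1"
  shows "((\<lambda>t::int. (of_bool (a \<le> t) - of_bool (b \<le> t)) * X powi t)
            has_sum (X powi a - X powi b) / (1 - X)) UNIV"
proof -
  have "- (X powi (t + 1)) / (1 - X) - - (X powi t) / (1 - X) = X powi t" for t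
  proof -
    have "- (X powi (t + 1)) / (1 - X) - - (X powi t) / (1 - X) = X powi t * (1 - X) / (1 - X)"
      using assms(1) unfolding diff_divide_distrib[symmetric] by (simp add: power_int_add algebra_simps)
    then show ?thesis using assms(2) by simp
  qed
  from has_sum_telescope_between[of "\<lambda>t. - (X powi t) / (1 - X)", OF this, of a b]
  show ?thesis by (simp add: diff_divide_distrib)
qed

lemma infsum_diff:
  fixes f g :: "'a \<Rightarrow> complex"
  assumes "f summable_on A" "g summable_on A"
  shows "(\<Sum>\<^sub>\<infinity>x\<in>A. f x - g x) = infsum f A - infsum g A"
  using infsum_add[OF assms(1) summable_on_uminus[THEN iffD2, OF assms(2)]]
  by (simp add: infsum_uminus)

lemma infsum_pairs:
  fixes f :: "'a \<Rightarrow> 'b \<Rightarrow> complex"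
  assumes "(\<lambda>(x, y). f x y) summable_on UNIV"
  shows "(\<Sum>\<^sub>\<infinity>(x, y). f x y) = (\<Sum>\<^sub>\<infinity>x. \<Sum>\<^sub>\<infinity>y. f x y)"
    and "(\<lambda>x. \<Sum>\<^sub>\<infinity>y. f x y) summable_on UNIV"
    and "(\<lambda>y. f x y) summable_on UNIV"
  using infsum_Sigma'_banach[of f UNIV "\<lambda>_. UNIV"] summable_on_Sigma_banach[of f UNIV "\<lambda>_. UNIV"]
    summable_on_SigmaD1[of f UNIV "\<lambda>_. UNIV" x] assms by simp_all

lemma infsum_triples:
  fixes f :: "'a \<Rightarrow> 'b \<Rightarrow> 'c \<Rightarrow> complex"
  assumes "(\<lambda>(x, y, z). f x y z) summable_on UNIV"
  shows "(\<Sum>\<^sub>\<infinity>(x, y, z). f x y z) = (\<Sum>\<^sub>\<infinity>x. \<Sum>\<^sub>\<infinity>y. \<Sum>\<^sub>\<infinity>z. f x y z)"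
proof -
  have a: "(\<lambda>(x, yz). case yz of (y, z) \<Rightarrow> f x y z) summable_on UNIV"
    using assms by simp
  note * = infsum_pairs[of "\<lambda>x (y, z). f x y z", OF a]
  have "(\<lambda>(y, z). f x y z) summable_on UNIV" for x
    using *(3)[of x] by simp
  from infsum_pairs(1)[OF this] *(1) show ?thesis by simp
qed

section \<open>Jacobi's identity for the cube of the Euler product\<close>

definition qfac :: "complex \<Rightarrow> nat \<Rightarrow> complex" where
  "qfac p n = (\<Prod>i<n. 1 - p ^ Suc i)"

text \<open>
  The Gaussian binomial coefficients, given by their Pascal recursion so that they vanish for
  \<open>k > n\<close>, which a quotient of products would not do in truncated arithmetic.
\<close>

fun qbin :: "complex \<Rightarrow> nat \<Rightarrow> nat \<Rightarrow> complex" where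
  "qbin p n 0 = 1"
| "qbin p 0 (Suc k) = 0"
| "qbin p (Suc n) (Suc k) = qbin p n (Suc k) + p ^ (n - k) * qbin p n k"

lemma qbin_eq_0: "k > n \<Longrightarrow> qbin p n k = 0"
  by (induction p n k rule: qbin.induct) auto

lemma qbin_self [simp]: "qbin p n n = 1"
  by (induction n) (auto simp: qbin_eq_0)

lemma qfac_Suc: "qfac p (Suc n) = qfac p n * (1 - p ^ Suc n)"
  by (simp add: qfac_def)

lemma qfac_0 [simp]: "qfac p 0 = 1"
  by (simp add: qfac_def)

lemma qbin_qfac: "k \<le> n \<Longrightarrow> qbin p n k * (qfac p k * qfac p (n - k)) = qfac p n"
proof (induction p n k rule: qbin.induct)
  case (3 p n k)
  show ?case
  proof (cases "k = n")
    case False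
    with 3 have k: "Suc k \<le> n" by simp
    define j where "j = n - Suc k"
    have j: "n = Suc (k + j)" using k by (simp add: j_def)
    have pascal: "(A + q * B) * ((F * r') * (G * r)) = T * r + q * T * r'"
      if "A * ((F * r') * G) = T" "B * (F * (G * r)) = T" for A B F G T q r r' :: complex
    proof -
      have "(A + q * B) * ((F * r') * (G * r)) = (A * ((F * r') * G)) * r + q * (B * (F * (G * r))) * r'"
        by (simp add: algebra_simps)
      then show ?thesis unfolding that .
    qed
    have "qbin p n (Suc k) * ((qfac p k * (1 - p ^ Suc k)) * qfac p j) = qfac p n"
      using 3 k by (simp add: j qfac_Suc)
    moreover have "qbin p n k * (qfac p k * (qfac p j * (1 - p ^ Suc j))) = qfac p n"
      using 3 k by (simp add: j qfac_Suc)
    ultimately have "(qbin p n (Suc k) + p ^ Suc j * qbin p n k)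
        * ((qfac p k * (1 - p ^ Suc k)) * (qfac p j * (1 - p ^ Suc j)))
        = qfac p n * (1 - p ^ Suc j) + p ^ Suc j * qfac p n * (1 - p ^ Suc k)"
      by (rule pascal)
    also have "\<dots> = qfac p (Suc n)"
      by (simp add: qfac_Suc j algebra_simps power_add)
    finally show ?thesis by (simp add: j qfac_Suc)
  qed (simp add: qbin_eq_0)
qed auto

lemma q_binomial_theorem:
  "(\<Prod>k<n. 1 + z * p ^ k) = (\<Sum>k\<le>n. qbin p n k * p ^ (k choose 2) * z ^ k)"
proof (induction n)
  case (Suc n)
  let ?t = "\<lambda>k. qbin p n k * p ^ (k choose 2) * z ^ k"
  have choose: "(Suc k choose 2) = (k choose 2) + k" for k
    by (simp add: numeral_2_eq_2)
  have "(\<Sum>k\<le>Suc n. qbin p (Suc n) k * p ^ (k choose 2) * z ^ k)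
      = 1 + (\<Sum>k\<le>n. qbin p (Suc n) (Suc k) * p ^ (Suc k choose 2) * z ^ Suc k)"
    by (subst sum.atMost_Suc_shift) (simp add: numeral_2_eq_2)
  also have "(\<Sum>k\<le>n. qbin p (Suc n) (Suc k) * p ^ (Suc k choose 2) * z ^ Suc k)
      = (\<Sum>k\<le>n. ?t (Suc k)) + (\<Sum>k\<le>n. z * p ^ n * ?t k)"
  proof (subst sum.distrib[symmetric], rule sum.cong[OF refl])
    fix k assume "k \<in> {..n}"
    then have "p ^ n = p ^ (n - k) * p ^ k"
      by (simp flip: power_add)
    then show "qbin p (Suc n) (Suc k) * p ^ (Suc k choose 2) * z ^ Suc k
        = ?t (Suc k) + z * p ^ n * ?t k"
      by (simp add: choose power_add algebra_simps)
  qed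
  also have "1 + ((\<Sum>k\<le>n. ?t (Suc k)) + (\<Sum>k\<le>n. z * p ^ n * ?t k))
      = (\<Sum>k\<le>Suc n. ?t k) + z * p ^ n * (\<Sum>k\<le>n. ?t k)"
    by (subst sum.atMost_Suc_shift) (simp add: sum_distrib_left numeral_2_eq_2)
  also have "\<dots> = (1 + z * p ^ n) * (\<Sum>k\<le>n. ?t k)"
    by (simp add: qbin_eq_0 algebra_simps)
  finally show ?case
    using Suc.IH by (simp add: mult_ac)
qed (simp add: numeral_2_eq_2)

lemma choose_two_shift_up: "(N + 1 + e choose 2) + (N + 1 choose 2) = (e + 1 choose 2) + N * (N + 1 + e)"
proof (induction e)
  case 0
  show ?case by (induction N) (simp_all add: numeral_2_eq_2)
qed (simp add: numeral_2_eq_2 algebra_simps)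

lemma choose_two_shift_down: "(k choose 2) + (k + e + 1 choose 2) = (e + 1 choose 2) + (k + e) * k"
proof (induction k)
  case (Suc k)
  then show ?case by (simp add: numeral_2_eq_2 algebra_simps)
qed (simp add: numeral_2_eq_2)

text \<open>
  Differentiate the \<open>q\<close>-binomial theorem for \<open>2 N + 1\<close> factors at the root \<open>- p^(- N)\<close> of the
  middle factor. On the product side only the product of the other factors survives. On the sum side
  the terms with indices \<open>N - e\<close> and \<open>N + 1 + e\<close> carry the same power of \<open>p\<close> and the same Gaussian
  binomial but opposite signs; as the polynomial vanishes at the root, the weight \<open>k\<close> may be
  replaced by \<open>k - (N + 1)\<close>, and the pair contributes the weight \<open>2 e + 1\<close>.
\<close>

lemma finite_jacobi:
  assumes p: "p \<noteq> 0" and nz: "\<And>k. qfac p k \<noteq> 0"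
  shows "qfac p N ^ 2 = (\<Sum>e\<le>N. (-1) ^ e * of_nat (2 * e + 1) * p ^ (e + 1 choose 2)
            * (qfac p (2 * N + 1) / (qfac p (N + 1 + e) * qfac p (N - e))))"
proof -
  define M where "M = 2 * N + 1"
  define z0 where "z0 = - 1 / p ^ N"
  define h where "h = (\<lambda>z. \<Prod>k\<in>{..<M}-{N}. 1 + z * p ^ k)"
  have prod: "(\<Prod>k<M. 1 + z * p ^ k) = (1 + z * p ^ N) * h z" for z
    unfolding h_def by (rule prod.remove) (auto simp: M_def)
  have root: "1 + z0 * p ^ N = 0"
    using p by (simp add: z0_def)
  have "h holomorphic_on UNIV"
    unfolding h_def by (intro holomorphic_intros)
  then have "(h has_field_derivative deriv h z0) (at z0)"
    by (auto simp: holomorphic_derivI)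
  then have deriv1: "((\<lambda>z. (1 + z * p ^ N) * h z) has_field_derivative p ^ N * h z0) (at z0)"
    by (auto intro!: derivative_eq_intros simp: root)
  have deriv2: "((\<lambda>z. \<Sum>k\<le>M. qbin p M k * p ^ (k choose 2) * z ^ k) has_field_derivative
        (\<Sum>k\<le>M. qbin p M k * p ^ (k choose 2) * (of_nat k * z0 ^ (k - 1)))) (at z0)"
    by (auto intro!: derivative_eq_intros sum.cong)
  have "(\<lambda>z. (1 + z * p ^ N) * h z) = (\<lambda>z. \<Sum>k\<le>M. qbin p M k * p ^ (k choose 2) * z ^ k)"
    by (simp add: prod[symmetric] q_binomial_theorem)
  with deriv2 have "((\<lambda>z. (1 + z * p ^ N) * h z) has_field_derivative
        (\<Sum>k\<le>M. qbin p M k * p ^ (k choose 2) * (of_nat k * z0 ^ (k - 1)))) (at z0)"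
    by simp
  from DERIV_unique[OF deriv1 this] have "p ^ N * h z0 = (\<Sum>k\<le>M. qbin p M k * p ^ (k choose 2) * (of_nat k * z0 ^ (k - 1)))" .
  \<comment> \<open>Multiplying by the root restores the exponent \<open>k\<close>, so that the vanishing of the polynomial can be used.\<close>
  then have "z0 * (p ^ N * h z0)
      = (\<Sum>k\<le>M. z0 * (qbin p M k * p ^ (k choose 2) * (of_nat k * z0 ^ (k - 1))))"
    by (simp only: sum_distrib_left)
  also have "\<dots> = (\<Sum>k\<le>M. of_nat k * (qbin p M k * p ^ (k choose 2) * z0 ^ k))"
  proof (rule sum.cong[OF refl])
    fix k
    show "z0 * (qbin p M k * p ^ (k choose 2) * (of_nat k * z0 ^ (k - 1)))
        = of_nat k * (qbin p M k * p ^ (k choose 2) * z0 ^ k)"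
      by (cases k) (simp_all only: mult_ac power_Suc of_nat_0 mult_zero_left mult_zero_right diff_Suc_1)
  qed
  finally have "z0 * (p ^ N * h z0) = (\<Sum>k\<le>M. of_nat k * (qbin p M k * p ^ (k choose 2) * z0 ^ k))" .
  moreover have "(\<Sum>k\<le>M. qbin p M k * p ^ (k choose 2) * z0 ^ k) = 0"
    by (simp add: q_binomial_theorem[symmetric] prod root)
  moreover have "z0 * (p ^ N * h z0) = - h z0"
    using p by (simp add: z0_def)
  ultimately have h1: "- h z0 =
      (\<Sum>k\<le>M. (of_nat k - of_nat (N + 1)) * (qbin p M k * p ^ (k choose 2) * z0 ^ k))"
    by (simp add: left_diff_distrib sum_subtractf flip: sum_distrib_left)

  let ?c = "(-1) ^ N / p ^ (N + 1 choose 2) :: complex"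
  have h2: "h z0 = ?c * qfac p N ^ 2"
  proof -
    have "h z0 = (\<Prod>k\<in>{..<N} \<union> {N + 1..<M}. 1 + z0 * p ^ k)"
      unfolding h_def by (rule prod.cong) (auto simp: M_def)
    also have "\<dots> = (\<Prod>k<N. 1 + z0 * p ^ k) * (\<Prod>k\<in>{N + 1..<M}. 1 + z0 * p ^ k)"
      by (rule prod.union_disjoint) auto
    also have "(\<Prod>k\<in>{N + 1..<M}. 1 + z0 * p ^ k) = qfac p N"
      unfolding qfac_def
    proof (rule prod.reindex_bij_witness[where i = "\<lambda>i. N + 1 + i" and j = "\<lambda>k. k - (N + 1)"])
      fix k assume "k \<in> {N + 1..<M}"
      then have "p ^ k = p ^ N * p ^ Suc (k - (N + 1))"
        by (simp flip: power_add power_Suc)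
      then show "1 - p ^ Suc (k - (N + 1)) = 1 + z0 * p ^ k"
        using p by (simp add: z0_def)
    qed (auto simp: M_def)
    also have "(\<Prod>k<N. 1 + z0 * p ^ k) = (\<Prod>i<N. (- 1 / p ^ Suc i) * (1 - p ^ Suc i))"
    proof (rule prod.reindex_bij_witness[where i = "\<lambda>i. N - Suc i" and j = "\<lambda>k. N - Suc k"])
      fix k assume "k \<in> {..<N}"
      then have "p ^ N = p ^ k * p ^ Suc (N - Suc k)"
        by (simp flip: power_add power_Suc)
      then show "(- 1 / p ^ Suc (N - Suc k)) * (1 - p ^ Suc (N - Suc k)) = 1 + z0 * p ^ k"
        using p by (simp add: z0_def field_simps)
    qed auto
    also have "\<dots> = (\<Prod>i<N. - 1 / p ^ Suc i) * qfac p N"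
      by (simp only: prod.distrib qfac_def)
    also have "(\<Prod>i<N. - 1 / p ^ Suc i) = ?c"
      by (induction N) (simp_all add: numeral_2_eq_2 power_add field_simps)
    finally show ?thesis by (simp add: power2_eq_square)
  qed
  let ?Q = "\<lambda>e. qfac p M / (qfac p (N + 1 + e) * qfac p (N - e))"
  let ?s = "\<lambda>k. (of_nat k - of_nat (N + 1)) * (qbin p M k * p ^ (k choose 2) * z0 ^ k)"
  have rearrange: "- x * Q * (A * B) * (c / d) = - (A / d) * (B * x * c * Q)" for x Q A B c d :: complex
    by simp
  have qb: "qbin p M k = qfac p M / (qfac p k * qfac p (M - k))" if "k \<le> M" for k
    using qbin_qfac[OF that, of p] nz by (simp add: field_simps)
  have z0k: "z0 ^ k = (-1) ^ k / p ^ (N * k)" for k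
    unfolding z0_def power_divide power_mult by simp
  have "(\<Sum>k\<le>M. ?s k) = (\<Sum>k\<in>{..N} \<union> {N + 1..M}. ?s k)"
    by (rule sum.cong) (auto simp: M_def)
  also have "\<dots> = (\<Sum>k\<le>N. ?s k) + (\<Sum>k=N+1..M. ?s k)"
    by (rule sum.union_disjoint) auto
  also have "(\<Sum>k\<le>N. ?s k) = (\<Sum>e\<le>N. - ?c * ((-1) ^ e * of_nat (e + 1) * p ^ (e + 1 choose 2) * ?Q e))"
  proof (rule sum.reindex_bij_witness[where i = "\<lambda>e. N - e" and j = "\<lambda>k. N - k"])
    fix k assume k: "k \<in> {..N}"
    define e where "e = N - k"
    have N: "N = k + e" using k by (simp add: e_def)
    have "p ^ (k choose 2) * p ^ (N + 1 choose 2) = p ^ (e + 1 choose 2) * p ^ (N * k)"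
      using choose_two_shift_down[of k e] by (simp add: N flip: power_add)
    then have 1: "p ^ (k choose 2) / p ^ (N * k) = p ^ (e + 1 choose 2) / p ^ (N + 1 choose 2)"
      using p by (simp add: field_simps)
    have 2: "qbin p M k = ?Q e"
    proof -
      have "k \<le> M" "M - k = N + 1 + e" "k = N - e" using N by (simp_all add: M_def)
      then show ?thesis using qb[of k] by (simp only: mult.commute)
    qed
    have 3: "(-1) ^ k = ((-1) ^ N * (-1) ^ e :: complex)"
      by (simp add: N power_add minus_one_power_iff)
    have 4: "(of_nat k - of_nat (N + 1) :: complex) = - of_nat (e + 1)"
      by (simp add: N)
    have "?s k = (of_nat k - of_nat (N + 1)) * ?Q e * (-1) ^ k * (p ^ (k choose 2) / p ^ (N * k))"
      unfolding z0k 2 by simp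
    also have "\<dots> = - ?c * ((-1) ^ e * of_nat (e + 1) * p ^ (e + 1 choose 2) * ?Q e)"
      unfolding 1 3 4 by (rule rearrange)
    finally show "- ?c * ((-1) ^ (N - k) * of_nat (N - k + 1) * p ^ (N - k + 1 choose 2) * ?Q (N - k)) = ?s k"
      by (simp add: e_def)
  qed auto
  also have "(\<Sum>k=N+1..M. ?s k) = (\<Sum>e\<le>N. - ?c * ((-1) ^ e * of_nat e * p ^ (e + 1 choose 2) * ?Q e))"
  proof (rule sum.reindex_bij_witness[where i = "\<lambda>e. N + 1 + e" and j = "\<lambda>k. k - (N + 1)"])
    fix k assume k: "k \<in> {N+1..M}"
    define e where "e = k - (N + 1)"
    have N: "k = N + 1 + e" "e \<le> N" using k by (auto simp: e_def M_def)
    have "p ^ (k choose 2) * p ^ (N + 1 choose 2) = p ^ (e + 1 choose 2) * p ^ (N * k)"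
      using choose_two_shift_up[of N e] by (simp add: N flip: power_add)
    then have 1: "p ^ (k choose 2) / p ^ (N * k) = p ^ (e + 1 choose 2) / p ^ (N + 1 choose 2)"
      using p by (simp add: field_simps)
    have 2: "qbin p M k = ?Q e"
    proof -
      have "k \<le> M" "M - k = N - e" using N by (simp_all add: M_def)
      then show ?thesis using qb[of k] N(1) by (simp only:)
    qed
    have 3: "(-1) ^ k = (- ((-1) ^ N * (-1) ^ e) :: complex)"
      by (simp add: N power_add)
    have 4: "(of_nat k - of_nat (N + 1) :: complex) = of_nat e"
      by (simp add: N)
    have "?s k = (of_nat k - of_nat (N + 1)) * ?Q e * (-1) ^ k * (p ^ (k choose 2) / p ^ (N * k))"
      unfolding z0k 2 by simp
    also have "\<dots> = - ?c * ((-1) ^ e * of_nat e * p ^ (e + 1 choose 2) * ?Q e)"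
      unfolding 1 3 4 mult_minus_right[of "of_nat e * ?Q e"] mult_minus_left
      by (rule rearrange[unfolded mult_minus_left])
    finally show "- ?c * ((-1) ^ (k - (N + 1)) * of_nat (k - (N + 1)) * p ^ (k - (N + 1) + 1 choose 2) * ?Q (k - (N + 1))) = ?s k"
      by (simp add: e_def)
  qed (auto simp: M_def)
  also have "(\<Sum>e\<le>N. - ?c * ((-1) ^ e * of_nat (e + 1) * p ^ (e + 1 choose 2) * ?Q e)) + \<dots>
      = - ?c * (\<Sum>e\<le>N. (-1) ^ e * of_nat (2 * e + 1) * p ^ (e + 1 choose 2) * ?Q e)"
  proof -
    have split: "of_nat (2 * e + 1) = (of_nat (e + 1) + of_nat e :: complex)" for e
      by simp
    show ?thesis
      unfolding sum_distrib_left sum.distrib[symmetric] split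
      by (simp only: distrib_left distrib_right)
  qed
  finally have S: "(\<Sum>k\<le>M. ?s k)
      = - ?c * (\<Sum>e\<le>N. (-1) ^ e * of_nat (2 * e + 1) * p ^ (e + 1 choose 2) * ?Q e)" .
  have "?c * qfac p N ^ 2
      = ?c * (\<Sum>e\<le>N. (-1) ^ e * of_nat (2 * e + 1) * p ^ (e + 1 choose 2) * ?Q e)"
    using h1 unfolding S h2 mult_minus_left neg_equal_iff_equal .
  moreover have "?c \<noteq> 0" using p by simp
  ultimately have "qfac p N ^ 2
      = (\<Sum>e\<le>N. (-1) ^ e * of_nat (2 * e + 1) * p ^ (e + 1 choose 2) * ?Q e)"
    unfolding mult_cancel_left by blast
  then show ?thesis
    unfolding M_def .
qed

lemma qfac_limit:
  assumes "norm p < 1"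
  shows "qfac p \<longlonglongrightarrow> (\<Prod>n. 1 - p ^ Suc n)" "(\<Prod>n. 1 - p ^ Suc n) \<noteq> 0" "qfac p k \<noteq> 0"
proof -
  have nz: "1 - p ^ Suc i \<noteq> 0" for i
  proof
    assume "1 - p ^ Suc i = 0"
    then have "norm p ^ Suc i = 1"
      by (metis eq_iff_diff_eq_0 norm_one norm_power)
    moreover have "norm p ^ Suc i < 1"
      using assms power_Suc_less_one[of "norm p" i] power_0_left[of "Suc i"]
      by (cases "p = 0") auto
    ultimately show False by simp
  qed
  then show "qfac p k \<noteq> 0" by (simp add: qfac_def)
  have "summable (\<lambda>n. norm (1 - p ^ Suc n - 1))"
    using assms by (simp add: norm_power norm_mult summable_mult)
  then have "abs_convergent_prod (\<lambda>n. 1 - p ^ Suc n)"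
    by (simp add: abs_convergent_prod_conv_summable)
  then have conv: "convergent_prod (\<lambda>n. 1 - p ^ Suc n)"
    by (rule abs_convergent_prod_imp_convergent_prod)
  show "(\<Prod>n. 1 - p ^ Suc n) \<noteq> 0"
    using prodinf_nonzero[OF conv nz] .
  have "(\<lambda>n. \<Prod>i\<le>n. 1 - p ^ Suc i) \<longlonglongrightarrow> (\<Prod>n. 1 - p ^ Suc n)"
    by (rule convergent_prod_LIMSEQ[OF conv])
  then have "(\<lambda>n. qfac p (Suc n)) \<longlonglongrightarrow> (\<Prod>n. 1 - p ^ Suc n)"
    by (simp only: qfac_def lessThan_Suc_atMost)
  then show "qfac p \<longlonglongrightarrow> (\<Prod>n. 1 - p ^ Suc n)"
    by (rule LIMSEQ_imp_Suc)
qed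

text \<open>
  Let \<open>N\<close> tend to infinity in the finite version. Finite products and their inverses are uniformly
  bounded, so Tannery's theorem applies, and the ratio of products tends to the inverse of
  the Euler product.
\<close>

theorem jacobi_cube_identity:
  fixes p :: complex
  assumes p: "p \<noteq> 0" "norm p < 1"
  shows "(\<lambda>e. (-1) ^ e * of_nat (2 * e + 1) * p ^ (e + 1 choose 2)) sums (\<Prod>n. 1 - p ^ Suc n) ^ 3"
    and "summable (\<lambda>e. norm ((-1) ^ e * of_nat (2 * e + 1) * p ^ (e + 1 choose 2)))"
proof -
  define L where "L = (\<Prod>n. 1 - p ^ Suc n)"
  define u where "u = (\<lambda>e. (-1) ^ e * of_nat (2 * e + 1) * p ^ (e + 1 choose 2))"
  define a where "a = (\<lambda>e N. if e \<le> N then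
     u e * (qfac p (2 * N + 1) / (qfac p (N + 1 + e) * qfac p (N - e))) else 0)"
  note lim = qfac_limit(1)[OF p(2), folded L_def]
  have L: "L \<noteq> 0" using qfac_limit(2)[OF p(2)] by (simp add: L_def)
  note nz = qfac_limit(3)[OF p(2)]
  obtain C where C: "C > 0" "\<And>n. norm (qfac p n) \<le> C"
    using convergent_imp_Bseq[OF convergentI[OF lim]] by (auto simp: Bseq_def)
  have "(\<lambda>n. inverse (qfac p n)) \<longlonglongrightarrow> inverse L"
    by (intro tendsto_inverse lim L)
  then obtain c where c: "c > 0" "\<And>n. norm (inverse (qfac p n)) \<le> c"
    using convergent_imp_Bseq[OF convergentI, of "\<lambda>n. inverse (qfac p n)" "inverse L"]
    by (auto simp: Bseq_def)
  have sums_a: "(\<lambda>e. a e N) sums (qfac p N ^ 2)" for N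
  proof -
    have "(\<lambda>e. a e N) sums (\<Sum>e\<le>N. a e N)"
      by (rule sums_finite) (auto simp: a_def)
    also have "(\<Sum>e\<le>N. a e N) = qfac p N ^ 2"
      unfolding finite_jacobi[OF p(1) nz] by (intro sum.cong) (auto simp: a_def u_def)
    finally show ?thesis .
  qed
  have ubound: "norm (u e) \<le> 2 * (real (Suc e) * norm p ^ e)" for e
  proof -
    have "e \<le> (e + 1 choose 2)" by (induction e) (simp_all add: numeral_2_eq_2)
    then have "norm p ^ (e + 1 choose 2) \<le> norm p ^ e"
      using p by (intro power_decreasing) auto
    moreover have "norm (1 + 2 * of_nat e :: complex) \<le> 2 * real (Suc e)"
      by (rule order_trans[OF norm_triangle_ineq]) (simp add: norm_mult)
    ultimately show ?thesis
      by (simp add: u_def norm_mult norm_power flip: mult.assoc) (intro mult_mono, auto)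
  qed
  have geo: "summable (\<lambda>e. 2 * (real (Suc e) * norm p ^ e))"
    using geometric_deriv_sums[of "norm p"] p by (intro summable_mult) (auto simp: sums_iff)
  have abound: "norm (a e N) \<le> 2 * (real (Suc e) * norm p ^ e) * (C * (c * c))" for e N
  proof (cases "e \<le> N")
    case True
    have "norm (qfac p (2 * N + 1) / (qfac p (N + 1 + e) * qfac p (N - e)))
        = norm (qfac p (2 * N + 1)) * (norm (inverse (qfac p (N + 1 + e))) * norm (inverse (qfac p (N - e))))"
      by (simp add: norm_mult norm_divide norm_inverse divide_inverse)
    also have "\<dots> \<le> C * (c * c)"
      using c C by (intro mult_mono) auto
    finally show ?thesis
      unfolding a_def if_P[OF True] norm_mult[of "u e"]
      by (rule mult_mono[OF ubound]) simp_all
  qed (use c C in \<open>auto simp: a_def\<close>)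
  have lim_a: "(\<lambda>N. a e N) \<longlonglongrightarrow> u e * (L / (L * L))" for e
  proof (rule Lim_transform_eventually)
    have "filterlim (\<lambda>N::nat. 2 * N + 1) sequentially sequentially"
      "filterlim (\<lambda>N::nat. N + 1 + e) sequentially sequentially"
      by (rule filterlim_subseq, auto simp: strict_mono_def)+
    moreover have "filterlim (\<lambda>N::nat. N - e) sequentially sequentially"
      by (rule filterlim_minus_const_nat_at_top)
    ultimately show "(\<lambda>N. u e * (qfac p (2 * N + 1) / (qfac p (N + 1 + e) * qfac p (N - e))))
        \<longlonglongrightarrow> u e * (L / (L * L))"
      by (intro tendsto_intros filterlim_compose[OF lim]) (use L in auto)
    show "\<forall>\<^sub>F N in sequentially. u e * (qfac p (2 * N + 1) / (qfac p (N + 1 + e) * qfac p (N - e))) = a e N"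
      using eventually_ge_at_top[of e] by eventually_elim (auto simp: a_def)
  qed
  have ev: "\<forall>\<^sub>F (e, N) in sequentially \<times>\<^sub>F sequentially.
      norm (a e N) \<le> 2 * (real (Suc e) * norm p ^ e) * (C * (c * c))"
    by (rule always_eventually) (use abound in blast)
  have "(\<lambda>N. \<Sum>e. a e N) \<longlonglongrightarrow> (\<Sum>e. u e * (L / (L * L)))"
    using tannerys_theorem[OF lim_a ev summable_mult2[OF geo]] by simp
  moreover have "(\<lambda>N. \<Sum>e. a e N) = (\<lambda>N. qfac p N ^ 2)"
    using sums_a by (simp add: sums_iff fun_eq_iff)
  ultimately have "(\<lambda>N. qfac p N ^ 2) \<longlonglongrightarrow> (\<Sum>e. u e * (L / (L * L)))"
    by (simp only:)
  from LIMSEQ_unique[OF this tendsto_power[OF lim]]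
  have lim2: "(\<Sum>e. u e * (L / (L * L))) = L ^ 2" .
  show su: "summable (\<lambda>e. norm ((-1) ^ e * of_nat (2 * e + 1) * p ^ (e + 1 choose 2)))"
    using ubound unfolding u_def by (intro summable_comparison_test[OF _ geo]) auto
  then have "summable u"
    unfolding u_def by (rule summable_norm_cancel)
  then have "suminf u * (L / (L * L)) = L ^ 2"
    using lim2 by (simp add: suminf_mult2)
  then have "suminf u = L ^ 3"
    using L by (simp add: field_simps power2_eq_square power3_eq_cube)
  with \<open>summable u\<close> show "(\<lambda>e. (-1) ^ e * of_nat (2 * e + 1) * p ^ (e + 1 choose 2)) sums (\<Prod>n. 1 - p ^ Suc n) ^ 3"
    unfolding u_def L_def by (simp add: sums_iff)
qed

section \<open>The partial fraction expansion of a reciprocal theta function\<close>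

text \<open>
  The modulus of \<open>ee (\<xi> + 2 j \<tau>)\<close> tends to \<open>0\<close> and to infinity as \<open>j\<close> tends to plus and minus
  infinity, which leaves finitely many \<open>j\<close>.
\<close>

lemma inverse_one_minus_ee_bounded:
  assumes tau: "Im \<tau> > 0" and nz: "\<And>j::int. ee (\<xi> + 2 * of_int j * \<tau>) \<noteq> 1"
  obtains C where "\<And>j::int. norm (1 / (1 - ee (\<xi> + 2 * of_int j * \<tau>))) \<le> C"
proof -
  define X where "X = (\<lambda>j::int. ee (\<xi> + 2 * of_int j * \<tau>))"
  define J where "J = \<lceil>(2 * pi * \<bar>Im \<xi>\<bar> + 1) / (4 * pi * Im \<tau>)\<rceil>"
  have "(2 * pi * \<bar>Im \<xi>\<bar> + 1) / (4 * pi * Im \<tau>) \<le> J"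
    unfolding J_def by (rule le_of_int_ceiling)
  then have J: "2 * pi * \<bar>Im \<xi>\<bar> + 1 \<le> J * (4 * pi * Im \<tau>)"
    using tau by (simp add: field_simps)
  have normX: "norm (X j) = exp (- 2 * pi * Im \<xi> - j * (4 * pi * Im \<tau>))" for j
    by (simp add: X_def norm_ee algebra_simps)
  have abs: "- 2 * pi * Im \<xi> \<le> 2 * pi * \<bar>Im \<xi>\<bar>" "- (2 * pi * \<bar>Im \<xi>\<bar>) \<le> - 2 * pi * Im \<xi>"
    using mult_left_mono[of "- Im \<xi>" "\<bar>Im \<xi>\<bar>" "2 * pi"] mult_left_mono[of "Im \<xi>" "\<bar>Im \<xi>\<bar>" "2 * pi"]
    by auto
  have two: "exp (1 :: real) \<ge> 2"
    using exp_ge_add_one_self[of 1] by simp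
  have large: "norm (1 / (1 - X j)) \<le> 2" if "J \<le> j" for j
  proof -
    have "J * (4 * pi * Im \<tau>) \<le> j * (4 * pi * Im \<tau>)"
      using that tau by (intro mult_right_mono) auto
    then have "norm (X j) \<le> exp (- 1)"
      using J abs unfolding normX exp_le_cancel_iff by linarith
    also have "\<dots> \<le> 1 / 2"
      using two by (simp add: exp_minus field_simps)
    finally have "norm (1 - X j) \<ge> 1 / 2"
      using norm_triangle_ineq2[of 1 "X j"] by simp
    then show ?thesis
      using le_imp_inverse_le[of "1 / 2" "norm (1 - X j)"] by (simp add: norm_divide inverse_eq_divide)
  qed
  have small: "norm (1 / (1 - X j)) \<le> 2" if "j \<le> - J" for j
  proof -
    have "j * (4 * pi * Im \<tau>) \<le> (- J) * (4 * pi * Im \<tau>)"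
      using that tau by (intro mult_right_mono) auto
    then have "norm (X j) \<ge> exp 1"
      using J abs unfolding normX exp_le_cancel_iff of_int_minus mult_minus_left by linarith
    then have "norm (1 - X j) \<ge> 1"
      using norm_triangle_ineq2[of "X j" 1] two by (simp add: norm_minus_commute)
    then show ?thesis
      using le_imp_inverse_le[of 1 "norm (1 - X j)"] by (simp add: norm_divide inverse_eq_divide)
  qed
  define C where "C = 2 + (\<Sum>j\<in>{-J..J}. norm (1 / (1 - X j)))"
  have "norm (1 / (1 - X j)) \<le> C" for j
  proof (cases "j \<in> {-J..J}")
    case True
    have "norm (1 / (1 - X j)) \<le> (\<Sum>j\<in>{-J..J}. norm (1 / (1 - X j)))"
      by (rule member_le_sum[OF True]) auto
    then show ?thesis by (simp add: C_def)
  next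
    case False
    then have "norm (1 / (1 - X j)) \<le> 2" using large[of j] small[of j] by force
    moreover have "0 \<le> (\<Sum>j\<in>{-J..J}. norm (1 / (1 - X j)))" by (rule sum_nonneg) simp
    ultimately show ?thesis by (simp add: C_def)
  qed
  then show ?thesis by (intro that[of C]) (simp only: X_def)
qed

text \<open>
  Up to an elementary factor this is \<open>\<vartheta>\<^sub>1\<^sub>1(2 \<tau>, \<xi>)\<close>, and the next definition is the partial
  fraction expansion of its reciprocal.
\<close>

definition theta_series :: "complex \<Rightarrow> complex \<Rightarrow> complex" where
  "theta_series \<tau> \<xi> = (\<Sum>\<^sub>\<infinity>h::int. alt h * ee (of_int h * \<xi> + of_int (h * (h + 1)) * \<tau>))"

definition theta_recip :: "complex \<Rightarrow> complex \<Rightarrow> complex" where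
  "theta_recip \<tau> \<xi> = (\<Sum>\<^sub>\<infinity>j::int. alt j * ee (of_int (j * (j + 1)) * \<tau>) / (1 - ee (\<xi> + 2 * of_int j * \<tau>)))"

lemma theta_series_summable:
  assumes "Im \<tau> > 0"
  shows "(\<lambda>h::int. alt h * ee (of_int h * \<xi> + of_int (h * (h + 1)) * \<tau>)) summable_on UNIV"
  using ee_summable[where \<phi> = "\<lambda>h::int. h" and \<psi> = "\<lambda>_. 0" and \<omega> = "\<lambda>_. 0" and u = alt and U = 1
      and p = "\<lambda>h. h" and r = "\<lambda>_. 0" and d = \<xi> and s = 0 and Q = "\<lambda>h. of_int (h * (h + 1))"
      and W = abs and F = 1 and D = 1 and E = 1, OF assms]
  by (simp add: inj_def power2_eq_square algebra_simps flip: of_int_add of_int_mult)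

lemma theta_recip_summable:
  assumes tau: "Im \<tau> > 0" and nz: "\<And>j::int. ee (\<xi> + 2 * of_int j * \<tau>) \<noteq> 1"
  shows "(\<lambda>j::int. alt j * ee (of_int (j * (j + 1)) * \<tau>) / (1 - ee (\<xi> + 2 * of_int j * \<tau>))) summable_on UNIV"
proof -
  obtain C where C: "norm (1 / (1 - ee (\<xi> + 2 * of_int j * \<tau>))) \<le> C" for j :: int
    using inverse_one_minus_ee_bounded[OF tau nz] by blast
  then show ?thesis
    using ee_summable[where \<phi> = "\<lambda>h::int. h" and \<psi> = "\<lambda>_. 0" and \<omega> = "\<lambda>_. 0"
      and u = "\<lambda>j. alt j / (1 - ee (\<xi> + 2 * of_int j * \<tau>))" and U = C
      and p = "\<lambda>_. 0" and r = "\<lambda>_. 0" and d = 0 and s = 0 and Q = "\<lambda>h. of_int (h * (h + 1))"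
      and W = abs and F = 1 and D = 1 and E = 1, OF tau]
    by (simp add: inj_def norm_divide power2_eq_square algebra_simps flip: of_int_add of_int_mult)
qed

text \<open>
  Convergence rests on
  \<open>(h - j)^2 + 2 j t = (h - t)^2 + j^2 + t^2 + 2 (t - h) (j - t)\<close>, where the last product is
  nonnegative on the support of the sign factor.
\<close>

lemma theta_kernel_summable:
  assumes "Im \<tau> > 0"
  shows "(\<lambda>(j::int, h::int, t::int). (of_bool (h \<le> t) - of_bool (j \<le> t)) * alt (h + j)
      * ee (of_int t * \<xi> + of_int ((h - j)\<^sup>2 + h + j + 2 * j * t) * \<tau>)) summable_on UNIV"
proof -
  define u where "u = (\<lambda>(j::int, h::int, t::int). (of_bool (h \<le> t) - of_bool (j \<le> t)) * alt (h + j))"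
  have "(\<lambda>x. u x * ee (of_int (case x of (j, h, t) \<Rightarrow> t) * \<xi> + of_int 0 * 0
      + of_real (of_int (case x of (j, h, t) \<Rightarrow> (h - j)\<^sup>2 + h + j + 2 * j * t)) * \<tau>)) summable_on UNIV"
  proof (rule ee_summable[where \<phi> = "\<lambda>(j, h, t). h - t" and \<psi> = "\<lambda>(j, h, t). j"
        and \<omega> = "\<lambda>(j, h, t). t" and W = "\<lambda>(j, h, t). \<bar>j\<bar> + \<bar>h\<bar> + \<bar>t\<bar>" and F = 2 and D = 1 and E = 1
        and U = 1 and r = "\<lambda>_. 0", OF assms])
    show "inj (\<lambda>x. (case x of (j, h, t) \<Rightarrow> h - t, case x of (j::int, h::int, t::int) \<Rightarrow> j,
            case x of (j, h, t) \<Rightarrow> t))"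
      by (auto simp: inj_def)
    fix x :: "int \<times> int \<times> int"
    obtain j h t where x: "x = (j, h, t)" by (cases x)
    show "norm (u x) \<le> 1" by (auto simp: x u_def norm_mult)
    have "\<bar>j\<bar> + \<bar>h\<bar> + \<bar>t\<bar> \<le> 2 * (\<bar>h - t\<bar> + \<bar>j\<bar> + \<bar>t\<bar>)"
      by arith
    then show "(case x of (j, h, t) \<Rightarrow> \<bar>j\<bar> + \<bar>h\<bar> + \<bar>t\<bar>) \<le> 2 * (\<bar>case x of (j, h, t) \<Rightarrow> h - t\<bar>
        + \<bar>case x of (j, h, t) \<Rightarrow> j\<bar> + \<bar>case x of (j, h, t) \<Rightarrow> t\<bar>)"
      by (simp only: x prod.case)
    assume "u x \<noteq> 0"
    then have "h \<le> t \<and> t < j \<or> j \<le> t \<and> t < h"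
      by (auto simp: x u_def of_bool_def split: if_splits)
    then have "0 \<le> (t - h) * (j - t)"
      by (auto intro: mult_nonneg_nonneg mult_nonpos_nonpos)
    then have "(h - t)\<^sup>2 + j\<^sup>2 + t\<^sup>2 \<le> (h - j)\<^sup>2 + h + j + 2 * j * t + (\<bar>j\<bar> + \<bar>h\<bar> + \<bar>t\<bar>)"
      by (simp add: power2_eq_square algebra_simps)
    then show "of_int ((case x of (j, h, t) \<Rightarrow> h - t)\<^sup>2 + (case x of (j, h, t) \<Rightarrow> j)\<^sup>2
          + (case x of (j, h, t) \<Rightarrow> t)\<^sup>2)
        \<le> 1 * of_int (case x of (j, h, t) \<Rightarrow> (h - j)\<^sup>2 + h + j + 2 * j * t)
          + 1 * real_of_int (case x of (j, h, t) \<Rightarrow> \<bar>j\<bar> + \<bar>h\<bar> + \<bar>t\<bar>)"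
      unfolding x prod.case mult_1 of_int_add[symmetric] of_int_le_iff .
  qed auto
  then show ?thesis
    by (simp add: u_def case_prod_unfold)
qed

text \<open>
  The indices \<open>k\<close> and \<open>- 1 - k\<close> share the power of \<open>q\<close> and together give the weight \<open>2 k + 1\<close>.
\<close>

lemma jacobi_cube_int:
  assumes tau: "Im \<tau> > 0"
  shows "(\<Sum>\<^sub>\<infinity>e::int. of_int e * alt e * ee (of_int (e * (e + 1)) * \<tau>)) = (\<Prod>n. 1 - ee (2 * \<tau>) ^ Suc n) ^ 3"
proof -
  define p where "p = ee (2 * \<tau>)"
  have p: "p \<noteq> 0" "norm p < 1"
    using tau by (simp_all add: p_def norm_ee)
  define w where "w = (\<lambda>k. (-1) ^ k * p ^ (k + 1 choose 2))"
  define f where "f = (\<lambda>e::int. of_int e * alt e * ee (of_int (e * (e + 1)) * \<tau>))"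
  have power: "p ^ k = ee (of_int (2 * int k) * \<tau>)" for k
    using ee_powi[of "2 * \<tau>" "int k"] by (simp add: p_def mult_ac)
  have tri: "2 * int (k + 1 choose 2) = int k * (int k + 1)" for k
    by (induction k) (simp_all add: numeral_2_eq_2 algebra_simps)
  have f1: "f (int k) = of_nat k * w k" for k
    unfolding f_def w_def power tri by (simp add: alt_eq_power mult_ac)
  have f2: "f (- 1 - int k) = of_nat (k + 1) * w k" for k
    unfolding f_def w_def power tri by (auto simp: alt_def mult_ac algebra_simps)
  have norms: "summable (\<lambda>k. norm (of_nat (2 * k + 1) * w k))"
    using jacobi_cube_identity(2)[OF p] by (simp add: w_def mult_ac)
  have s: "(\<lambda>k. of_nat (g k) * w k) summable_on UNIV" if "\<And>k. g k \<le> 2 * k + 1" for g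
  proof (rule norm_summable_imp_summable_on, rule summable_comparison_test[OF _ norms])
    show "\<exists>N. \<forall>n\<ge>N. norm (norm (of_nat (g n) * w n)) \<le> norm (of_nat (2 * n + 1) * w n)"
    proof (intro exI allI impI)
      fix k
      have "real (g k) \<le> real (2 * k + 1)"
        using that[of k] by (rule of_nat_mono)
      then show "norm (norm (of_nat (g k) * w k)) \<le> norm (of_nat (2 * k + 1) * w k)"
        unfolding norm_mult norm_of_nat by (simp add: mult_right_mono)
    qed
  qed
  have s1: "(\<lambda>k. of_nat k * w k) summable_on UNIV" by (rule s) simp
  have s2: "(\<lambda>k. of_nat (k + 1) * w k) summable_on UNIV" by (rule s) simp
  have "infsum f (range int \<union> range (\<lambda>k. - 1 - int k))
      = infsum f (range int) + infsum f (range (\<lambda>k. - 1 - int k))"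
    using s1 s2 by (intro infsum_Un_disjoint)
      (auto simp: summable_on_reindex inj_on_def o_def f1 f2 simp del: of_nat_add of_nat_Suc)
  also have "range int \<union> range (\<lambda>k. - 1 - int k) = UNIV"
  proof -
    have "e \<in> range int \<union> range (\<lambda>k. - 1 - int k)" for e
    proof (cases "0 \<le> e")
      case True
      then have "e = int (nat e)" by simp
      then show ?thesis by blast
    next
      case False
      then have "e = - 1 - int (nat (- 1 - e))" by simp
      then show ?thesis by blast
    qed
    then show ?thesis by blast
  qed
  also have "infsum f (range int) + infsum f (range (\<lambda>k. - 1 - int k))
      = (\<Sum>\<^sub>\<infinity>k. of_nat k * w k) + (\<Sum>\<^sub>\<infinity>k. of_nat (k + 1) * w k)"
    by (simp add: infsum_reindex inj_on_def o_def f1 f2 del: of_nat_add of_nat_Suc)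
  also have "\<dots> = (\<Sum>\<^sub>\<infinity>k. of_nat k * w k + of_nat (k + 1) * w k)"
    by (rule infsum_add[OF s1 s2, symmetric])
  also have "\<dots> = (\<Sum>\<^sub>\<infinity>k. (-1) ^ k * of_nat (2 * k + 1) * p ^ (k + 1 choose 2))"
    by (rule infsum_cong) (simp add: w_def algebra_simps)
  also have "\<dots> = (\<Prod>n. 1 - p ^ Suc n) ^ 3"
    by (rule infsumI, rule norm_summable_imp_has_sum) (rule jacobi_cube_identity[OF p])+
  finally show ?thesis by (simp add: f_def p_def)
qed

lemma alternating_gaussian_zero:
  assumes "odd k"
  shows "(\<Sum>\<^sub>\<infinity>l::int. alt l * ee (of_int (l\<^sup>2 + k * l) * \<tau>)) = 0"
proof (rule infsum_odd_reflection[where k = "- k"])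
  fix l
  have "(- k - l)\<^sup>2 + k * (- k - l) = l\<^sup>2 + k * l"
    by (simp add: power2_eq_square algebra_simps)
  moreover have "alt (- k - l) = - alt l"
    using assms by (auto simp: alt_def)
  ultimately show "alt (- k - l) * ee (of_int ((- k - l)\<^sup>2 + k * (- k - l)) * \<tau>)
      = - (alt l * ee (of_int (l\<^sup>2 + k * l) * \<tau>))"
    by simp
qed

text \<open>
  With \<open>X = ee (\<xi> + 2 j \<tau>)\<close>, the \<open>h\<close>-th term of the theta series times the \<open>j\<close>-th partial fraction
  is a coefficient free of \<open>\<xi>\<close> times \<open>X^h / (1 - X)\<close>. The theta series vanishes at the pole \<open>X = 1\<close>, so
  \<open>X^h\<close> may be replaced by \<open>X^h - X^j\<close>, and the quotient becomes a finite geometric sum of powers \<open>X^t\<close>.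
  Subtracting \<open>X^j\<close>, rather than a fixed power, makes the triple series converge absolutely.
  Collecting the coefficient of each power of \<open>ee \<xi>\<close> gives again a geometric sum in \<open>j\<close>, whose two
  ends are vanishing alternating series, except for \<open>t = - 1\<close>, where the ratio is \<open>1\<close> and the
  sum counts the integers in the interval.
\<close>

theorem theta_series_times_recip:
  assumes tau: "Im \<tau> > 0" and nz: "\<And>j::int. ee (\<xi> + 2 * of_int j * \<tau>) \<noteq> 1"
  shows "theta_series \<tau> \<xi> * theta_recip \<tau> \<xi> = - ee (- \<xi>) * (\<Prod>n. 1 - ee (2 * \<tau>) ^ Suc n) ^ 3"
proof -
  define X where "X = (\<lambda>j::int. ee (\<xi> + 2 * of_int j * \<tau>))"
  have X: "X j \<noteq> 0" "X j \<noteq> 1" for j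
    using nz by (simp_all add: X_def)
  define f where "f = (\<lambda>(j::int) (h::int) (t::int). (of_bool (h \<le> t) - of_bool (j \<le> t)) * alt (h + j)
      * ee (of_int t * \<xi> + of_int ((h - j)\<^sup>2 + h + j + 2 * j * t) * \<tau>))"
  have sf: "(\<lambda>(j, h, t). f j h t) summable_on UNIV"
    unfolding f_def by (rule theta_kernel_summable[OF tau])

  have row: "theta_series \<tau> \<xi> * (alt j * ee (of_int (j * (j + 1)) * \<tau>) / (1 - X j))
      = (\<Sum>\<^sub>\<infinity>h. \<Sum>\<^sub>\<infinity>t. f j h t)" for j
  proof -
    define c where "c = (\<lambda>h. alt (h + j) * ee (of_int ((h - j)\<^sup>2 + h + j) * \<tau>))"
    have 1: "alt h * ee (of_int h * \<xi> + of_int (h * (h + 1)) * \<tau>)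
        * (alt j * ee (of_int (j * (j + 1)) * \<tau>) / (1 - X j)) = c h * (X j powi h / (1 - X j))" for h
    proof -
      have "of_int h * \<xi> + of_int (h * (h + 1)) * \<tau> + of_int (j * (j + 1)) * \<tau>
          = of_int ((h - j)\<^sup>2 + h + j) * \<tau> + of_int h * (\<xi> + 2 * of_int j * \<tau>)"
        by (simp add: power2_eq_square algebra_simps)
      then have "ee (of_int h * \<xi> + of_int (h * (h + 1)) * \<tau>) * ee (of_int (j * (j + 1)) * \<tau>)
          = ee (of_int ((h - j)\<^sup>2 + h + j) * \<tau>) * X j powi h"
        by (simp only: X_def ee_powi flip: ee_add)
      then show ?thesis by (simp add: c_def alt_add mult_ac)
    qed
    have 2: "c h * (X j powi j / (1 - X j))
        = (alt h * ee (of_int (h\<^sup>2 + (1 - 2 * j) * h) * \<tau>))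
          * (alt j * ee (of_int (j\<^sup>2 + j) * \<tau>) * X j powi j / (1 - X j))" for h
    proof -
      have "of_int ((h - j)\<^sup>2 + h + j) * \<tau>
          = of_int (h\<^sup>2 + (1 - 2 * j) * h) * \<tau> + of_int (j\<^sup>2 + j) * \<tau>"
        by (simp add: power2_eq_square algebra_simps)
      then have "ee (of_int ((h - j)\<^sup>2 + h + j) * \<tau>)
          = ee (of_int (h\<^sup>2 + (1 - 2 * j) * h) * \<tau>) * ee (of_int (j\<^sup>2 + j) * \<tau>)"
        by (simp only: flip: ee_add)
      then show ?thesis by (simp add: c_def alt_add mult_ac)
    qed
    have 3: "f j h t = c h * ((of_bool (h \<le> t) - of_bool (j \<le> t)) * X j powi t)" for h t
    proof -
      have "of_int t * \<xi> + of_int ((h - j)\<^sup>2 + h + j + 2 * j * t) * \<tau>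
          = of_int ((h - j)\<^sup>2 + h + j) * \<tau> + of_int t * (\<xi> + 2 * of_int j * \<tau>)"
        by (simp add: algebra_simps)
      then have "ee (of_int t * \<xi> + of_int ((h - j)\<^sup>2 + h + j + 2 * j * t) * \<tau>)
          = ee (of_int ((h - j)\<^sup>2 + h + j) * \<tau>) * X j powi t"
        by (simp only: X_def ee_powi flip: ee_add)
      then show ?thesis
        by (simp only: f_def c_def mult_ac)
    qed
    have "theta_series \<tau> \<xi> * (alt j * ee (of_int (j * (j + 1)) * \<tau>) / (1 - X j))
        = (\<Sum>\<^sub>\<infinity>h. c h * (X j powi h / (1 - X j)))"
      unfolding theta_series_def infsum_cmult_left'[symmetric] 1 ..
    \<comment> \<open>Up to a constant factor, the coefficients \<open>c\<close> add up to the value of the theta series at the pole \<open>X j = 1\<close>.\<close>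
    moreover have "(\<Sum>\<^sub>\<infinity>h. c h * (X j powi j / (1 - X j))) = 0"
      unfolding 2 infsum_cmult_left' by (subst alternating_gaussian_zero) auto
    moreover have "(\<lambda>h. c h * (X j powi h / (1 - X j))) summable_on UNIV"
      using summable_on_cmult_left[OF theta_series_summable[OF tau, of \<xi>]] unfolding 1[symmetric] .
    moreover have "(\<lambda>h. c h * (X j powi j / (1 - X j))) summable_on UNIV"
      unfolding 2
    proof (rule summable_on_cmult_left)
      show "(\<lambda>h. alt h * ee (of_int (h\<^sup>2 + (1 - 2 * j) * h) * \<tau>)) summable_on UNIV"
        using theta_series_summable[OF tau, of "- 2 * of_int j * \<tau>"]
        by (simp add: power2_eq_square algebra_simps)
    qed
    ultimately have "theta_series \<tau> \<xi> * (alt j * ee (of_int (j * (j + 1)) * \<tau>) / (1 - X j))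
        = (\<Sum>\<^sub>\<infinity>h. c h * (X j powi h / (1 - X j)) - c h * (X j powi j / (1 - X j)))"
      by (simp add: infsum_diff)
    also have "\<dots> = (\<Sum>\<^sub>\<infinity>h. \<Sum>\<^sub>\<infinity>t. f j h t)"
    proof (rule infsum_cong)
      fix h
      have "(\<Sum>\<^sub>\<infinity>t. f j h t) = c h * ((X j powi h - X j powi j) / (1 - X j))"
        unfolding 3 infsum_cmult_right' by (simp add: infsumI[OF has_sum_geometric_between[OF X]])
      then show "c h * (X j powi h / (1 - X j)) - c h * (X j powi j / (1 - X j)) = (\<Sum>\<^sub>\<infinity>t. f j h t)"
        by (simp add: diff_divide_distrib right_diff_distrib)
    qed
    finally show ?thesis .
  qed

  have inner: "(\<Sum>\<^sub>\<infinity>e. \<Sum>\<^sub>\<infinity>j. f j (j + e) t) = (if t = - 1 then - ee (- \<xi>) * (\<Prod>n. 1 - ee (2 * \<tau>) ^ Suc n) ^ 3 else 0)"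
    for t
  proof -
    define Y where "Y = ee (2 * of_int (t + 1) * \<tau>)"
    define a where "a = (\<lambda>e::int. alt e * ee (of_int t * \<xi> + of_int (e * (e + 1)) * \<tau>))"
    have f: "f j (j + e) t = a e * ((of_bool (t + 1 \<le> j) - of_bool (t + 1 - e \<le> j)) * Y powi j)" for e j
    proof -
      have "of_int t * \<xi> + of_int ((j + e - j)\<^sup>2 + (j + e) + j + 2 * j * t) * \<tau>
          = (of_int t * \<xi> + of_int (e * (e + 1)) * \<tau>) + of_int j * (2 * of_int (t + 1) * \<tau>)"
        by (simp add: power2_eq_square algebra_simps)
      then have "ee (of_int t * \<xi> + of_int ((j + e - j)\<^sup>2 + (j + e) + j + 2 * j * t) * \<tau>)
          = ee (of_int t * \<xi> + of_int (e * (e + 1)) * \<tau>) * Y powi j"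
        by (simp only: Y_def ee_powi flip: ee_add)
      moreover have "of_bool (j + e \<le> t) - of_bool (j \<le> t)
          = (of_bool (t + 1 \<le> j) - of_bool (t + 1 - e \<le> j) :: complex)"
        by (auto simp: of_bool_def)
      moreover have "alt (j + e + j) = alt e" by (simp add: alt_def)
      ultimately show ?thesis
        by (simp only: f_def a_def mult_ac)
    qed
    show ?thesis
    proof (cases "t = - 1")
      case True
      have "(\<Sum>\<^sub>\<infinity>j::int. (of_bool (t + 1 \<le> j) - of_bool (t + 1 - e \<le> j)) * Y powi j) = - of_int e" for e
        using infsumI[OF has_sum_telescope_between[of of_int "\<lambda>_. 1" "t + 1" "t + 1 - e"]] True
        by (simp add: Y_def)
      then have "(\<Sum>\<^sub>\<infinity>e. \<Sum>\<^sub>\<infinity>j. f j (j + e) t) = (\<Sum>\<^sub>\<infinity>e. a e * - of_int e)"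
        unfolding f infsum_cmult_right' by simp
      also have "\<dots> = (\<Sum>\<^sub>\<infinity>e. - ee (- \<xi>) * (of_int e * alt e * ee (of_int (e * (e + 1)) * \<tau>)))"
        by (rule infsum_cong) (simp add: a_def True ee_diff ee_minus)
      also have "\<dots> = - ee (- \<xi>) * (\<Prod>n. 1 - ee (2 * \<tau>) ^ Suc n) ^ 3"
        unfolding infsum_cmult_right' jacobi_cube_int[OF tau] ..
      finally show ?thesis by (simp add: True)
    next
      case False
      have Y: "Y \<noteq> 0" "Y \<noteq> 1"
      proof -
        define k where "k = t + 1"
        have "k \<noteq> 0" using False by (simp add: k_def)
        then have "norm Y \<noteq> 1"
          using tau unfolding Y_def k_def[symmetric] norm_ee by simp
        then show "Y \<noteq> 1" by auto
      qed (simp add: Y_def)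
      have "(\<Sum>\<^sub>\<infinity>e. \<Sum>\<^sub>\<infinity>j. f j (j + e) t) = (\<Sum>\<^sub>\<infinity>e. a e * ((Y powi (t + 1) - Y powi (t + 1 - e)) / (1 - Y)))"
        unfolding f infsum_cmult_right' by (simp add: infsumI[OF has_sum_geometric_between[OF Y]])
      also have "\<dots> = (\<Sum>\<^sub>\<infinity>e. alt e * ee (of_int (e\<^sup>2 + 1 * e) * \<tau>) * (ee (of_int t * \<xi>) * Y powi (t + 1) / (1 - Y))
           - alt e * ee (of_int (e\<^sup>2 + (- 1 - 2 * t) * e) * \<tau>) * (ee (of_int t * \<xi>) * Y powi (t + 1) / (1 - Y)))"
      proof (rule infsum_cong)
        fix e
        have 1: "a e = alt e * ee (of_int (e\<^sup>2 + 1 * e) * \<tau>) * ee (of_int t * \<xi>)"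
          by (simp add: a_def ee_add power2_eq_square algebra_simps)
        have "of_int (e\<^sup>2 + 1 * e) * \<tau> + of_int (t + 1 - e) * (2 * of_int (t + 1) * \<tau>)
          = of_int (e\<^sup>2 + (- 1 - 2 * t) * e) * \<tau> + of_int (t + 1) * (2 * of_int (t + 1) * \<tau>)"
          by (simp add: power2_eq_square algebra_simps)
        then have 2: "ee (of_int (e\<^sup>2 + 1 * e) * \<tau>) * Y powi (t + 1 - e)
          = ee (of_int (e\<^sup>2 + (- 1 - 2 * t) * e) * \<tau>) * Y powi (t + 1)"
          by (simp only: Y_def ee_powi flip: ee_add)
        have "a e * ((Y powi (t + 1) - Y powi (t + 1 - e)) / (1 - Y))
            = alt e * ee (of_int (e\<^sup>2 + 1 * e) * \<tau>) * (ee (of_int t * \<xi>) * Y powi (t + 1) / (1 - Y))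
              - alt e * (ee (of_int (e\<^sup>2 + 1 * e) * \<tau>) * Y powi (t + 1 - e)) * (ee (of_int t * \<xi>) / (1 - Y))"
          unfolding 1 by (simp add: diff_divide_distrib right_diff_distrib mult_ac)
        also have "\<dots> = alt e * ee (of_int (e\<^sup>2 + 1 * e) * \<tau>) * (ee (of_int t * \<xi>) * Y powi (t + 1) / (1 - Y))
           - alt e * ee (of_int (e\<^sup>2 + (- 1 - 2 * t) * e) * \<tau>) * (ee (of_int t * \<xi>) * Y powi (t + 1) / (1 - Y))"
          unfolding 2 by (simp add: mult_ac)
        finally show "a e * ((Y powi (t + 1) - Y powi (t + 1 - e)) / (1 - Y)) = \<dots>" .
      qed
      also have "\<dots> = (\<Sum>\<^sub>\<infinity>e. alt e * ee (of_int (e\<^sup>2 + 1 * e) * \<tau>) * (ee (of_int t * \<xi>) * Y powi (t + 1) / (1 - Y)))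
           - (\<Sum>\<^sub>\<infinity>e. alt e * ee (of_int (e\<^sup>2 + (- 1 - 2 * t) * e) * \<tau>) * (ee (of_int t * \<xi>) * Y powi (t + 1) / (1 - Y)))"
      proof (intro infsum_diff summable_on_cmult_left)
        show "(\<lambda>e. alt e * ee (of_int (e\<^sup>2 + 1 * e) * \<tau>)) summable_on UNIV"
          using theta_series_summable[OF tau, of 0] by (simp add: power2_eq_square algebra_simps)
        show "(\<lambda>e. alt e * ee (of_int (e\<^sup>2 + (- 1 - 2 * t) * e) * \<tau>)) summable_on UNIV"
          using theta_series_summable[OF tau, of "of_int (- 2 - 2 * t) * \<tau>"]
          by (simp add: power2_eq_square algebra_simps)
      qed
      also have "\<dots> = 0"
      proof -
        have "odd (- 1 - 2 * t)" by simp
        from alternating_gaussian_zero[OF this] alternating_gaussian_zero[OF odd_one]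
        show ?thesis unfolding infsum_cmult_left' by (simp only: mult_zero_left diff_self)
      qed
      finally show ?thesis using False by simp
    qed
  qed

  have "theta_series \<tau> \<xi> * theta_recip \<tau> \<xi> = (\<Sum>\<^sub>\<infinity>j. \<Sum>\<^sub>\<infinity>h. \<Sum>\<^sub>\<infinity>t. f j h t)"
    unfolding theta_recip_def infsum_cmult_right'[symmetric] row[unfolded X_def] ..
  also have "\<dots> = (\<Sum>\<^sub>\<infinity>(j, h, t). f j h t)"
    by (rule infsum_triples[OF sf, symmetric])
  \<comment> \<open>For fixed \<open>t\<close> and \<open>e = h - j\<close> the exponent is linear in \<open>j\<close>.\<close>
  also have "\<dots> = (\<Sum>\<^sub>\<infinity>(t, e, j). f j (j + e) t)"
    by (rule infsum_reindex_bij_witness[where i = "\<lambda>(t, e, j). (j, j + e, t)" and j = "\<lambda>(j, h, t). (t, h - j, j)"]) auto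
  also have "\<dots> = (\<Sum>\<^sub>\<infinity>t. \<Sum>\<^sub>\<infinity>e. \<Sum>\<^sub>\<infinity>j. f j (j + e) t)"
  proof (rule infsum_triples)
    have "(\<lambda>(j, h, t). f j h t) summable_on UNIV \<longleftrightarrow> (\<lambda>(t, e, j). f j (j + e) t) summable_on UNIV"
      by (rule summable_on_reindex_bij_witness[where i = "\<lambda>(t, e, j). (j, j + e, t)" and j = "\<lambda>(j, h, t). (t, h - j, j)"]) auto
    then show "(\<lambda>(t, e, j). f j (j + e) t) summable_on UNIV" using sf by simp
  qed
  also have "\<dots> = - ee (- \<xi>) * (\<Prod>n. 1 - ee (2 * \<tau>) ^ Suc n) ^ 3"
    unfolding inner by (rule infsumI, rule has_sum_finite_neutralI[where B = "{- 1}"]) auto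
  finally show ?thesis .
qed

section \<open>Expansion of the Appell sum against a theta function\<close>

text \<open>
  Apart from \<open>theta_factor\<close> below, \<open>denom_theta\<close> is the series \<open>\<theta>\<^sup>(\<^sup>-\<^sup>)\<close> by which \<open>\<Phi>\<close> is multiplied,
  \<open>numer_theta\<close> the one in the numerators of the theta quotients (without a power of \<open>v w\<close>), and
  \<open>appell_sum\<close> is one half of \<open>\<Phi>\<close>. The series \<open>class_theta\<close> is the ordinary theta series
  over the residue class of \<open>t\<close> modulo \<open>n\<close>, normalised to have integral exponents.
\<close>

definition denom_theta :: "complex \<Rightarrow> int \<Rightarrow> complex \<Rightarrow> complex" where
  "denom_theta \<tau> n d = (\<Sum>\<^sub>\<infinity>l::int. alt l * ee (of_int (n * l) * d + of_int ((n + 1) * l\<^sup>2 - n * l) * \<tau>))"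

definition appell_sum :: "complex \<Rightarrow> int \<Rightarrow> complex \<Rightarrow> complex \<Rightarrow> complex" where
  "appell_sum \<tau> n d s = (\<Sum>\<^sub>\<infinity>j::int. ee (of_int (n * j) * s + of_int (n * j\<^sup>2) * \<tau>)
     / (1 - ee (d + s + 2 * of_int j * \<tau>)))"

definition numer_theta :: "complex \<Rightarrow> int \<Rightarrow> complex \<Rightarrow> complex \<Rightarrow> complex" where
  "numer_theta \<tau> n d s = (\<Sum>\<^sub>\<infinity>i::int. alt i * ee (of_int i * d + of_int ((n + 1) * i) * s + of_int ((n + 1) * i\<^sup>2 + n * i) * \<tau>))"

definition class_theta :: "complex \<Rightarrow> int \<Rightarrow> complex \<Rightarrow> int \<Rightarrow> complex" where
  "class_theta \<tau> n s t = (\<Sum>\<^sub>\<infinity>i::int. ee (of_int (n * i + t) * s + of_int (n * i\<^sup>2 + 2 * i * t) * \<tau>))"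

lemma int_abs_le_mult: "n \<ge> 1 \<Longrightarrow> \<bar>k\<bar> \<le> \<bar>n * k\<bar>" for n k :: int
  by (simp add: abs_mult mult_le_cancel_right1)

lemma abs_bound:
  fixes a b c i t :: int
  assumes "\<bar>i\<bar> \<le> \<bar>a - b + c\<bar>" "t = b - a + i"
  shows "\<bar>t\<bar> + \<bar>c\<bar> \<le> 4 * (\<bar>a\<bar> + \<bar>b\<bar> + \<bar>c\<bar>)"
proof -
  have "\<bar>i\<bar> \<le> \<bar>a\<bar> + \<bar>b\<bar> + \<bar>c\<bar>" "\<bar>t\<bar> \<le> \<bar>a\<bar> + \<bar>b\<bar> + \<bar>i\<bar>"
    using assms by arith+
  then show ?thesis using abs_ge_zero[of a] abs_ge_zero[of b] unfolding distrib_left by linarith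
qed

lemma summable_ee_int:
  fixes u :: "int \<Rightarrow> complex"
  assumes tau: "Im \<tau> > 0" and u: "\<And>j. norm (u j) \<le> U" and c: "c \<ge> 1"
  shows "(\<lambda>j. u j * ee (of_int (a * j) * d + of_int (b * j) * s + of_int (c * j\<^sup>2 + e * j) * \<tau>)) summable_on UNIV"
proof -
  have "(\<lambda>j. u j * ee (of_int (a * j) * d + of_int (b * j) * s
      + of_real (of_int (c * j\<^sup>2 + e * j)) * \<tau>)) summable_on UNIV"
  proof (rule ee_summable[where \<phi> = "\<lambda>h::int. h" and \<psi> = "\<lambda>_. 0" and \<omega> = "\<lambda>_. 0" and U = U
      and W = "\<lambda>j. (\<bar>a\<bar> + \<bar>b\<bar> + \<bar>e\<bar>) * \<bar>j\<bar>" and F = "\<bar>a\<bar> + \<bar>b\<bar> + \<bar>e\<bar>" and D = 1 and E = 1, OF tau _ u])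
    fix j :: int
    show "\<bar>a * j\<bar> + \<bar>b * j\<bar> \<le> (\<bar>a\<bar> + \<bar>b\<bar> + \<bar>e\<bar>) * \<bar>j\<bar>"
      by (simp add: abs_mult algebra_simps)
    have "j\<^sup>2 \<le> c * j\<^sup>2"
      using c mult_right_mono[of 1 c "j\<^sup>2"] by simp
    moreover have "- (e * j) \<le> \<bar>e\<bar> * \<bar>j\<bar>"
      using abs_ge_minus_self[of "e * j"] by (simp add: abs_mult)
    moreover have "0 \<le> \<bar>a\<bar> * \<bar>j\<bar>" "0 \<le> \<bar>b\<bar> * \<bar>j\<bar>" by simp_all
    ultimately have "j\<^sup>2 + 0\<^sup>2 + 0\<^sup>2 \<le> c * j\<^sup>2 + e * j + (\<bar>a\<bar> + \<bar>b\<bar> + \<bar>e\<bar>) * \<bar>j\<bar>"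
      unfolding distrib_right power2_eq_square[of "0::int"] mult_zero_left by linarith
    then show "of_int (j\<^sup>2 + 0\<^sup>2 + 0\<^sup>2) \<le> 1 * of_int (c * j\<^sup>2 + e * j)
        + 1 * real_of_int ((\<bar>a\<bar> + \<bar>b\<bar> + \<bar>e\<bar>) * \<bar>j\<bar>)"
      unfolding mult_1 of_int_add[symmetric] of_int_le_iff .
  qed (auto simp: inj_def)
  then show ?thesis by simp
qed

text \<open>
  On the support of the sign factor, \<open>t\<close> lies between \<open>n l\<close> and \<open>N + i\<close>, and the quadratic part of
  the exponent satisfies
  \<open>(n + 1) (l^2 + n i^2 + 2 (l + i) t) = n (l + i)^2 + (l + t)^2 + (n i + t)^2 + 2 (t - n l) (i - t)\<close>.
\<close>

lemma appell_kernel_summable: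
  assumes tau: "Im \<tau> > 0" and n: "n \<ge> 1" and N: "n + 1 = 2 * N"
  shows "(\<lambda>(l::int, i::int, t::int). (of_bool (n * l \<le> t) - of_bool (N + i \<le> t)) * alt l
      * ee (of_int t * d + of_int (n * i + t) * s
          + of_int (l\<^sup>2 - n * l + n * i\<^sup>2 + 2 * (l + i) * t) * \<tau>)) summable_on UNIV"
proof -
  define u where "u = (\<lambda>(l, i, t). (of_bool (n * l \<le> t) - of_bool (N + i \<le> t)) * alt l)"
  have "(\<lambda>x. u x * ee (of_int (case x of (l, i, t) \<Rightarrow> t) * d + of_int (case x of (l, i, t) \<Rightarrow> n * i + t) * s
      + of_real (of_int (case x of (l, i, t) \<Rightarrow> l\<^sup>2 - n * l + n * i\<^sup>2 + 2 * (l + i) * t)) * \<tau>)) summable_on UNIV"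
  proof (rule ee_summable[where \<phi> = "\<lambda>(l, i, t). l + i" and \<psi> = "\<lambda>(l, i, t). l + t"
        and \<omega> = "\<lambda>(l, i, t). n * i + t" and W = "\<lambda>(l, i, t). \<bar>t\<bar> + \<bar>n * i + t\<bar>" and F = 4
        and D = "of_int (n + 1)" and E = "of_int (n + 1)" and U = 1, OF tau])
    have i_eq: "(n + 1) * i = (l + i) - (l + t) + (n * i + t)" for l i t
      by (simp add: algebra_simps)
    show "inj (\<lambda>x. (case x of (l, i, t) \<Rightarrow> l + i, case x of (l, i, t) \<Rightarrow> l + t,
            case x of (l, i, t) \<Rightarrow> n * i + t))"
    proof (rule injI)
      fix y z :: "int \<times> int \<times> int"
      obtain l i t l' i' t' where yz: "y = (l, i, t)" "z = (l', i', t')" by (cases y, cases z)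
      assume "(case y of (l, i, t) \<Rightarrow> l + i, case y of (l, i, t) \<Rightarrow> l + t, case y of (l, i, t) \<Rightarrow> n * i + t)
        = (case z of (l, i, t) \<Rightarrow> l + i, case z of (l, i, t) \<Rightarrow> l + t, case z of (l, i, t) \<Rightarrow> n * i + t)"
      then have eq: "l + i = l' + i'" "l + t = l' + t'" "n * i + t = n * i' + t'"
        by (auto simp: yz)
      then have "(n + 1) * i = (n + 1) * i'"
        using i_eq[of i l t] i_eq[of i' l' t'] by simp
      then show "y = z" using n eq by (simp add: yz)
    qed
    fix x :: "int \<times> int \<times> int"
    obtain l i t where x: "x = (l, i, t)" by (cases x)
    show "norm (u x) \<le> 1" by (auto simp: x u_def norm_mult)
    have "\<bar>i\<bar> \<le> \<bar>(l + i) - (l + t) + (n * i + t)\<bar>"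
      using int_abs_le_mult[of "n + 1" i] n unfolding i_eq[of i l t] by simp
    moreover have "t = (l + t) - (l + i) + i" by simp
    ultimately have "\<bar>t\<bar> + \<bar>n * i + t\<bar> \<le> 4 * (\<bar>l + i\<bar> + \<bar>l + t\<bar> + \<bar>n * i + t\<bar>)"
      by (rule abs_bound)
    then show "(case x of (l, i, t) \<Rightarrow> \<bar>t\<bar> + \<bar>n * i + t\<bar>) \<le> 4 * (\<bar>case x of (l, i, t) \<Rightarrow> l + i\<bar>
        + \<bar>case x of (l, i, t) \<Rightarrow> l + t\<bar> + \<bar>case x of (l, i, t) \<Rightarrow> n * i + t\<bar>)"
      by (simp only: x prod.case)
    assume "u x \<noteq> 0"
    then have "n * l \<le> t \<and> t < N + i \<or> N + i \<le> t \<and> t < n * l"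
      by (auto simp: x u_def of_bool_def split: if_splits)
    then have "0 \<le> (t - n * l) * (N + i - t)"
      by (auto intro: mult_nonneg_nonneg mult_nonpos_nonpos)
    moreover have "(n + 1) * (l\<^sup>2 - n * l + n * i\<^sup>2 + 2 * (l + i) * t) + (n + 1) * t
        = n * (l + i)\<^sup>2 + (l + t)\<^sup>2 + (n * i + t)\<^sup>2 + 2 * ((t - n * l) * (N + i - t))"
      unfolding right_diff_distrib[of "t - n * l"] distrib_left[of "t - n * l"]
      using N by algebra
    moreover have "(l + i)\<^sup>2 \<le> n * (l + i)\<^sup>2"
      using n mult_right_mono[of 1 n "(l + i)\<^sup>2"] by simp
    moreover have "(n + 1) * t \<le> (n + 1) * (\<bar>t\<bar> + \<bar>n * i + t\<bar>)"
      using n by (intro mult_left_mono) auto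
    ultimately have "(l + i)\<^sup>2 + (l + t)\<^sup>2 + (n * i + t)\<^sup>2
        \<le> (n + 1) * (l\<^sup>2 - n * l + n * i\<^sup>2 + 2 * (l + i) * t) + (n + 1) * (\<bar>t\<bar> + \<bar>n * i + t\<bar>)"
      by linarith
    then show "of_int ((case x of (l, i, t) \<Rightarrow> l + i)\<^sup>2 + (case x of (l, i, t) \<Rightarrow> l + t)\<^sup>2
          + (case x of (l, i, t) \<Rightarrow> n * i + t)\<^sup>2)
        \<le> of_int (n + 1) * of_int (case x of (l, i, t) \<Rightarrow> l\<^sup>2 - n * l + n * i\<^sup>2 + 2 * (l + i) * t)
          + of_int (n + 1) * real_of_int (case x of (l, i, t) \<Rightarrow> \<bar>t\<bar> + \<bar>n * i + t\<bar>)"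
      unfolding x prod.case of_int_mult[symmetric] of_int_add[symmetric] of_int_le_iff .
  qed (use n in auto)
  then show ?thesis
    by (simp add: u_def case_prod_unfold)
qed

text \<open>
  The same with the cut at \<open>N\<close>, where
  \<open>n (l^2 + n i^2 + 2 (l + i) t) = n l^2 + t^2 + (n i + t)^2 + 2 (t - n l) (0 - t)\<close>.
\<close>

lemma appell_kernel_fixed_cut_summable:
  assumes tau: "Im \<tau> > 0" and n: "n \<ge> 1" and N: "n + 1 = 2 * N"
  shows "(\<lambda>(t::int, l::int, i::int). (of_bool (n * l \<le> t) - of_bool (N \<le> t)) * alt l
      * ee (of_int t * d + of_int (n * i + t) * s
          + of_int (l\<^sup>2 - n * l + n * i\<^sup>2 + 2 * (l + i) * t) * \<tau>)) summable_on UNIV"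
proof -
  define u where "u = (\<lambda>(t, l, i::int). (of_bool (n * l \<le> t) - of_bool (N \<le> t)) * alt l)"
  have "(\<lambda>x. u x * ee (of_int (case x of (t, l, i) \<Rightarrow> t) * d + of_int (case x of (t, l, i) \<Rightarrow> n * i + t) * s
      + of_real (of_int (case x of (t, l, i) \<Rightarrow> l\<^sup>2 - n * l + n * i\<^sup>2 + 2 * (l + i) * t)) * \<tau>)) summable_on UNIV"
  proof (rule ee_summable[where \<phi> = "\<lambda>(t, l, i). l" and \<psi> = "\<lambda>(t, l, i). t"
        and \<omega> = "\<lambda>(t, l, i). n * i + t" and W = "\<lambda>(t, l, i). \<bar>t\<bar> + \<bar>n * i + t\<bar> + \<bar>l\<bar>" and F = 1
        and D = "of_int n" and E = "of_int (n + 1)" and U = 1, OF tau])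
    show "inj (\<lambda>x. (case x of (t, l, i) \<Rightarrow> l, case x of (t, l, i) \<Rightarrow> t,
            case x of (t, l, i) \<Rightarrow> n * i + t))"
      using n by (auto simp: inj_def)
    fix x :: "int \<times> int \<times> int"
    obtain t l i where x: "x = (t, l, i)" by (cases x)
    show "norm (u x) \<le> 1" by (auto simp: x u_def norm_mult)
    assume "u x \<noteq> 0"
    then have "n * l \<le> t \<and> t < N \<or> N \<le> t \<and> t < n * l"
      by (auto simp: x u_def of_bool_def split: if_splits)
    then have "0 \<le> (t - n * l) * (N - t)"
      by (auto intro: mult_nonneg_nonneg mult_nonpos_nonpos)
    moreover have "n * (l\<^sup>2 - n * l + n * i\<^sup>2 + 2 * (l + i) * t) + ((n + 1) * t - n * l)
        = n * l\<^sup>2 + t\<^sup>2 + (n * i + t)\<^sup>2 + 2 * ((t - n * l) * (N - t))"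
      using N by algebra
    moreover have "l\<^sup>2 \<le> n * l\<^sup>2"
      using n mult_right_mono[of 1 n "l\<^sup>2"] by simp
    moreover have "(n + 1) * t - n * l \<le> (n + 1) * (\<bar>t\<bar> + \<bar>n * i + t\<bar> + \<bar>l\<bar>)"
    proof -
      have "(n + 1) * t \<le> (n + 1) * \<bar>t\<bar>" by (rule mult_left_mono) (use n in auto)
      moreover have "n * (- l) \<le> n * \<bar>l\<bar>" by (rule mult_left_mono) (use n in auto)
      moreover have "0 \<le> (n + 1) * \<bar>n * i + t\<bar>" using n by simp
      moreover have "n * \<bar>l\<bar> \<le> (n + 1) * \<bar>l\<bar>" by (rule mult_right_mono) auto
      ultimately show ?thesis unfolding distrib_left[of "n + 1"] mult_minus_right by linarith
    qed
    ultimately have "l\<^sup>2 + t\<^sup>2 + (n * i + t)\<^sup>2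
        \<le> n * (l\<^sup>2 - n * l + n * i\<^sup>2 + 2 * (l + i) * t) + (n + 1) * (\<bar>t\<bar> + \<bar>n * i + t\<bar> + \<bar>l\<bar>)"
      by linarith
    then show "of_int ((case x of (t, l, i) \<Rightarrow> l)\<^sup>2 + (case x of (t, l, i) \<Rightarrow> t)\<^sup>2
          + (case x of (t, l, i) \<Rightarrow> n * i + t)\<^sup>2)
        \<le> of_int n * of_int (case x of (t, l, i) \<Rightarrow> l\<^sup>2 - n * l + n * i\<^sup>2 + 2 * (l + i) * t)
          + of_int (n + 1) * real_of_int (case x of (t, l, i) \<Rightarrow> \<bar>t\<bar> + \<bar>n * i + t\<bar> + \<bar>l\<bar>)"
      unfolding x prod.case of_int_mult[symmetric] of_int_add[symmetric] of_int_le_iff .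
  qed (use n in auto)
  then show ?thesis
    by (simp add: u_def case_prod_unfold)
qed

text \<open>
  The two products are double series over \<open>(l, j)\<close> and \<open>(i, j)\<close>; putting \<open>j = l + i\<close> in both matches
  terms with the same pole and the same residue. The combined term is a finite geometric sum,
  and the resulting triple series is rearranged so that \<open>l\<close> is summed first, which allows
  the cut to be moved from \<open>N + i\<close> to \<open>N\<close>, and then so that \<open>i\<close> is summed first.
\<close>

theorem appell_sum_expansion:
  assumes tau: "Im \<tau> > 0" and n: "n \<ge> 1" and N: "n + 1 = 2 * N"
    and nz: "\<And>j::int. ee (d + s + 2 * of_int j * \<tau>) \<noteq> 1"
  defines "c \<equiv> \<lambda>t l. (of_bool (n * l \<le> t) - of_bool (N \<le> t)) * alt l
      * ee (of_int t * d + of_int (l\<^sup>2 - n * l + 2 * l * t) * \<tau>)"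
  shows "(\<lambda>(t, l). c t l * class_theta \<tau> n s t) summable_on UNIV"
    and "denom_theta \<tau> n d * appell_sum \<tau> n d s
      - ee (of_int N * (d + s)) * (numer_theta \<tau> n d s * theta_recip \<tau> (d + s))
      = (\<Sum>\<^sub>\<infinity>(t, l). c t l * class_theta \<tau> n s t)"
proof -
  define X where "X = (\<lambda>j::int. ee (d + s + 2 * of_int j * \<tau>))"
  have X: "X j \<noteq> 0" "X j \<noteq> 1" for j
    using nz by (simp_all add: X_def)
  obtain C where C: "norm (1 / (1 - X j)) \<le> C" for j
    using inverse_one_minus_ee_bounded[OF tau nz] unfolding X_def by blast
  define a where "a = (\<lambda>l::int. alt l * ee (of_int (n * l) * d + of_int ((n + 1) * l\<^sup>2 - n * l) * \<tau>))"
  define b where "b = (\<lambda>j::int. ee (of_int (n * j) * s + of_int (n * j\<^sup>2) * \<tau>) / (1 - X j))"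
  define a' where "a' = (\<lambda>i::int. alt i * ee (of_int i * d + of_int ((n + 1) * i) * s + of_int ((n + 1) * i\<^sup>2 + n * i) * \<tau>))"
  define b' where "b' = (\<lambda>j::int. alt j * ee (of_int (j * (j + 1)) * \<tau>) / (1 - X j))"
  have sa: "a summable_on UNIV"
    using summable_ee_int[OF tau, where u = alt and U = 1 and c = "n + 1" and e = "- n" and a = n and b = 0] n
    by (simp add: a_def)
  have sb: "b summable_on UNIV"
    using summable_ee_int[OF tau C, where c = n and e = 0 and a = n and b = 0 and d = s] n
    by (simp add: b_def)
  have sa': "a' summable_on UNIV"
    using summable_ee_int[OF tau, where u = alt and U = 1 and c = "n + 1" and e = n and a = 1 and b = "n + 1"] n
    by (simp add: a'_def)
  have sb': "b' summable_on UNIV"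
    unfolding b'_def X_def by (rule theta_recip_summable[OF tau nz])

  define f where "f = (\<lambda>(l::int) (i::int) (t::int). (of_bool (n * l \<le> t) - of_bool (N + i \<le> t)) * alt l
      * ee (of_int t * d + of_int (n * i + t) * s
          + of_int (l\<^sup>2 - n * l + n * i\<^sup>2 + 2 * (l + i) * t) * \<tau>))"
  have sf: "(\<lambda>(l, i, t). f l i t) summable_on UNIV"
    unfolding f_def by (rule appell_kernel_summable[OF tau n N])
  define g where "g = (\<lambda>(t::int) (l::int) (i::int). (of_bool (n * l \<le> t) - of_bool (N \<le> t)) * alt l
      * ee (of_int t * d + of_int (n * i + t) * s
          + of_int (l\<^sup>2 - n * l + n * i\<^sup>2 + 2 * (l + i) * t) * \<tau>))"
  have sg: "(\<lambda>(t, l, i). g t l i) summable_on UNIV"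
    unfolding g_def by (rule appell_kernel_fixed_cut_summable[OF tau n N])

  define w where "w = (\<lambda>l i. alt l * ee (of_int (n * i) * s + of_int (l\<^sup>2 - n * l + n * i\<^sup>2) * \<tau>))"
  \<comment> \<open>Under the substitution \<open>j = l + i\<close> the two products have the same coefficient \<open>w\<close> at the pole of \<open>X (l + i)\<close>.\<close>
  have ab: "a l * b (l + i) = w l i * (X (l + i) powi (n * l) / (1 - X (l + i)))" for l i
  proof -
    have "(of_int (n * l) * d + of_int ((n + 1) * l\<^sup>2 - n * l) * \<tau>)
          + (of_int (n * (l + i)) * s + of_int (n * (l + i)\<^sup>2) * \<tau>)
        = (of_int (n * i) * s + of_int (l\<^sup>2 - n * l + n * i\<^sup>2) * \<tau>)
          + of_int (n * l) * (d + s + 2 * of_int (l + i) * \<tau>)"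
      by (simp add: power2_eq_square algebra_simps)
    then have "ee (of_int (n * l) * d + of_int ((n + 1) * l\<^sup>2 - n * l) * \<tau>)
          * ee (of_int (n * (l + i)) * s + of_int (n * (l + i)\<^sup>2) * \<tau>)
        = ee (of_int (n * i) * s + of_int (l\<^sup>2 - n * l + n * i\<^sup>2) * \<tau>) * X (l + i) powi (n * l)"
      by (simp only: X_def ee_powi flip: ee_add)
    then show ?thesis by (simp add: a_def b_def w_def mult_ac)
  qed
  have ab': "ee (of_int N * (d + s)) * (a' i * b' (l + i)) = w l i * (X (l + i) powi (N + i) / (1 - X (l + i)))" for l i
  proof -
    have N': "of_int n = (2 * of_int N - 1 :: complex)"
      using arg_cong[OF N, of "of_int :: int \<Rightarrow> complex"] by (simp add: algebra_simps)
    have "of_int N * (d + s)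
          + (of_int i * d + of_int ((n + 1) * i) * s + of_int ((n + 1) * i\<^sup>2 + n * i) * \<tau>)
          + of_int ((l + i) * (l + i + 1)) * \<tau>
        = (of_int (n * i) * s + of_int (l\<^sup>2 - n * l + n * i\<^sup>2) * \<tau>)
          + of_int (N + i) * (d + s + 2 * of_int (l + i) * \<tau>)"
      by (simp add: power2_eq_square algebra_simps N')
    then have *: "ee (of_int N * (d + s))
          * ee (of_int i * d + of_int ((n + 1) * i) * s + of_int ((n + 1) * i\<^sup>2 + n * i) * \<tau>)
          * ee (of_int ((l + i) * (l + i + 1)) * \<tau>)
        = ee (of_int (n * i) * s + of_int (l\<^sup>2 - n * l + n * i\<^sup>2) * \<tau>) * X (l + i) powi (N + i)"
      by (simp only: X_def ee_powi flip: ee_add)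
    have "alt i * alt (l + i) = alt l" by (auto simp: alt_def)
    then have "ee (of_int N * (d + s)) * (a' i * b' (l + i)) = alt l * (ee (of_int N * (d + s))
          * ee (of_int i * d + of_int ((n + 1) * i) * s + of_int ((n + 1) * i\<^sup>2 + n * i) * \<tau>)
          * ee (of_int ((l + i) * (l + i + 1)) * \<tau>)) / (1 - X (l + i))"
      by (simp add: a'_def b'_def mult_ac flip: \<open>alt i * alt (l + i) = alt l\<close>)
    then show ?thesis unfolding * by (simp add: w_def mult_ac)
  qed
  have f: "f l i t = w l i * ((of_bool (n * l \<le> t) - of_bool (N + i \<le> t)) * X (l + i) powi t)" for l i t
  proof -
    have "of_int t * d + of_int (n * i + t) * s + of_int (l\<^sup>2 - n * l + n * i\<^sup>2 + 2 * (l + i) * t) * \<tau>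
        = (of_int (n * i) * s + of_int (l\<^sup>2 - n * l + n * i\<^sup>2) * \<tau>) + of_int t * (d + s + 2 * of_int (l + i) * \<tau>)"
      by (simp add: power2_eq_square algebra_simps)
    then have "ee (of_int t * d + of_int (n * i + t) * s + of_int (l\<^sup>2 - n * l + n * i\<^sup>2 + 2 * (l + i) * t) * \<tau>)
        = ee (of_int (n * i) * s + of_int (l\<^sup>2 - n * l + n * i\<^sup>2) * \<tau>) * X (l + i) powi t"
      by (simp only: X_def ee_powi flip: ee_add)
    then show ?thesis by (simp only: f_def w_def mult_ac)
  qed

  have "denom_theta \<tau> n d * appell_sum \<tau> n d s = (\<Sum>\<^sub>\<infinity>(l, j). a l * b j)"
    unfolding infsum_times(2)[OF sa sb] by (simp add: denom_theta_def appell_sum_def a_def b_def X_def)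
  also have "\<dots> = (\<Sum>\<^sub>\<infinity>(l, i). a l * b (l + i))"
    by (rule infsum_reindex_bij_witness[where i = "\<lambda>(l, i). (l, l + i)" and j = "\<lambda>(l, j). (l, j - l)"]) auto
  finally have lhs1: "denom_theta \<tau> n d * appell_sum \<tau> n d s = (\<Sum>\<^sub>\<infinity>(l, i). a l * b (l + i))" .
  have "numer_theta \<tau> n d s * theta_recip \<tau> (d + s) = (\<Sum>\<^sub>\<infinity>(i, j). a' i * b' j)"
    unfolding infsum_times(2)[OF sa' sb'] by (simp add: numer_theta_def theta_recip_def a'_def b'_def X_def)
  also have "\<dots> = (\<Sum>\<^sub>\<infinity>(l, i). a' i * b' (l + i))"
    by (rule infsum_reindex_bij_witness[where i = "\<lambda>(l, i). (i, l + i)" and j = "\<lambda>(i, j). (j - i, i)"]) auto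
  finally have lhs2: "ee (of_int N * (d + s)) * (numer_theta \<tau> n d s * theta_recip \<tau> (d + s))
      = (\<Sum>\<^sub>\<infinity>(l, i). ee (of_int N * (d + s)) * (a' i * b' (l + i)))"
    by (simp add: case_prod_unfold infsum_cmult_right')
  have s1: "(\<lambda>(l, i). a l * b (l + i)) summable_on UNIV"
    using infsum_times(1)[OF sa sb]
      summable_on_reindex_bij_witness[where i = "\<lambda>(l, i). (l, l + i)" and j = "\<lambda>(l, j). (l, j - l)"
        and S = UNIV and T = UNIV and g = "\<lambda>(l, j). a l * b j" and h = "\<lambda>(l, i). a l * b (l + i)"]
    by auto
  have "(\<lambda>(l, i). a' i * b' (l + i)) summable_on UNIV"
    using infsum_times(1)[OF sa' sb']
      summable_on_reindex_bij_witness[where i = "\<lambda>(l, i). (i, l + i)" and j = "\<lambda>(i, j). (j - i, i)"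
        and S = UNIV and T = UNIV and g = "\<lambda>(i, j). a' i * b' j" and h = "\<lambda>(l, i). a' i * b' (l + i)"]
    by auto
  from summable_on_cmult_right[OF this, of "ee (of_int N * (d + s))"]
  have s2: "(\<lambda>(l, i). ee (of_int N * (d + s)) * (a' i * b' (l + i))) summable_on UNIV"
    by (simp add: case_prod_unfold)
  have "denom_theta \<tau> n d * appell_sum \<tau> n d s
      - ee (of_int N * (d + s)) * (numer_theta \<tau> n d s * theta_recip \<tau> (d + s))
      = (\<Sum>\<^sub>\<infinity>(l, i). a l * b (l + i) - ee (of_int N * (d + s)) * (a' i * b' (l + i)))"
    unfolding lhs1 lhs2 infsum_diff[OF s1 s2, symmetric] by (simp add: case_prod_unfold)
  also have "\<dots> = (\<Sum>\<^sub>\<infinity>(l, i). \<Sum>\<^sub>\<infinity>t. f l i t)"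
  proof (rule infsum_cong, clarify)
    fix l i
    have "(\<Sum>\<^sub>\<infinity>t. f l i t) = w l i * ((X (l + i) powi (n * l) - X (l + i) powi (N + i)) / (1 - X (l + i)))"
      unfolding f infsum_cmult_right' by (simp only: infsumI[OF has_sum_geometric_between[OF X]])
    then show "a l * b (l + i) - ee (of_int N * (d + s)) * (a' i * b' (l + i)) = (\<Sum>\<^sub>\<infinity>t. f l i t)"
      unfolding ab ab' by (simp add: diff_divide_distrib right_diff_distrib)
  qed
  also have "\<dots> = (\<Sum>\<^sub>\<infinity>((l, i), t). f l i t)"
  proof -
    have "(\<lambda>(li, t). (case li of (l, i) \<Rightarrow> \<lambda>t. f l i t) t) summable_on UNIV"
      using sf summable_on_reindex_bij_witness[where i = "\<lambda>((l, i), t). (l, i, t)" and j = "\<lambda>(l, i, t). ((l, i), t)"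
          and S = UNIV and T = UNIV and g = "\<lambda>(l, i, t). f l i t" and h = "\<lambda>((l, i), t). f l i t"]
      by (auto simp: case_prod_unfold)
    from infsum_pairs(1)[OF this] show ?thesis by (simp add: case_prod_unfold)
  qed
  also have "\<dots> = (\<Sum>\<^sub>\<infinity>(i, t, l). f l i t)"
    by (rule infsum_reindex_bij_witness[where i = "\<lambda>(i, t, l). ((l, i), t)" and j = "\<lambda>((l, i), t). (i, t, l)"]) auto
  also have "\<dots> = (\<Sum>\<^sub>\<infinity>i. \<Sum>\<^sub>\<infinity>t. \<Sum>\<^sub>\<infinity>l. f l i t)"
    by (rule infsum_triples)
      (use sf summable_on_reindex_bij_witness[where i = "\<lambda>(i, t, l). (l, i, t)" and j = "\<lambda>(l, i, t). (i, t, l)"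
          and S = UNIV and T = UNIV and g = "\<lambda>(l, i, t). f l i t" and h = "\<lambda>(i, t, l). f l i t"] in auto)
  also have "\<dots> = (\<Sum>\<^sub>\<infinity>i. \<Sum>\<^sub>\<infinity>t. \<Sum>\<^sub>\<infinity>l. g t l i)"
  proof (rule infsum_cong, rule infsum_cong)
    fix i t
    define z where "z = (\<lambda>l::int. alt l * ee (of_int (l\<^sup>2 + (2 * t - n) * l) * \<tau>))"
    define K where "K = ee (of_int t * d + of_int (n * i + t) * s + of_int (n * i\<^sup>2 + 2 * i * t) * \<tau>)"
    have E: "alt l * ee (of_int t * d + of_int (n * i + t) * s
          + of_int (l\<^sup>2 - n * l + n * i\<^sup>2 + 2 * (l + i) * t) * \<tau>) = z l * K" for l
    proof -
      have "of_int t * d + of_int (n * i + t) * s + of_int (l\<^sup>2 - n * l + n * i\<^sup>2 + 2 * (l + i) * t) * \<tau>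
          = of_int (l\<^sup>2 + (2 * t - n) * l) * \<tau>
            + (of_int t * d + of_int (n * i + t) * s + of_int (n * i\<^sup>2 + 2 * i * t) * \<tau>)"
        by (simp add: power2_eq_square algebra_simps)
      then show ?thesis by (simp only: z_def K_def ee_add mult_ac)
    qed
    \<comment> \<open>Moving the cut from \<open>N + i\<close> to \<open>N\<close> changes the row by a multiple of a vanishing alternating series.\<close>
    have diff: "f l i t - g t l i = z l * ((of_bool (N \<le> t) - of_bool (N + i \<le> t)) * K)" for l
      using E[of l] by (simp only: f_def g_def mult.assoc) (simp add: algebra_simps)
    have "odd (2 * t - n)" using N by presburger
    then have "(\<Sum>\<^sub>\<infinity>l. z l) = 0"
      unfolding z_def by (rule alternating_gaussian_zero)
    then have 1: "(\<Sum>\<^sub>\<infinity>l. f l i t - g t l i) = 0"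
      unfolding diff infsum_cmult_left' by simp
    have sfl: "(\<lambda>l. f l i t) summable_on UNIV"
    proof -
      have sz: "z summable_on UNIV"
        using summable_ee_int[OF tau, where u = alt and U = 1 and c = 1 and e = "2 * t - n" and a = 0 and b = 0]
        by (simp add: z_def)
      have "(\<lambda>l. norm (z l * K)) summable_on UNIV"
        using summable_on_cmult_left[OF sz, of K] by (simp only: summable_on_iff_abs_summable_on_complex)
      then have "(\<lambda>l. norm (f l i t)) summable_on UNIV"
      proof (rule summable_on_comparison_test)
        fix l
        have "f l i t = (of_bool (n * l \<le> t) - of_bool (N + i \<le> t)) * (z l * K)"
          by (simp only: f_def mult.assoc[of _ "alt l"] E)
        moreover have "norm (of_bool (n * l \<le> t) - of_bool (N + i \<le> t) :: complex) \<le> 1" by auto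
        ultimately show "norm (f l i t) \<le> norm (z l * K)"
          by (simp only: norm_mult) (intro mult_left_le_one_le, auto)
      qed auto
      then show ?thesis by (rule abs_summable_summable)
    qed
    have "(\<lambda>l. f l i t - z l * ((of_bool (N \<le> t) - of_bool (N + i \<le> t)) * K)) = (\<lambda>l. g t l i)"
      by (simp add: diff[symmetric])
    moreover have "(\<lambda>l. f l i t - z l * ((of_bool (N \<le> t) - of_bool (N + i \<le> t)) * K)) summable_on UNIV"
    proof -
      have "z summable_on UNIV"
        using summable_ee_int[OF tau, where u = alt and U = 1 and c = 1 and e = "2 * t - n" and a = 0 and b = 0]
        by (simp add: z_def)
      then have "(\<lambda>l. - (z l * ((of_bool (N \<le> t) - of_bool (N + i \<le> t)) * K))) summable_on UNIV"
        unfolding summable_on_uminus by (rule summable_on_cmult_left)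
      from summable_on_add[OF sfl this] show ?thesis by simp
    qed
    ultimately have "(\<lambda>l. g t l i) summable_on UNIV" by simp
    from infsum_diff[OF sfl this] 1 show "(\<Sum>\<^sub>\<infinity>l. f l i t) = (\<Sum>\<^sub>\<infinity>l. g t l i)" by simp
  qed
  also have "\<dots> = (\<Sum>\<^sub>\<infinity>(i, t, l). g t l i)"
    by (rule infsum_triples[symmetric])
      (use sg summable_on_reindex_bij_witness[where i = "\<lambda>(i, t, l). (t, l, i)" and j = "\<lambda>(t, l, i). (i, t, l)"
          and S = UNIV and T = UNIV and g = "\<lambda>(t, l, i). g t l i" and h = "\<lambda>(i, t, l). g t l i"] in auto)
  also have "\<dots> = (\<Sum>\<^sub>\<infinity>((t, l), i). g t l i)"
    by (rule infsum_reindex_bij_witness[where i = "\<lambda>((t, l), i). (i, t, l)" and j = "\<lambda>(i, t, l). ((t, l), i)"]) auto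
  finally have eq: "denom_theta \<tau> n d * appell_sum \<tau> n d s
      - ee (of_int N * (d + s)) * (numer_theta \<tau> n d s * theta_recip \<tau> (d + s))
      = (\<Sum>\<^sub>\<infinity>((t, l), i). g t l i)" .
  have sg': "(\<lambda>(tl, i). (case tl of (t, l) \<Rightarrow> \<lambda>i. g t l i) i) summable_on UNIV"
    using sg summable_on_reindex_bij_witness[where i = "\<lambda>((t, l), i). (t, l, i)" and j = "\<lambda>(t, l, i). ((t, l), i)"
        and S = UNIV and T = UNIV and g = "\<lambda>(t, l, i). g t l i" and h = "\<lambda>((t, l), i). g t l i"]
    by (auto simp: case_prod_unfold)
  have gi: "(\<Sum>\<^sub>\<infinity>i. g t l i) = c t l * class_theta \<tau> n s t" for t l
  proof -
    have "g t l i = c t l * ee (of_int (n * i + t) * s + of_int (n * i\<^sup>2 + 2 * i * t) * \<tau>)" for i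
    proof -
      have "of_int t * d + of_int (n * i + t) * s + of_int (l\<^sup>2 - n * l + n * i\<^sup>2 + 2 * (l + i) * t) * \<tau>
          = (of_int t * d + of_int (l\<^sup>2 - n * l + 2 * l * t) * \<tau>)
            + (of_int (n * i + t) * s + of_int (n * i\<^sup>2 + 2 * i * t) * \<tau>)"
        by (simp add: power2_eq_square algebra_simps)
      from arg_cong[OF this, of ee] show ?thesis
        unfolding g_def c_def
        by (simp only: mult.assoc flip: ee_add)
    qed
    then show ?thesis by (simp add: class_theta_def infsum_cmult_right')
  qed
  show "(\<lambda>(t, l). c t l * class_theta \<tau> n s t) summable_on UNIV"
    using infsum_pairs(2)[OF sg'] by (simp add: case_prod_unfold gi)
  show "denom_theta \<tau> n d * appell_sum \<tau> n d s
      - ee (of_int N * (d + s)) * (numer_theta \<tau> n d s * theta_recip \<tau> (d + s))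
      = (\<Sum>\<^sub>\<infinity>(t, l). c t l * class_theta \<tau> n s t)"
    unfolding eq using infsum_pairs(1)[OF sg'] by (simp add: case_prod_unfold gi)
qed

section \<open>Antisymmetrisation and splitting into residue classes\<close>

text \<open>
  The antisymmetrised theta series, and the coefficient with which the class of \<open>\<kappa>\<close> enters at
  \<open>t = n r + \<kappa>\<close>; the terms \<open>- n r^2 - 2 r \<kappa>\<close> in the exponent come from \<open>class_diff_shift\<close>.
\<close>

definition class_diff :: "complex \<Rightarrow> int \<Rightarrow> complex \<Rightarrow> int \<Rightarrow> complex" where
  "class_diff \<tau> n s t = class_theta \<tau> n s t - class_theta \<tau> n (- s) t"

definition lattice_term :: "complex \<Rightarrow> int \<Rightarrow> complex \<Rightarrow> int \<Rightarrow> int \<Rightarrow> int \<Rightarrow> complex" where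
  "lattice_term \<tau> n d \<kappa> r l = alt l * ee (of_int (n * r + \<kappa>) * d
     + of_int (l\<^sup>2 - n * l + 2 * l * (n * r + \<kappa>) - n * r\<^sup>2 - 2 * r * \<kappa>) * \<tau>)"

lemma class_theta_minus: "class_theta \<tau> n (- s) t = class_theta \<tau> n s (- t)"
proof -
  have "bij_betw uminus UNIV (UNIV :: int set)"
    by (rule bij_betwI[where g = uminus]) auto
  from infsum_reindex_bij_betw[OF this] show ?thesis
    unfolding class_theta_def
    by (subst infsum_reindex_bij_betw[OF \<open>bij_betw uminus UNIV UNIV\<close>, symmetric])
       (simp add: algebra_simps)
qed

lemma class_theta_shift:
  "class_theta \<tau> n s (n * r + \<kappa>) = ee (- of_int (n * r\<^sup>2 + 2 * r * \<kappa>) * \<tau>) * class_theta \<tau> n s \<kappa>"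
proof -
  have bij: "bij_betw (\<lambda>i. i - r) UNIV (UNIV :: int set)"
    by (rule bij_betwI[where g = "\<lambda>i. i + r"]) auto
  have "class_theta \<tau> n s (n * r + \<kappa>) = (\<Sum>\<^sub>\<infinity>i. ee (- of_int (n * r\<^sup>2 + 2 * r * \<kappa>) * \<tau>) *
      ee (of_int (n * i + \<kappa>) * s + of_int (n * i\<^sup>2 + 2 * i * \<kappa>) * \<tau>))"
    unfolding class_theta_def infsum_reindex_bij_betw[OF bij, symmetric,
        of "\<lambda>i. ee (of_int (n * i + (n * r + \<kappa>)) * s + of_int (n * i\<^sup>2 + 2 * i * (n * r + \<kappa>)) * \<tau>)"]
  proof (rule infsum_cong)
    fix i :: int
    have "of_int (n * (i - r) + (n * r + \<kappa>)) * s + of_int (n * (i - r)\<^sup>2 + 2 * (i - r) * (n * r + \<kappa>)) * \<tau>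
        = - of_int (n * r\<^sup>2 + 2 * r * \<kappa>) * \<tau> + (of_int (n * i + \<kappa>) * s + of_int (n * i\<^sup>2 + 2 * i * \<kappa>) * \<tau>)"
      by (simp add: power2_eq_square algebra_simps)
    then show "ee (of_int (n * (i - r) + (n * r + \<kappa>)) * s + of_int (n * (i - r)\<^sup>2 + 2 * (i - r) * (n * r + \<kappa>)) * \<tau>)
        = ee (- of_int (n * r\<^sup>2 + 2 * r * \<kappa>) * \<tau>) * ee (of_int (n * i + \<kappa>) * s + of_int (n * i\<^sup>2 + 2 * i * \<kappa>) * \<tau>)"
      by (simp only: flip: ee_add)
  qed
  then show ?thesis by (simp only: infsum_cmult_right' class_theta_def)
qed

lemma class_diff_shift:
  "class_diff \<tau> n s (n * r + \<kappa>) = ee (- of_int (n * r\<^sup>2 + 2 * r * \<kappa>) * \<tau>) * class_diff \<tau> n s \<kappa>"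
  by (simp only: class_diff_def class_theta_shift right_diff_distrib)

lemma class_diff_minus: "class_diff \<tau> n s (- t) = - class_diff \<tau> n s t"
  unfolding class_diff_def class_theta_minus[of \<tau> n s] by simp

lemma class_diff_0 [simp]: "class_diff \<tau> n s 0 = 0"
  using class_diff_minus[of \<tau> n s 0] by simp

text \<open>
  The quadratic part of the exponent is
  \<open>l^2 + 2 n l r - n r^2 = l^2 + n r^2 + 2 n (r - l) (- r)\<close>, and \<open>(r - l) (- r) \<ge> 0\<close> on both cones.
\<close>

lemma lattice_term_summable:
  assumes tau: "Im \<tau> > 0" and n: "n \<ge> 1"
  shows "(\<lambda>(r, l). lattice_term \<tau> n d \<kappa> r l) summable_on {(r, l). 1 \<le> r \<and> r \<le> l}"
    and "(\<lambda>(r, l). lattice_term \<tau> n d \<kappa> r l) summable_on {(r, l). l < r \<and> r \<le> 0}"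
proof -
  define \<Omega> where "\<Omega> = {(r::int, l::int). 1 \<le> r \<and> r \<le> l} \<union> {(r, l). l < r \<and> r \<le> 0}"
  define u where "u = (\<lambda>(r, l). of_bool ((r, l) \<in> \<Omega>) * alt l * ee (of_int \<kappa> * d))"
  have "(\<lambda>x. u x * ee (of_int (case x of (r, l) \<Rightarrow> n * r) * d + of_int 0 * 0
      + of_real (of_int (case x of (r, l) \<Rightarrow> l\<^sup>2 - n * l + 2 * l * (n * r + \<kappa>) - n * r\<^sup>2 - 2 * r * \<kappa>)) * \<tau>)) summable_on UNIV"
  proof (rule ee_summable[where \<phi> = "\<lambda>(r, l). r" and \<psi> = "\<lambda>(r, l). l" and \<omega> = "\<lambda>_. 0"
        and r = "\<lambda>_. 0" and W = "\<lambda>(r, l). (n + 2 * \<bar>\<kappa>\<bar>) * (\<bar>r\<bar> + \<bar>l\<bar>)" and F = "n + 2 * \<bar>\<kappa>\<bar>"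
        and D = 1 and E = 1 and U = "norm (ee (of_int \<kappa> * d))", OF tau])
    show "inj (\<lambda>x. (case x of (r, l) \<Rightarrow> r, case x of (r::int, l) \<Rightarrow> l, 0::int))"
      by (auto simp: inj_def)
    fix x :: "int \<times> int"
    obtain r l where x: "x = (r, l)" by (cases x)
    show "norm (u x) \<le> norm (ee (of_int \<kappa> * d))" by (auto simp: x u_def norm_mult)
    have "\<bar>n * r\<bar> \<le> n * (\<bar>r\<bar> + \<bar>l\<bar>)" using n by (simp add: abs_mult)
    also have "\<dots> \<le> (n + 2 * \<bar>\<kappa>\<bar>) * (\<bar>r\<bar> + \<bar>l\<bar>)" by (rule mult_right_mono) auto
    finally show "\<bar>case x of (r, l) \<Rightarrow> n * r\<bar> + \<bar>0\<bar> \<le> (case x of (r, l) \<Rightarrow> (n + 2 * \<bar>\<kappa>\<bar>) * (\<bar>r\<bar> + \<bar>l\<bar>))"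
      by (simp add: x)
    assume "u x \<noteq> 0"
    then have "r - l \<le> 0 \<and> - r \<le> 0 \<or> 0 \<le> r - l \<and> 0 \<le> - r"
      by (auto simp: x u_def \<Omega>_def)
    then have "0 \<le> (r - l) * (- r)"
      by (blast intro: mult_nonneg_nonneg mult_nonpos_nonpos)
    then have "0 \<le> n * ((r - l) * (- r))" by (rule mult_nonneg_nonneg[rotated]) (use n in simp)
    moreover have "l\<^sup>2 - n * l + 2 * l * (n * r + \<kappa>) - n * r\<^sup>2 - 2 * r * \<kappa> + (n * l - 2 * (l * \<kappa>) + 2 * (r * \<kappa>))
        = n * r\<^sup>2 + l\<^sup>2 + 2 * (n * ((r - l) * (- r)))"
      by (simp add: power2_eq_square algebra_simps)
    moreover have "r\<^sup>2 \<le> n * r\<^sup>2"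
      using n mult_right_mono[of 1 n "r\<^sup>2"] by simp
    moreover have "n * l - 2 * (l * \<kappa>) + 2 * (r * \<kappa>) \<le> (n + 2 * \<bar>\<kappa>\<bar>) * (\<bar>r\<bar> + \<bar>l\<bar>)"
    proof -
      have "- (l * \<kappa>) \<le> \<bar>\<kappa>\<bar> * \<bar>l\<bar>" "r * \<kappa> \<le> \<bar>\<kappa>\<bar> * \<bar>r\<bar>"
        using abs_ge_minus_self[of "l * \<kappa>"] abs_ge_self[of "r * \<kappa>"] by (simp_all add: abs_mult mult.commute)
      moreover have "n * l \<le> n * \<bar>l\<bar>" "0 \<le> n * \<bar>r\<bar>"
        using n by (auto intro: mult_left_mono)
      moreover have "(n + 2 * \<bar>\<kappa>\<bar>) * (\<bar>r\<bar> + \<bar>l\<bar>)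
          = n * \<bar>r\<bar> + n * \<bar>l\<bar> + 2 * (\<bar>\<kappa>\<bar> * \<bar>r\<bar>) + 2 * (\<bar>\<kappa>\<bar> * \<bar>l\<bar>)"
        by (simp add: algebra_simps)
      ultimately show ?thesis by linarith
    qed
    ultimately have "r\<^sup>2 + l\<^sup>2 + 0\<^sup>2 \<le> l\<^sup>2 - n * l + 2 * l * (n * r + \<kappa>) - n * r\<^sup>2 - 2 * r * \<kappa>
        + (n + 2 * \<bar>\<kappa>\<bar>) * (\<bar>r\<bar> + \<bar>l\<bar>)"
      unfolding power2_eq_square[of "0::int"] mult_zero_left by linarith
    then show "of_int ((case x of (r, l) \<Rightarrow> r)\<^sup>2 + (case x of (r, l) \<Rightarrow> l)\<^sup>2 + 0\<^sup>2)
        \<le> 1 * of_int (case x of (r, l) \<Rightarrow> l\<^sup>2 - n * l + 2 * l * (n * r + \<kappa>) - n * r\<^sup>2 - 2 * r * \<kappa>)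
          + 1 * real_of_int (case x of (r, l) \<Rightarrow> (n + 2 * \<bar>\<kappa>\<bar>) * (\<bar>r\<bar> + \<bar>l\<bar>))"
      unfolding x prod.case mult_1 of_int_add[symmetric] of_int_le_iff .
  qed auto
  then have "(\<lambda>x. u x * (case x of (r, l) \<Rightarrow> ee (of_int (n * r) * d
      + of_int (l\<^sup>2 - n * l + 2 * l * (n * r + \<kappa>) - n * r\<^sup>2 - 2 * r * \<kappa>) * \<tau>))) summable_on UNIV"
    by (simp add: case_prod_unfold)
  also have "?this \<longleftrightarrow> (\<lambda>(r, l). lattice_term \<tau> n d \<kappa> r l) summable_on \<Omega>"
    by (rule summable_on_cong_neutral)
      (auto simp: u_def lattice_term_def distrib_right ee_add)
  finally have "(\<lambda>(r, l). lattice_term \<tau> n d \<kappa> r l) summable_on \<Omega>" .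
  then show "(\<lambda>(r, l). lattice_term \<tau> n d \<kappa> r l) summable_on {(r, l). 1 \<le> r \<and> r \<le> l}"
    "(\<lambda>(r, l). lattice_term \<tau> n d \<kappa> r l) summable_on {(r, l). l < r \<and> r \<le> 0}"
    by (rule summable_on_subset_banach; auto simp: \<Omega>_def)+
qed

definition upper_cone_sum :: "complex \<Rightarrow> int \<Rightarrow> complex \<Rightarrow> int \<Rightarrow> complex" where
  "upper_cone_sum \<tau> n d \<kappa> = (\<Sum>\<^sub>\<infinity>(r, l)\<in>{(r, l). 1 \<le> r \<and> r \<le> l}. lattice_term \<tau> n d \<kappa> r l)"

definition lower_cone_sum :: "complex \<Rightarrow> int \<Rightarrow> complex \<Rightarrow> int \<Rightarrow> complex" where
  "lower_cone_sum \<tau> n d \<kappa> = (\<Sum>\<^sub>\<infinity>(r, l)\<in>{(r, l). l < r \<and> r \<le> 0}. lattice_term \<tau> n d \<kappa> r l)"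

lemma has_sum_cone_rows:
  assumes tau: "Im \<tau> > 0" and n: "n \<ge> 1"
  shows "((\<lambda>j::nat. \<Sum>r=1..j. lattice_term \<tau> n d \<kappa> (int r) (int j)) has_sum upper_cone_sum \<tau> n d \<kappa>) {1..}"
    and "((\<lambda>j::nat. \<Sum>r=0..j-1. lattice_term \<tau> n d \<kappa> (- int r) (- int j)) has_sum lower_cone_sum \<tau> n d \<kappa>) {1..}"
proof -
  have "((\<lambda>(j, r). lattice_term \<tau> n d \<kappa> (int r) (int j)) has_sum upper_cone_sum \<tau> n d \<kappa>) (SIGMA j:{1..}. {1..j})
      \<longleftrightarrow> ((\<lambda>(r, l). lattice_term \<tau> n d \<kappa> r l) has_sum upper_cone_sum \<tau> n d \<kappa>) {(r, l). 1 \<le> r \<and> r \<le> l}"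
    by (rule has_sum_reindex_bij_witness[where i = "\<lambda>(r, l). (nat l, nat r)" and j = "\<lambda>(j, r). (int r, int j)"]) auto
  also have "\<dots>"
    unfolding upper_cone_sum_def by (rule has_sum_infsum[OF lattice_term_summable(1)[OF tau n]])
  finally show "((\<lambda>j::nat. \<Sum>r=1..j. lattice_term \<tau> n d \<kappa> (int r) (int j)) has_sum upper_cone_sum \<tau> n d \<kappa>) {1..}"
    by (rule has_sum_SigmaD) (auto intro!: has_sum_finiteI)
  have "((\<lambda>(j, r). lattice_term \<tau> n d \<kappa> (- int r) (- int j)) has_sum lower_cone_sum \<tau> n d \<kappa>) (SIGMA j:{1..}. {0..j-1})
      \<longleftrightarrow> ((\<lambda>(r, l). lattice_term \<tau> n d \<kappa> r l) has_sum lower_cone_sum \<tau> n d \<kappa>) {(r, l). l < r \<and> r \<le> 0}"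
    by (rule has_sum_reindex_bij_witness[where i = "\<lambda>(r, l). (nat (- l), nat (- r))" and j = "\<lambda>(j, r). (- int r, - int j)"]) auto
  also have "\<dots>"
    unfolding lower_cone_sum_def by (rule has_sum_infsum[OF lattice_term_summable(2)[OF tau n]])
  finally show "((\<lambda>j::nat. \<Sum>r=0..j-1. lattice_term \<tau> n d \<kappa> (- int r) (- int j)) has_sum lower_cone_sum \<tau> n d \<kappa>) {1..}"
    by (rule has_sum_SigmaD) (auto intro!: has_sum_finiteI)
qed

text \<open>
  On the diagonal the indefinite exponent collapses to that of \<open>denom_theta\<close>.
\<close>

lemma has_sum_lattice_diagonal:
  assumes tau: "Im \<tau> > 0" and n: "n \<ge> 1"
  shows "((\<lambda>r. lattice_term \<tau> n d \<kappa> r r) has_sum ee (of_int \<kappa> * d) * denom_theta \<tau> n d) UNIV"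
proof -
  have "(\<lambda>l. alt l * ee (of_int (n * l) * d + of_int ((n + 1) * l\<^sup>2 - n * l) * \<tau>)) summable_on UNIV"
    using summable_ee_int[OF tau, where u = alt and U = 1 and c = "n + 1" and e = "- n" and a = n and b = 0] n
    by simp
  from has_sum_cmult_right[OF has_sum_infsum[OF this], of "ee (of_int \<kappa> * d)"]
  have "((\<lambda>l. ee (of_int \<kappa> * d) * (alt l * ee (of_int (n * l) * d + of_int ((n + 1) * l\<^sup>2 - n * l) * \<tau>)))
      has_sum ee (of_int \<kappa> * d) * denom_theta \<tau> n d) UNIV"
    by (simp add: denom_theta_def)
  also have "(\<lambda>l. ee (of_int \<kappa> * d) * (alt l * ee (of_int (n * l) * d + of_int ((n + 1) * l\<^sup>2 - n * l) * \<tau>)))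
      = (\<lambda>r. lattice_term \<tau> n d \<kappa> r r)"
  proof
    fix r :: int
    have "of_int \<kappa> * d + (of_int (n * r) * d + of_int ((n + 1) * r\<^sup>2 - n * r) * \<tau>)
        = of_int (n * r + \<kappa>) * d + of_int (r\<^sup>2 - n * r + 2 * r * (n * r + \<kappa>) - n * r\<^sup>2 - 2 * r * \<kappa>) * \<tau>"
      by (simp add: power2_eq_square algebra_simps)
    from arg_cong[OF this, of ee]
    show "ee (of_int \<kappa> * d) * (alt r * ee (of_int (n * r) * d + of_int ((n + 1) * r\<^sup>2 - n * r) * \<tau>))
        = lattice_term \<tau> n d \<kappa> r r"
      unfolding lattice_term_def ee_add[of "of_int \<kappa> * d"] by (simp only: mult.left_commute)
  qed
  finally show ?thesis .
qed

text \<open>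
  As \<open>\<bar>\<kappa>\<bar> < N\<close>, the cut \<open>N \<le> n r + \<kappa>\<close> means \<open>1 \<le> r\<close> for every class, while \<open>n l \<le> n r + \<kappa>\<close> means
  \<open>l \<le> r\<close> or \<open>l < r\<close> according to the sign of \<open>\<kappa>\<close>. This asymmetry is the source of the
  diagonal term.
\<close>

lemma infsum_residue_class:
  assumes tau: "Im \<tau> > 0" and n: "n \<ge> 1" and N: "n + 1 = 2 * N" and \<kappa>: "\<bar>\<kappa>\<bar> < N"
  shows "(\<Sum>\<^sub>\<infinity>(r, l). (of_bool (n * l \<le> n * r + \<kappa>) - of_bool (N \<le> n * r + \<kappa>)) * lattice_term \<tau> n d \<kappa> r l)
     = lower_cone_sum \<tau> n d \<kappa> - upper_cone_sum \<tau> n d \<kappa>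
       + (if \<kappa> \<ge> 0 then ee (of_int \<kappa> * d) * denom_theta \<tau> n d else 0)"
proof -
  have small: "\<bar>\<kappa>\<bar> < n" using \<kappa> N by linarith
  have ge: "n * l \<le> n * r + \<kappa> \<longleftrightarrow> l < r \<or> (l = r \<and> 0 \<le> \<kappa>)" for l r
  proof -
    consider "l < r" | "l = r" | "r < l" by linarith
    then show ?thesis
    proof cases
      case 1
      then have "n * (l + 1) \<le> n * r" using n by (intro mult_left_mono) auto
      then show ?thesis using 1 small by (simp add: distrib_left)
    next
      case 3
      then have "n * (r + 1) \<le> n * l" using n by (intro mult_left_mono) auto
      then show ?thesis using 3 small by (simp add: distrib_left)
    qed simp
  qed
  have cut: "N \<le> n * r + \<kappa> \<longleftrightarrow> 1 \<le> r" for r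
  proof (cases "1 \<le> r")
    case True
    then have "n * 1 \<le> n * r" using n by (intro mult_left_mono) auto
    then show ?thesis using True \<kappa> N by simp
  next
    case False
    then have "n * r \<le> n * 0" using n by (intro mult_left_mono) auto
    then show ?thesis using False \<kappa> N by simp
  qed
  let ?h = "\<lambda>(r, l). lattice_term \<tau> n d \<kappa> r l"
  let ?U = "{(r::int, l::int). 1 \<le> r \<and> r \<le> l}"
  let ?L = "{(r::int, l::int). l < r \<and> r \<le> 0}"
  have "((\<lambda>x. of_bool (x \<in> ?U) * ?h x) has_sum upper_cone_sum \<tau> n d \<kappa>) UNIV
      \<longleftrightarrow> (?h has_sum upper_cone_sum \<tau> n d \<kappa>) ?U"
    by (rule has_sum_cong_neutral) auto
  then have U: "((\<lambda>x. of_bool (x \<in> ?U) * ?h x) has_sum upper_cone_sum \<tau> n d \<kappa>) UNIV"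
    using has_sum_infsum[OF lattice_term_summable(1)[OF tau n]] by (simp add: upper_cone_sum_def)
  have "((\<lambda>x. of_bool (x \<in> ?L) * ?h x) has_sum lower_cone_sum \<tau> n d \<kappa>) UNIV
      \<longleftrightarrow> (?h has_sum lower_cone_sum \<tau> n d \<kappa>) ?L"
    by (rule has_sum_cong_neutral) auto
  then have L: "((\<lambda>x. of_bool (x \<in> ?L) * ?h x) has_sum lower_cone_sum \<tau> n d \<kappa>) UNIV"
    using has_sum_infsum[OF lattice_term_summable(2)[OF tau n]] by (simp add: lower_cone_sum_def)
  have D: "((\<lambda>x. of_bool (0 \<le> \<kappa> \<and> x \<in> range (\<lambda>r. (r, r))) * ?h x) has_sum
      (if \<kappa> \<ge> 0 then ee (of_int \<kappa> * d) * denom_theta \<tau> n d else 0)) UNIV"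
  proof (cases "0 \<le> \<kappa>")
    case True
    have "(?h has_sum ee (of_int \<kappa> * d) * denom_theta \<tau> n d) (range (\<lambda>r. (r, r)))"
      using has_sum_lattice_diagonal[OF tau n, of d \<kappa>]
      by (subst has_sum_reindex) (auto simp: inj_on_def o_def)
    also have "?this \<longleftrightarrow> ((\<lambda>x. of_bool (0 \<le> \<kappa> \<and> x \<in> range (\<lambda>r. (r, r))) * ?h x) has_sum
      ee (of_int \<kappa> * d) * denom_theta \<tau> n d) UNIV"
      by (rule has_sum_cong_neutral) (use True in auto)
    finally show ?thesis using True by simp
  qed simp
  have "(\<lambda>x. - (of_bool (x \<in> ?U) * ?h x) + of_bool (x \<in> ?L) * ?h x
      + of_bool (0 \<le> \<kappa> \<and> x \<in> range (\<lambda>r. (r, r))) * ?h x)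
    = (\<lambda>(r, l). (of_bool (n * l \<le> n * r + \<kappa>) - of_bool (N \<le> n * r + \<kappa>)) * lattice_term \<tau> n d \<kappa> r l)"
    unfolding ge cut by (auto simp: fun_eq_iff)
  moreover have "((\<lambda>x. - (of_bool (x \<in> ?U) * ?h x) + of_bool (x \<in> ?L) * ?h x
      + of_bool (0 \<le> \<kappa> \<and> x \<in> range (\<lambda>r. (r, r))) * ?h x) has_sum
      - upper_cone_sum \<tau> n d \<kappa> + lower_cone_sum \<tau> n d \<kappa>
      + (if \<kappa> \<ge> 0 then ee (of_int \<kappa> * d) * denom_theta \<tau> n d else 0)) UNIV"
    by (intro has_sum_add has_sum_uminusI U L D)
  ultimately show ?thesis
    using infsumI by fastforce
qed

lemma sum_symmetric_interval:
  fixes f :: "int \<Rightarrow> complex"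
  shows "(\<Sum>\<kappa>\<in>{- int M..int M}. f \<kappa>) = f 0 + (\<Sum>k=1..M. f (int k) + f (- int k))"
proof (induction M)
  case (Suc M)
  have "{- int (Suc M)..int (Suc M)} = insert (int (Suc M)) (insert (- int (Suc M)) {- int M..int M})"
    by auto
  then show ?case using Suc.IH by (simp add: add_ac)
qed simp

text \<open>
  Division with remainder in the balanced interval from \<open>- M\<close> to \<open>M\<close> splits the sum over \<open>t\<close>; the
  classes \<open>\<kappa>\<close> and \<open>- \<kappa>\<close> are then combined, since \<open>class_diff\<close> is odd. In particular the
  class \<open>\<kappa> = 0\<close> drops out.
\<close>

theorem appell_sum_difference:
  fixes M :: nat
  assumes tau: "Im \<tau> > 0" and n: "n = 2 * int M + 1"
    and nz: "\<And>j::int. ee (d + s + 2 * of_int j * \<tau>) \<noteq> 1" "\<And>j::int. ee (d + - s + 2 * of_int j * \<tau>) \<noteq> 1"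
  shows "denom_theta \<tau> n d * (appell_sum \<tau> n d s - appell_sum \<tau> n d (- s))
      = ee (of_int (int M + 1) * (d + s)) * (numer_theta \<tau> n d s * theta_recip \<tau> (d + s))
        - ee (of_int (int M + 1) * (d + - s)) * (numer_theta \<tau> n d (- s) * theta_recip \<tau> (d + - s))
        + (\<Sum>k=1..M. class_diff \<tau> n s (int k) *
            (lower_cone_sum \<tau> n d (int k) - upper_cone_sum \<tau> n d (int k)
             - lower_cone_sum \<tau> n d (- int k) + upper_cone_sum \<tau> n d (- int k)
             + ee (of_int (int k) * d) * denom_theta \<tau> n d))"
proof -
  define N where "N = int M + 1"
  have n1: "n \<ge> 1" and N: "n + 1 = 2 * N" using n by (auto simp: N_def)
  define c where "c = (\<lambda>t l. (of_bool (n * l \<le> t) - of_bool (N \<le> t)) * alt l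
      * ee (of_int t * d + of_int (l\<^sup>2 - n * l + 2 * l * t) * \<tau>))"
  have G: "(\<lambda>(t, l). c t l * class_theta \<tau> n s t) summable_on UNIV"
    "denom_theta \<tau> n d * appell_sum \<tau> n d s
      - ee (of_int N * (d + s)) * (numer_theta \<tau> n d s * theta_recip \<tau> (d + s))
      = (\<Sum>\<^sub>\<infinity>(t, l). c t l * class_theta \<tau> n s t)"
    unfolding c_def by (rule appell_sum_expansion[OF tau n1 N nz(1)])+
  have G': "(\<lambda>(t, l). c t l * class_theta \<tau> n (- s) t) summable_on UNIV"
    "denom_theta \<tau> n d * appell_sum \<tau> n d (- s)
      - ee (of_int N * (d + - s)) * (numer_theta \<tau> n d (- s) * theta_recip \<tau> (d + - s))
      = (\<Sum>\<^sub>\<infinity>(t, l). c t l * class_theta \<tau> n (- s) t)"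
    unfolding c_def by (rule appell_sum_expansion[OF tau n1 N nz(2)])+
  have sK: "(\<lambda>(t, l). c t l * class_diff \<tau> n s t) summable_on UNIV"
    using summable_on_add[OF G(1) summable_on_uminus[THEN iffD2, OF G'(1)]]
    by (simp add: case_prod_unfold class_diff_def right_diff_distrib)
  have "(\<Sum>\<^sub>\<infinity>(t, l). c t l * class_theta \<tau> n s t) - (\<Sum>\<^sub>\<infinity>(t, l). c t l * class_theta \<tau> n (- s) t)
      = (\<Sum>\<^sub>\<infinity>(t, l). c t l * class_diff \<tau> n s t)"
    unfolding infsum_diff[OF G(1) G'(1), symmetric]
    by (simp add: case_prod_unfold class_diff_def right_diff_distrib)
  also have "\<dots> = (\<Sum>\<kappa>\<in>{- int M..int M}. \<Sum>\<^sub>\<infinity>(r, l). c (n * r + \<kappa>) l * class_diff \<tau> n s (n * r + \<kappa>))"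
  proof -
    let ?S = "\<Sum>\<^sub>\<infinity>(t, l). c t l * class_diff \<tau> n s t"
    have "((\<lambda>(\<kappa>, r, l). c (n * r + \<kappa>) l * class_diff \<tau> n s (n * r + \<kappa>)) has_sum ?S) ({- int M..int M} \<times> UNIV)
        \<longleftrightarrow> ((\<lambda>(t, l). c t l * class_diff \<tau> n s t) has_sum ?S) UNIV"
  proof (rule has_sum_reindex_bij_witness[where j = "\<lambda>(\<kappa>, r, l). (n * r + \<kappa>, l)"
        and i = "\<lambda>(t, l). ((t + int M) mod n - int M, (t + int M) div n, l)"])
    fix x :: "int \<times> int \<times> int"
    assume "x \<in> {- int M..int M} \<times> UNIV"
    then obtain \<kappa> r l where x: "x = (\<kappa>, r, l)" "0 \<le> \<kappa> + int M" "\<kappa> + int M < n"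
      using n by auto
    have "(n * r + \<kappa> + int M) div n = r" "(n * r + \<kappa> + int M) mod n = \<kappa> + int M"
      using x n1 by (simp_all add: add.assoc div_mult_self4 mod_mult_self4)
    then show "(case case x of (\<kappa>, r, l) \<Rightarrow> (n * r + \<kappa>, l) of
        (t, l) \<Rightarrow> ((t + int M) mod n - int M, (t + int M) div n, l)) = x"
      by (simp add: x)
  next
    fix x :: "int \<times> int"
    obtain t l where x: "x = (t, l)" by (cases x)
    have "n * ((t + int M) div n) + ((t + int M) mod n - int M) = t"
      using mult_div_mod_eq[of n "t + int M"] by linarith
    then show "(case case x of (t, l) \<Rightarrow> ((t + int M) mod n - int M, (t + int M) div n, l) of
        (\<kappa>, r, l) \<Rightarrow> (n * r + \<kappa>, l)) = x"
      by (simp add: x)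
    show "(case x of (t, l) \<Rightarrow> ((t + int M) mod n - int M, (t + int M) div n, l)) \<in> {- int M..int M} \<times> UNIV"
      using pos_mod_bound[of n "t + int M"] pos_mod_sign[of n "t + int M"] n n1 by (simp add: x)
  qed auto
    then have hs: "((\<lambda>(\<kappa>, r, l). c (n * r + \<kappa>) l * class_diff \<tau> n s (n * r + \<kappa>)) has_sum ?S) ({- int M..int M} \<times> UNIV)"
      using has_sum_infsum[OF sK] by simp
    then have "(\<lambda>(\<kappa>, rl). case rl of (r, l) \<Rightarrow> c (n * r + \<kappa>) l * class_diff \<tau> n s (n * r + \<kappa>))
        summable_on (SIGMA \<kappa>:{- int M..int M}. UNIV)"
      by (rule has_sum_imp_summable)
    from infsum_Sigma'_banach[OF this] infsumI[OF hs] show ?thesis by simp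
  qed
  also have "\<dots> = (\<Sum>\<kappa>\<in>{- int M..int M}. class_diff \<tau> n s \<kappa> *
      (lower_cone_sum \<tau> n d \<kappa> - upper_cone_sum \<tau> n d \<kappa>
       + (if \<kappa> \<ge> 0 then ee (of_int \<kappa> * d) * denom_theta \<tau> n d else 0)))"
  proof (rule sum.cong[OF refl])
    fix \<kappa> assume "\<kappa> \<in> {- int M..int M}"
    then have \<kappa>: "\<bar>\<kappa>\<bar> < N" by (auto simp: N_def)
    have "c (n * r + \<kappa>) l * class_diff \<tau> n s (n * r + \<kappa>) = class_diff \<tau> n s \<kappa> *
        ((of_bool (n * l \<le> n * r + \<kappa>) - of_bool (N \<le> n * r + \<kappa>)) * lattice_term \<tau> n d \<kappa> r l)" for r l
    proof -
      have "(of_int (n * r + \<kappa>) * d + of_int (l\<^sup>2 - n * l + 2 * l * (n * r + \<kappa>)) * \<tau>)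
          + - of_int (n * r\<^sup>2 + 2 * r * \<kappa>) * \<tau>
        = of_int (n * r + \<kappa>) * d + of_int (l\<^sup>2 - n * l + 2 * l * (n * r + \<kappa>) - n * r\<^sup>2 - 2 * r * \<kappa>) * \<tau>"
        by (simp add: algebra_simps)
      then have "ee (of_int (n * r + \<kappa>) * d + of_int (l\<^sup>2 - n * l + 2 * l * (n * r + \<kappa>)) * \<tau>)
          * ee (- of_int (n * r\<^sup>2 + 2 * r * \<kappa>) * \<tau>)
        = ee (of_int (n * r + \<kappa>) * d + of_int (l\<^sup>2 - n * l + 2 * l * (n * r + \<kappa>) - n * r\<^sup>2 - 2 * r * \<kappa>) * \<tau>)"
        by (simp only: flip: ee_add)
      then show ?thesis
        unfolding c_def class_diff_shift lattice_term_def by (simp only: mult_ac)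
    qed
    then show "(\<Sum>\<^sub>\<infinity>(r, l). c (n * r + \<kappa>) l * class_diff \<tau> n s (n * r + \<kappa>)) = class_diff \<tau> n s \<kappa> *
      (lower_cone_sum \<tau> n d \<kappa> - upper_cone_sum \<tau> n d \<kappa>
       + (if \<kappa> \<ge> 0 then ee (of_int \<kappa> * d) * denom_theta \<tau> n d else 0))"
      unfolding infsum_residue_class[OF tau n1 N \<kappa>, symmetric] infsum_cmult_right'[symmetric]
      by (simp add: case_prod_unfold)
  qed
  also have "\<dots> = (\<Sum>k=1..M. class_diff \<tau> n s (int k) *
            (lower_cone_sum \<tau> n d (int k) - upper_cone_sum \<tau> n d (int k)
             - lower_cone_sum \<tau> n d (- int k) + upper_cone_sum \<tau> n d (- int k)
             + ee (of_int (int k) * d) * denom_theta \<tau> n d))"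
    unfolding sum_symmetric_interval class_diff_0 class_diff_minus mult_zero_left add_0
    by (rule sum.cong) (auto simp: algebra_simps)
  finally show ?thesis
    using G(2) G'(2) by (simp add: N_def algebra_simps)
qed

section \<open>Translation to the theta functions of the statement\<close>

text \<open>
  The monomial \<open>v^a w^b q^c\<close> with real exponents. Writing every factor in this form reduces the
  translation of the statement to identities between real exponents.
\<close>

definition qmonomial :: "complex \<Rightarrow> complex \<Rightarrow> complex \<Rightarrow> real \<Rightarrow> real \<Rightarrow> real \<Rightarrow> complex" where
  "qmonomial d s \<tau> a b c = ee (of_real a * d + of_real b * s + of_real c * \<tau>)"

lemma qmonomial_mult: "qmonomial d s \<tau> a b c * qmonomial d s \<tau> a' b' c' = qmonomial d s \<tau> (a + a') (b + b') (c + c')"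
  unfolding qmonomial_def ee_add[symmetric] by (simp add: algebra_simps)

lemma qmonomial_cong: "a = a' \<Longrightarrow> b = b' \<Longrightarrow> c = c' \<Longrightarrow> qmonomial d s \<tau> a b c = qmonomial d s \<tau> a' b' c'"
  by simp

lemma qpow_eq_qmonomial: "qpow \<tau> c = qmonomial d s \<tau> 0 0 c"
  by (simp add: qmonomial_def qpow_eq_ee)

lemma exp_eq_ee: "exp (2 * of_real pi * \<i> * x * z) = ee (x * z)"
  by (simp add: ee_def mult_ac)

lemma theta_eq_class_theta:
  assumes "n \<ge> 1"
  shows "theta (2 * of_int \<kappa>) (of_int n) \<tau> s = ee (of_real ((of_int \<kappa>)\<^sup>2 / of_int n) * \<tau>) * class_theta \<tau> n s \<kappa>"
    and "theta (of_int \<kappa>) (of_int n / 2) (2 * \<tau>) (2 * s) = ee (of_real ((of_int \<kappa>)\<^sup>2 / of_int n) * \<tau>) * class_theta \<tau> n s \<kappa>"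
proof -
  have summand: "ee (of_int (n * j + \<kappa>) * s) * ee (of_real (of_int n * (of_int j + of_int \<kappa> / of_int n)\<^sup>2) * \<tau>)
      = ee (of_real ((of_int \<kappa>)\<^sup>2 / of_int n) * \<tau>) * ee (of_int (n * j + \<kappa>) * s + of_int (n * j\<^sup>2 + 2 * j * \<kappa>) * \<tau>)"
    for j
  proof -
    have "of_int n * (of_int j + of_int \<kappa> / of_int n)\<^sup>2
        = (of_int \<kappa>)\<^sup>2 / of_int n + (of_int (n * j\<^sup>2 + 2 * j * \<kappa>) :: real)"
      using assms by (simp add: field_simps power2_eq_square)
    then show ?thesis
      unfolding ee_add[symmetric] by (simp add: algebra_simps)
  qed
  show "theta (2 * of_int \<kappa>) (of_int n) \<tau> s = ee (of_real ((of_int \<kappa>)\<^sup>2 / of_int n) * \<tau>) * class_theta \<tau> n s \<kappa>"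
    unfolding theta_def class_theta_def infsum_cmult_right'[symmetric] summand[symmetric]
  proof (rule infsum_cong)
    fix j :: int
    have "of_int n * (of_int j + of_int \<kappa> / of_int n) = real_of_int (n * j + \<kappa>)"
      using assms by (simp add: field_simps)
    then show "exp (2 * of_real pi * \<i> * of_real (of_int n * (of_int j + 2 * of_int \<kappa> / (2 * of_int n))) * s)
        * qpow \<tau> (of_int n * (of_int j + 2 * of_int \<kappa> / (2 * of_int n))\<^sup>2)
      = ee (of_int (n * j + \<kappa>) * s) * ee (of_real (of_int n * (of_int j + of_int \<kappa> / of_int n)\<^sup>2) * \<tau>)"
      unfolding exp_eq_ee qpow_eq_ee by simp
  qed
  show "theta (of_int \<kappa>) (of_int n / 2) (2 * \<tau>) (2 * s) = ee (of_real ((of_int \<kappa>)\<^sup>2 / of_int n) * \<tau>) * class_theta \<tau> n s \<kappa>"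
    unfolding theta_def class_theta_def infsum_cmult_right'[symmetric] summand[symmetric]
  proof (rule infsum_cong)
    fix j :: int
    have "of_int n / 2 * (of_int j + of_int \<kappa> / of_int n) * 2 = real_of_int (n * j + \<kappa>)"
      using assms by (simp add: field_simps)
    from arg_cong[OF this, of complex_of_real]
    have "of_real (of_int n / 2 * (of_int j + of_int \<kappa> / (2 * (of_int n / 2)))) * (2 * s) = of_int (n * j + \<kappa>) * s"
      by (simp add: mult_ac)
    moreover have "of_real (of_int n / 2 * (of_int j + of_int \<kappa> / (2 * (of_int n / 2)))\<^sup>2) * (2 * \<tau>)
        = of_real (of_int n * (of_int j + of_int \<kappa> / of_int n)\<^sup>2) * \<tau>"
      by simp
    ultimately show "exp (2 * of_real pi * \<i> * of_real (of_int n / 2 * (of_int j + of_int \<kappa> / (2 * (of_int n / 2)))) * (2 * s))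
        * qpow (2 * \<tau>) (of_int n / 2 * (of_int j + of_int \<kappa> / (2 * (of_int n / 2)))\<^sup>2)
      = ee (of_int (n * j + \<kappa>) * s) * ee (of_real (of_int n * (of_int j + of_int \<kappa> / of_int n)\<^sup>2) * \<tau>)"
      unfolding exp_eq_ee qpow_eq_ee by (simp only:)
  qed
qed

lemma theta_diff_eq_class_diff:
  assumes "n \<ge> 1"
  shows "theta_diff (2 * of_int \<kappa>) (of_int n) \<tau> s = ee (of_real ((of_int \<kappa>)\<^sup>2 / of_int n) * \<tau>) * class_diff \<tau> n s \<kappa>"
    and "theta_diff (of_int \<kappa>) (of_int n / 2) (2 * \<tau>) (2 * s) = ee (of_real ((of_int \<kappa>)\<^sup>2 / of_int n) * \<tau>) * class_diff \<tau> n s \<kappa>"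
  using theta_eq_class_theta[OF assms, of \<kappa> \<tau> s] theta_eq_class_theta[OF assms, of "- \<kappa>" \<tau> s]
  by (simp_all add: theta_diff_def class_diff_def class_theta_minus right_diff_distrib)

lemma recip_identities:
  fixes x j :: real
  assumes "x + 1 \<noteq> 0"
  shows "(x + 1) * (j + - x / (2 * (x + 1))) * x / (x + 1) = x / (2 * (x + 1)) - x / 2 + x * j"
    and "((x + 1) * j + x / 2) / (x + 1) = j + (x / (2 * (x + 1)))"
    and "(x + 1) * (j + x / (2 * (x + 1))) = (x + 1) * j + x / 2"
    and "(x + 1) * (j + - x / (2 * (x + 1)))\<^sup>2 = x / 4 - x / (4 * (x + 1)) + ((x + 1) * j\<^sup>2 - x * j)"
    and "(x + 1) * (j + x / (2 * (x + 1)))\<^sup>2 = x / 4 - x / (4 * (x + 1)) + ((x + 1) * j\<^sup>2 + x * j)"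
proof -
  define e where "e = 1 / (2 * (x + 1))"
  have e: "2 * e * (x + 1) = 1" using assms by (simp add: e_def)
  have d: "a / (2 * (x + 1)) = a * e" "a / (4 * (x + 1)) = a * e / 2" "a / (x + 1) = 2 * a * e" for a
    using assms by (simp_all add: e_def field_simps)
  show "(x + 1) * (j + - x / (2 * (x + 1))) * x / (x + 1) = x / (2 * (x + 1)) - x / 2 + x * j"
    unfolding d using e by algebra
  show "((x + 1) * j + x / 2) / (x + 1) = j + (x / (2 * (x + 1)))"
    unfolding d using e by algebra
  show "(x + 1) * (j + x / (2 * (x + 1))) = (x + 1) * j + x / 2"
    unfolding d using e by algebra
  show "(x + 1) * (j + - x / (2 * (x + 1)))\<^sup>2 = x / 4 - x / (4 * (x + 1)) + ((x + 1) * j\<^sup>2 - x * j)"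
    unfolding d using e by algebra
  show "(x + 1) * (j + x / (2 * (x + 1)))\<^sup>2 = x / 4 - x / (4 * (x + 1)) + ((x + 1) * j\<^sup>2 + x * j)"
    unfolding d using e by algebra
qed
text \<open>
  The factor \<open>q^(n/4 - n/(4 (n + 1))) v^(n/(2 (n + 1)) - n/2)\<close> that all terms of the theorem have in
  common; it contains the fractional exponents due to the index \<open>n + 1\<close>.
\<close>

definition theta_factor :: "complex \<Rightarrow> int \<Rightarrow> complex \<Rightarrow> complex" where
  "theta_factor \<tau> n d = qmonomial d 0 \<tau> (of_int n / (2 * (of_int n + 1)) - of_int n / 2) 0
     (of_int n / 4 - of_int n / (4 * (of_int n + 1)))"

lemma theta_minus_denom:
  assumes "n \<ge> 1"
  shows "theta_minus (- of_int n) (of_int n + 1) \<tau> (of_real (of_int n) * d / of_real (of_int n + 1))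
     = theta_factor \<tau> n d * denom_theta \<tau> n d"
  unfolding theta_minus_def denom_theta_def infsum_cmult_right'[symmetric]
proof (rule infsum_cong)
  fix j :: int
  define x where "x = real_of_int n"
  have x: "x + 1 \<noteq> 0" "x > 0" using assms by (auto simp: x_def)
  let ?y = "(x + 1) * (of_int j + - x / (2 * (x + 1)))"
  have E1: "exp (2 * of_real pi * \<i> * of_real ?y * (of_real x * d / of_real (x + 1))) = qmonomial d 0 \<tau> (?y * x / (x + 1)) 0 0"
    unfolding exp_eq_ee qmonomial_def using x by (simp add: field_simps)
  have E2: "ee (of_int (n * j) * d + of_int ((n + 1) * j\<^sup>2 - n * j) * \<tau>)
      = qmonomial d 0 \<tau> (x * of_int j) 0 ((x + 1) * (of_int j)\<^sup>2 - x * of_int j)"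
    unfolding qmonomial_def by (simp add: x_def)
  have "exp (2 * of_real pi * \<i> * of_real ?y * (of_real x * d / of_real (x + 1)))
      * qpow \<tau> ((x + 1) * (of_int j + - x / (2 * (x + 1)))\<^sup>2)
    = theta_factor \<tau> n d * ee (of_int (n * j) * d + of_int ((n + 1) * j\<^sup>2 - n * j) * \<tau>)"
    unfolding E1 E2 theta_factor_def x_def[symmetric] qpow_eq_qmonomial[of \<tau> _ d 0] qmonomial_mult
    by (rule qmonomial_cong) (unfold recip_identities[OF x(1)], simp_all)
  then show "(-1) powi j * exp (2 * of_real pi * \<i> * of_real ((of_int n + 1) * (of_int j + - of_int n / (2 * (of_int n + 1))))
        * (of_real (of_int n) * d / of_real (of_int n + 1)))
      * qpow \<tau> ((of_int n + 1) * (of_int j + - of_int n / (2 * (of_int n + 1)))\<^sup>2)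
    = theta_factor \<tau> n d * (alt j * ee (of_int (n * j) * d + of_int ((n + 1) * j\<^sup>2 - n * j) * \<tau>))"
    unfolding alt_eq_powi x_def[symmetric] by (simp add: mult_ac)
qed

lemma theta_minus_numer:
  assumes "n \<ge> 1"
  shows "theta_minus (of_int n) (of_int n + 1) \<tau> (d / of_real (of_int n + 1) + s)
     = theta_factor \<tau> n d * (ee (of_real (of_int n / 2) * (d + s)) * numer_theta \<tau> n d s)"
  unfolding theta_minus_def numer_theta_def infsum_cmult_right'[symmetric]
proof (rule infsum_cong)
  fix j :: int
  define x where "x = real_of_int n"
  have x: "x + 1 \<noteq> 0" "x > 0" using assms by (auto simp: x_def)
  let ?y = "(x + 1) * (of_int j + x / (2 * (x + 1)))"
  have E1: "exp (2 * of_real pi * \<i> * of_real y * (d / of_real (x + 1) + s)) = qmonomial d s \<tau> (y / (x + 1)) y 0" for y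
    unfolding exp_eq_ee qmonomial_def by (simp add: distrib_left)
  have E2: "ee (of_int j * d + of_int ((n + 1) * j) * s + of_int ((n + 1) * j\<^sup>2 + n * j) * \<tau>)
      = qmonomial d s \<tau> (of_int j) ((x + 1) * of_int j) ((x + 1) * (of_int j)\<^sup>2 + x * of_int j)"
    unfolding qmonomial_def by (simp add: x_def)
  have E3: "ee (of_real (x / 2) * (d + s)) = qmonomial d s \<tau> (x / 2) (x / 2) 0"
    unfolding qmonomial_def by (simp add: distrib_left)
  have E4: "theta_factor \<tau> n d = qmonomial d s \<tau> (x / (2 * (x + 1)) - x / 2) 0 (x / 4 - x / (4 * (x + 1)))"
    by (simp add: theta_factor_def qmonomial_def x_def)
  have "exp (2 * of_real pi * \<i> * of_real ?y * (d / of_real (x + 1) + s))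
      * qpow \<tau> ((x + 1) * (of_int j + x / (2 * (x + 1)))\<^sup>2)
    = theta_factor \<tau> n d * (ee (of_real (x / 2) * (d + s))
       * ee (of_int j * d + of_int ((n + 1) * j) * s + of_int ((n + 1) * j\<^sup>2 + n * j) * \<tau>))"
    unfolding E1 E2 E3 E4 qpow_eq_qmonomial[of \<tau> _ d s] qmonomial_mult
    by (rule qmonomial_cong) (unfold recip_identities[OF x(1)], simp_all)
  then show "(-1) powi j * exp (2 * of_real pi * \<i> * of_real ((of_int n + 1) * (of_int j + of_int n / (2 * (of_int n + 1))))
        * (d / of_real (of_int n + 1) + s))
      * qpow \<tau> ((of_int n + 1) * (of_int j + of_int n / (2 * (of_int n + 1)))\<^sup>2)
    = theta_factor \<tau> n d * (ee (of_real (of_int n / 2) * (d + s)) * (alt j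
       * ee (of_int j * d + of_int ((n + 1) * j) * s + of_int ((n + 1) * j\<^sup>2 + n * j) * \<tau>)))"
    unfolding alt_eq_powi x_def[symmetric] by (simp add: mult_ac)
qed

lemma Phi_eq_appell_sum:
  "Phi (of_int n / 2) 0 (2 * \<tau>) (2 * z1) (2 * z2) 0
     = appell_sum \<tau> n (z1 - z2) (z1 + z2) - appell_sum \<tau> n (z1 - z2) (- (z1 + z2))"
proof -
  have "Phi1 (of_int n / 2) 0 (2 * \<tau>) (2 * z1) (2 * z2) 0 = appell_sum \<tau> n (z1 - z2) (z1 + z2)"
    by (simp add: Phi1_def appell_sum_def qpow_eq_ee ee_add algebra_simps)
       (simp add: ee_def mult_ac add_ac flip: exp_add)
  moreover have "Phi2 (of_int n / 2) 0 (2 * \<tau>) (2 * z1) (2 * z2) 0 = appell_sum \<tau> n (z1 - z2) (- (z1 + z2))"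
  proof -
    have "exp (- 2 * of_real pi * \<i> * of_real (of_int n / 2) * of_int j * (2 * z1 + 2 * z2) - 2 * of_real pi * \<i> * of_real 0 * (2 * z2))
          * qpow (2 * \<tau>) (of_int n / 2 * (of_int j)\<^sup>2 + 0 * of_int j)
        = ee (of_int (n * j) * - (z1 + z2) + of_int (n * j\<^sup>2) * \<tau>)" for j
      unfolding ee_def qpow_def exp_add[symmetric]
      by (rule arg_cong[of _ _ exp]) (simp add: algebra_simps)
    moreover have "exp (- 2 * of_real pi * \<i> * (2 * z2)) * qpow (2 * \<tau>) (of_int j)
        = ee ((z1 - z2) + - (z1 + z2) + 2 * of_int j * \<tau>)" for j
      unfolding ee_def qpow_def exp_add[symmetric]
      by (rule arg_cong[of _ _ exp]) (simp add: algebra_simps)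
    ultimately show ?thesis
      unfolding Phi2_def appell_sum_def by simp
  qed
  ultimately show ?thesis by (simp add: Phi_def)
qed

lemma ee_half_int: "ee (of_int k / 2) = alt k"
proof -
  have "ee (1 / 2) = -1" by (simp add: ee_def)
  then show ?thesis using ee_powi[of "1 / 2" k] alt_eq_powi[of k] by simp
qed

lemma mumford_theta_eq_theta_series:
  "mumford_theta 1 1 (2 * \<tau>) \<zeta> = \<i> * ee (\<tau> / 4 + \<zeta> / 2) * theta_series \<tau> \<zeta>"
  unfolding mumford_theta_def theta_series_def infsum_cmult_right'[symmetric]
proof (rule infsum_cong)
  fix h :: int
  have "of_real pi * \<i> * (of_int h + of_nat 1 / 2)\<^sup>2 * (2 * \<tau>)
      + 2 * of_real pi * \<i> * (of_int h + of_nat 1 / 2) * (\<zeta> + of_nat 1 / 2)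
    = 2 * of_real pi * \<i> * (1 / 4 + (of_int h / 2 + ((\<tau> / 4 + \<zeta> / 2) + (of_int h * \<zeta> + of_int (h * (h + 1)) * \<tau>))))"
    by (simp add: power2_eq_square field_simps)
  then have "exp (of_real pi * \<i> * (of_int h + of_nat 1 / 2)\<^sup>2 * (2 * \<tau>)
      + 2 * of_real pi * \<i> * (of_int h + of_nat 1 / 2) * (\<zeta> + of_nat 1 / 2))
    = ee (1 / 4 + (of_int h / 2 + ((\<tau> / 4 + \<zeta> / 2) + (of_int h * \<zeta> + of_int (h * (h + 1)) * \<tau>))))"
    by (simp only: ee_def)
  also have "\<dots> = ee (1 / 4) * (alt h * (ee (\<tau> / 4 + \<zeta> / 2) * ee (of_int h * \<zeta> + of_int (h * (h + 1)) * \<tau>)))"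
    by (simp only: ee_add ee_half_int)
  also have "ee (1 / 4) = \<i>"
    using cis_pi_half unfolding cis_conv_exp by (simp add: ee_def mult_ac)
  finally show "exp (of_real pi * \<i> * (of_int h + of_nat 1 / 2)\<^sup>2 * (2 * \<tau>)
      + 2 * of_real pi * \<i> * (of_int h + of_nat 1 / 2) * (\<zeta> + of_nat 1 / 2))
    = \<i> * ee (\<tau> / 4 + \<zeta> / 2) * (alt h * ee (of_int h * \<zeta> + of_int (h * (h + 1)) * \<tau>))"
    by (simp only: mult_ac)
qed

lemma theta_series_minus: "theta_series \<tau> (- \<xi>) = - ee \<xi> * theta_series \<tau> \<xi>"
proof -
  have bij: "bij_betw (\<lambda>h. - 1 - h) UNIV (UNIV :: int set)"
    by (rule bij_betwI[where g = "\<lambda>h. - 1 - h"]) auto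
  show ?thesis
    unfolding theta_series_def infsum_cmult_right'[symmetric]
      infsum_reindex_bij_betw[OF bij, symmetric, of "\<lambda>h. alt h * ee (of_int h * - \<xi> + of_int (h * (h + 1)) * \<tau>)"]
  proof (rule infsum_cong)
    fix h :: int
    have "of_int (- 1 - h) * - \<xi> + of_int ((- 1 - h) * (- 1 - h + 1)) * \<tau>
        = \<xi> + (of_int h * \<xi> + of_int (h * (h + 1)) * \<tau>)"
      by (simp add: algebra_simps)
    then have "ee (of_int (- 1 - h) * - \<xi> + of_int ((- 1 - h) * (- 1 - h + 1)) * \<tau>)
        = ee \<xi> * ee (of_int h * \<xi> + of_int (h * (h + 1)) * \<tau>)"
      by (simp only: flip: ee_add)
    moreover have "alt (- 1 - h) = - alt h" by (auto simp: alt_def)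
    ultimately show "alt (- 1 - h) * ee (of_int (- 1 - h) * - \<xi> + of_int ((- 1 - h) * (- 1 - h + 1)) * \<tau>)
        = - ee \<xi> * (alt h * ee (of_int h * \<xi> + of_int (h * (h + 1)) * \<tau>))"
      by (simp only: mult_minus_left mult_minus_right mult_ac)
  qed
qed

lemma mumford_theta_11_odd: "mumford_theta 1 1 (2 * \<tau>) (- \<zeta>) = - mumford_theta 1 1 (2 * \<tau>) \<zeta>"
proof -
  have "ee (\<tau> / 4 + - \<zeta> / 2) * ee \<zeta> = ee (\<tau> / 4 + \<zeta> / 2)"
    unfolding ee_add[symmetric] by (simp add: add.commute)
  then show ?thesis
    unfolding mumford_theta_eq_theta_series theta_series_minus by simp
qed

text \<open>
  Jacobi's identity makes the Euler product nonzero, so the product formula for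
  \<open>theta_series\<close> also shows that the denominator does not vanish.
\<close>

lemma eta_cube_over_theta:
  assumes tau: "Im \<tau> > 0" and nz: "\<And>j::int. ee (\<zeta> + 2 * of_int j * \<tau>) \<noteq> 1"
  shows "- \<i> * dedekind_eta (2 * \<tau>) ^ 3 / mumford_theta 1 1 (2 * \<tau>) \<zeta> = ee (\<zeta> / 2) * theta_recip \<tau> \<zeta>"
proof -
  define P where "P = (\<Prod>n. 1 - ee (2 * \<tau>) ^ Suc n)"
  have P: "P \<noteq> 0"
    unfolding P_def using tau by (intro qfac_limit(2)) (simp add: norm_ee)
  have TR: "theta_series \<tau> \<zeta> * theta_recip \<tau> \<zeta> = - ee (- \<zeta>) * P ^ 3"
    unfolding P_def by (rule theta_series_times_recip[OF tau nz])
  then have T: "theta_series \<tau> \<zeta> \<noteq> 0" using P by auto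
  have "qpow (2 * \<tau>) (real (Suc n)) = ee (2 * \<tau>) ^ Suc n" for n
    using ee_powi[of "2 * \<tau>" "int (Suc n)"]
    by (simp only: qpow_eq_ee power_int_of_nat of_int_of_nat_eq of_real_of_nat_eq)
  then have "dedekind_eta (2 * \<tau>) = qpow (2 * \<tau>) (1 / 24) * P"
    by (simp add: dedekind_eta_def P_def)
  then have "dedekind_eta (2 * \<tau>) ^ 3 = qpow (2 * \<tau>) (1 / 24) ^ 3 * P ^ 3"
    by (simp add: power_mult_distrib)
  also have "qpow (2 * \<tau>) (1 / 24) ^ 3 = ee (\<tau> / 4)"
    by (simp add: qpow_eq_ee power3_eq_cube flip: ee_add)
  finally have eta: "dedekind_eta (2 * \<tau>) ^ 3 = ee (\<tau> / 4) * P ^ 3" .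
  have "- \<i> * dedekind_eta (2 * \<tau>) ^ 3 / mumford_theta 1 1 (2 * \<tau>) \<zeta>
      = - (P ^ 3) / (ee (\<zeta> / 2) * theta_series \<tau> \<zeta>)"
    unfolding eta mumford_theta_eq_theta_series ee_add by (simp add: field_simps T)
  also have "\<dots> = ee (\<zeta> / 2) * theta_recip \<tau> \<zeta>"
  proof -
    have "ee (\<zeta> / 2) * ee (\<zeta> / 2) * ee (- \<zeta>) = 1"
      unfolding ee_add[symmetric] by simp
    then have "- (P ^ 3) = ee (\<zeta> / 2) * ee (\<zeta> / 2) * (- ee (- \<zeta>) * P ^ 3)"
      by (simp add: mult.assoc[symmetric])
    then show ?thesis
      unfolding TR[symmetric] using T by (simp add: field_simps)
  qed
  finally show ?thesis .
qed

lemma has_sum_finite_sum: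
  fixes f :: "'b \<Rightarrow> 'a \<Rightarrow> complex"
  assumes "finite K" "\<And>k. k \<in> K \<Longrightarrow> (f k has_sum S k) A"
  shows "((\<lambda>x. \<Sum>k\<in>K. f k x) has_sum (\<Sum>k\<in>K. S k)) A"
  using assms by (induction K rule: finite_induct) (auto intro!: has_sum_add)

text \<open>
  Completing the square: the half-integral shift \<open>x / 2\<close> inside the square and the linear factor
  \<open>q^(x / 2 - t)\<close> cancel against the common factor, and the square of \<open>t\<close> splits into the part
  that belongs to \<open>lattice_term\<close> and the normalisation \<open>\<kappa>^2 / x\<close> of the theta series.
\<close>

lemma false_theta_term:
  fixes d \<tau> :: complex
  assumes n: "n \<ge> 1"
  defines "x \<equiv> real_of_int n"
  defines "pre \<equiv> qmonomial d 0 \<tau> (x / (2 * (x + 1))) 0 (- x / (4 * (x + 1)))"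
  assumes t: "of_int t = x * of_int r + real_of_int \<kappa>"
  shows "pre * (qmonomial d 0 \<tau> 0 0 ((x + 1) * (of_int l)\<^sup>2 - (2 * x * of_int l + x - 2 * of_int t)\<^sup>2 / (4 * x))
           * qmonomial d 0 \<tau> (of_int t - x / 2) 0 (x / 2 - of_int t)
           * (alt l * ee (of_real ((of_int \<kappa>)\<^sup>2 / x) * \<tau>)))
       = theta_factor \<tau> n d * lattice_term \<tau> n d \<kappa> r l"
proof -
  have x: "x > 0" "x + 1 \<noteq> 0" using n by (auto simp: x_def)
  have E1: "lattice_term \<tau> n d \<kappa> r l = alt l * qmonomial d 0 \<tau> (x * of_int r + of_int \<kappa>) 0
     ((of_int l)\<^sup>2 - x * of_int l + 2 * of_int l * (x * of_int r + of_int \<kappa>) - x * (of_int r)\<^sup>2 - 2 * of_int r * of_int \<kappa>)"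
    by (simp add: lattice_term_def qmonomial_def x_def)
  have E2: "ee (of_real ((of_int \<kappa>)\<^sup>2 / x) * \<tau>) = qmonomial d 0 \<tau> 0 0 ((of_int \<kappa>)\<^sup>2 / x)"
    by (simp add: qmonomial_def)
  have core: "(2 * x * of_int l + x - 2 * (x * of_int r + of_int \<kappa>))\<^sup>2 / (4 * x)
      = x * (of_int l)\<^sup>2 + x / 4 + x * of_int l - 2 * of_int l * (x * of_int r + of_int \<kappa>)
        - (x * of_int r + of_int \<kappa>)
        + (x * (of_int r)\<^sup>2 + 2 * of_int r * of_int \<kappa> + (of_int \<kappa>)\<^sup>2 / x)"
    using x(1) by (simp add: field_simps power2_eq_square)
  have "pre * (qmonomial d 0 \<tau> 0 0 ((x + 1) * (of_int l)\<^sup>2 - (2 * x * of_int l + x - 2 * of_int t)\<^sup>2 / (4 * x))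
           * qmonomial d 0 \<tau> (of_int t - x / 2) 0 (x / 2 - of_int t) * qmonomial d 0 \<tau> 0 0 ((of_int \<kappa>)\<^sup>2 / x))
     = theta_factor \<tau> n d * qmonomial d 0 \<tau> (x * of_int r + of_int \<kappa>) 0
     ((of_int l)\<^sup>2 - x * of_int l + 2 * of_int l * (x * of_int r + of_int \<kappa>) - x * (of_int r)\<^sup>2 - 2 * of_int r * of_int \<kappa>)"
    unfolding pre_def theta_factor_def x_def[symmetric] qmonomial_mult t
    by (rule qmonomial_cong) (unfold core, simp_all add: algebra_simps)
  then show ?thesis unfolding E1 E2 by (simp add: mult_ac)
qed

section \<open>The false theta double sums and the identity\<close>

lemma exp_times_qpow:
  "exp (of_real pi * \<i> * of_real e * d) * qpow \<tau> (- (1 / 2) * e) = qmonomial d 0 \<tau> (e / 2) 0 (- e / 2)"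
  "exp (- of_real pi * \<i> * of_real e * d) * qpow \<tau> (1 / 2 * e) = qmonomial d 0 \<tau> (- e / 2) 0 (e / 2)"
  unfolding qpow_def qmonomial_def ee_def exp_add[symmetric]
  by (rule arg_cong[of _ _ exp], simp add: algebra_simps)+

text \<open>
  Each summand of the theorem consists of two terms, one with \<open>l = j\<close> and one with \<open>l = - j\<close>, which
  lie in opposite residue classes and opposite cones.
\<close>

lemma false_theta_summand:
  fixes m :: real and r j \<kappa> :: nat and d \<tau> :: complex
  assumes n: "n \<ge> 1" and m: "m = of_int n / 2"
  defines "pre \<equiv> qpow \<tau> (- (m / (2 * (2 * m + 1)))) * exp (2 * of_real pi * \<i> * of_real m / of_real (2 * m + 1) * d)"
  shows "pre * ((-1) ^ j
            * qpow \<tau> ((2 * m + 1) * (real j)\<^sup>2 - 1 / (8 * m) * (4 * m * (real j - real r) + 2 * m - real (2 * \<kappa>))\<^sup>2)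
            * (exp (of_real pi * \<i> * of_real (4 * m * real r - 2 * m + real (2 * \<kappa>)) * d)
                 * qpow \<tau> (- (1 / 2) * (4 * m * real r - 2 * m + real (2 * \<kappa>)))
               + exp (- of_real pi * \<i> * of_real (4 * m * real r - 2 * m + real (2 * \<kappa>)) * d)
                 * qpow \<tau> (1 / 2 * (4 * m * real r - 2 * m + real (2 * \<kappa>))))
            * theta_diff (real (2 * \<kappa>)) (2 * m) \<tau> s)
      = theta_factor \<tau> n d * class_diff \<tau> n s (int \<kappa>)
        * (lattice_term \<tau> n d (int \<kappa>) (int r) (int j) + lattice_term \<tau> n d (- int \<kappa>) (1 - int r) (- int j))"
    and "pre * ((-1) ^ j
            * qpow \<tau> ((2 * m + 1) * (real j)\<^sup>2 - 1 / (8 * m) * (4 * m * (real j - real r) - 2 * m + real (2 * \<kappa>))\<^sup>2)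
            * (exp (of_real pi * \<i> * of_real (4 * m * real r + 2 * m - real (2 * \<kappa>)) * d)
                 * qpow \<tau> (- (1 / 2) * (4 * m * real r + 2 * m - real (2 * \<kappa>)))
               + exp (- of_real pi * \<i> * of_real (4 * m * real r + 2 * m - real (2 * \<kappa>)) * d)
                 * qpow \<tau> (1 / 2 * (4 * m * real r + 2 * m - real (2 * \<kappa>))))
            * theta_diff (real (2 * \<kappa>)) (2 * m) \<tau> s)
      = theta_factor \<tau> n d * class_diff \<tau> n s (int \<kappa>)
        * (lattice_term \<tau> n d (- int \<kappa>) (1 + int r) (int j) + lattice_term \<tau> n d (int \<kappa>) (- int r) (- int j))"
proof -
  define x where "x = real_of_int n"
  have x: "x > 0" using n by (simp add: x_def)
  have mx: "m = x / 2" by (simp add: m x_def)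
  have pre: "pre = qmonomial d 0 \<tau> (x / (2 * (x + 1))) 0 (- x / (4 * (x + 1)))"
  proof -
    have "m / (2 * m + 1) = x / (2 * (x + 1))"
      using x by (simp add: mx field_simps)
    moreover have "2 * of_real pi * \<i> * of_real m / of_real (2 * m + 1) * d
        = 2 * of_real pi * \<i> * (of_real (m / (2 * m + 1)) * d)"
      by simp
    ultimately have "2 * of_real pi * \<i> * of_real m / of_real (2 * m + 1) * d
        = 2 * of_real pi * \<i> * (of_real (x / (2 * (x + 1))) * d)"
      by (simp only:)
    moreover have "- (m / (2 * (2 * m + 1))) = - x / (4 * (x + 1))"
      using x by (simp add: mx field_simps)
    ultimately show ?thesis
      unfolding pre_def qmonomial_def ee_add qpow_eq_ee by (simp only:) (simp add: ee_def)
  qed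
  have td: "theta_diff (real (2 * \<kappa>)) (2 * m) \<tau> s
      = ee (of_real ((of_int (int \<kappa>))\<^sup>2 / x) * \<tau>) * class_diff \<tau> n s (int \<kappa>)"
    using theta_diff_eq_class_diff(1)[OF n, of "int \<kappa>" \<tau> s] by (simp add: mx x_def)
  have combine: "pre * (sg * a * (b1 + b2) * th) = Z * K * (l1 + l2)"
    if "pre * (a * b1 * (sg * e1)) = Z * l1" "pre * (a * b2 * (sg * e1)) = Z * l2" "th = e1 * K"
    for sg a b1 b2 th Z K l1 l2 e1
  proof -
    have "pre * (sg * a * (b1 + b2) * th) = K * (pre * (a * b1 * (sg * e1)) + pre * (a * b2 * (sg * e1)))"
      unfolding that(3) by (simp add: algebra_simps)
    then show ?thesis unfolding that(1,2) by (simp add: algebra_simps)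
  qed
  note trm = false_theta_term[OF n, where d = d and \<tau> = \<tau>, folded x_def, folded pre]
  show "pre * ((-1) ^ j
            * qpow \<tau> ((2 * m + 1) * (real j)\<^sup>2 - 1 / (8 * m) * (4 * m * (real j - real r) + 2 * m - real (2 * \<kappa>))\<^sup>2)
            * (exp (of_real pi * \<i> * of_real (4 * m * real r - 2 * m + real (2 * \<kappa>)) * d)
                 * qpow \<tau> (- (1 / 2) * (4 * m * real r - 2 * m + real (2 * \<kappa>)))
               + exp (- of_real pi * \<i> * of_real (4 * m * real r - 2 * m + real (2 * \<kappa>)) * d)
                 * qpow \<tau> (1 / 2 * (4 * m * real r - 2 * m + real (2 * \<kappa>))))
            * theta_diff (real (2 * \<kappa>)) (2 * m) \<tau> s)
      = theta_factor \<tau> n d * class_diff \<tau> n s (int \<kappa>)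
        * (lattice_term \<tau> n d (int \<kappa>) (int r) (int j) + lattice_term \<tau> n d (- int \<kappa>) (1 - int r) (- int j))"
    unfolding exp_times_qpow unfolding qpow_eq_qmonomial[of _ _ d 0] alt_eq_power
  proof (rule combine[OF _ _ td])
    have "(4 * m * (real j - real r) + 2 * m - real (2 * \<kappa>))\<^sup>2 = (2 * x * of_int (int j) + x - 2 * of_int (n * int r + int \<kappa>))\<^sup>2"
      by (simp add: mx x_def power2_eq_square algebra_simps)
    then have "(2 * m + 1) * (real j)\<^sup>2 - 1 / (8 * m) * (4 * m * (real j - real r) + 2 * m - real (2 * \<kappa>))\<^sup>2
        = (x + 1) * (of_int (int j))\<^sup>2 - (2 * x * of_int (int j) + x - 2 * of_int (n * int r + int \<kappa>))\<^sup>2 / (4 * x)"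
      by (simp only:) (simp add: mx)
    moreover have "(4 * m * real r - 2 * m + real (2 * \<kappa>)) / 2 = of_int (n * int r + int \<kappa>) - x / 2"
      by (simp add: mx x_def field_simps)
    moreover have "- (4 * m * real r - 2 * m + real (2 * \<kappa>)) / 2 = x / 2 - of_int (n * int r + int \<kappa>)"
      by (simp add: mx x_def field_simps)
    ultimately show "pre * (qmonomial d 0 \<tau> 0 0 ((2 * m + 1) * (real j)\<^sup>2 - 1 / (8 * m) * (4 * m * (real j - real r) + 2 * m - real (2 * \<kappa>))\<^sup>2)
        * qmonomial d 0 \<tau> ((4 * m * real r - 2 * m + real (2 * \<kappa>)) / 2) 0 (- (4 * m * real r - 2 * m + real (2 * \<kappa>)) / 2)
        * (alt (int j) * ee (of_real ((of_int (int \<kappa>))\<^sup>2 / x) * \<tau>))) = theta_factor \<tau> n d * lattice_term \<tau> n d (int \<kappa>) (int r) (int j)"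
      by (simp only:) (rule trm, simp add: x_def)
    have "(4 * m * (real j - real r) + 2 * m - real (2 * \<kappa>))\<^sup>2 = (2 * x * of_int (- int j) + x - 2 * of_int (n * (1 - int r) + - int \<kappa>))\<^sup>2"
      by (simp add: mx x_def power2_eq_square algebra_simps)
    then have "(2 * m + 1) * (real j)\<^sup>2 - 1 / (8 * m) * (4 * m * (real j - real r) + 2 * m - real (2 * \<kappa>))\<^sup>2
        = (x + 1) * (of_int (- int j))\<^sup>2 - (2 * x * of_int (- int j) + x - 2 * of_int (n * (1 - int r) + - int \<kappa>))\<^sup>2 / (4 * x)"
      by (simp only:) (simp add: mx)
    moreover have "- (4 * m * real r - 2 * m + real (2 * \<kappa>)) / 2 = of_int (n * (1 - int r) + - int \<kappa>) - x / 2"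
      by (simp add: mx x_def field_simps)
    moreover have "(4 * m * real r - 2 * m + real (2 * \<kappa>)) / 2 = x / 2 - of_int (n * (1 - int r) + - int \<kappa>)"
      by (simp add: mx x_def field_simps)
    moreover have "alt (int j) * ee (of_real ((of_int (int \<kappa>))\<^sup>2 / x) * \<tau>)
        = alt (- int j) * ee (of_real ((of_int (- int \<kappa>))\<^sup>2 / x) * \<tau>)"
      by simp
    ultimately show "pre * (qmonomial d 0 \<tau> 0 0 ((2 * m + 1) * (real j)\<^sup>2 - 1 / (8 * m) * (4 * m * (real j - real r) + 2 * m - real (2 * \<kappa>))\<^sup>2)
        * qmonomial d 0 \<tau> (- (4 * m * real r - 2 * m + real (2 * \<kappa>)) / 2) 0 ((4 * m * real r - 2 * m + real (2 * \<kappa>)) / 2)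
        * (alt (int j) * ee (of_real ((of_int (int \<kappa>))\<^sup>2 / x) * \<tau>))) = theta_factor \<tau> n d * lattice_term \<tau> n d (- int \<kappa>) (1 - int r) (- int j)"
      by (simp only:) (rule trm, simp add: x_def)
  qed
  show "pre * ((-1) ^ j
            * qpow \<tau> ((2 * m + 1) * (real j)\<^sup>2 - 1 / (8 * m) * (4 * m * (real j - real r) - 2 * m + real (2 * \<kappa>))\<^sup>2)
            * (exp (of_real pi * \<i> * of_real (4 * m * real r + 2 * m - real (2 * \<kappa>)) * d)
                 * qpow \<tau> (- (1 / 2) * (4 * m * real r + 2 * m - real (2 * \<kappa>)))
               + exp (- of_real pi * \<i> * of_real (4 * m * real r + 2 * m - real (2 * \<kappa>)) * d)
                 * qpow \<tau> (1 / 2 * (4 * m * real r + 2 * m - real (2 * \<kappa>))))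
            * theta_diff (real (2 * \<kappa>)) (2 * m) \<tau> s)
      = theta_factor \<tau> n d * class_diff \<tau> n s (int \<kappa>)
        * (lattice_term \<tau> n d (- int \<kappa>) (1 + int r) (int j) + lattice_term \<tau> n d (int \<kappa>) (- int r) (- int j))"
    unfolding exp_times_qpow unfolding qpow_eq_qmonomial[of _ _ d 0] alt_eq_power
  proof (rule combine[OF _ _ td])
    have "(4 * m * (real j - real r) - 2 * m + real (2 * \<kappa>))\<^sup>2 = (2 * x * of_int (int j) + x - 2 * of_int (n * (1 + int r) + - int \<kappa>))\<^sup>2"
      by (simp add: mx x_def power2_eq_square algebra_simps)
    then have "(2 * m + 1) * (real j)\<^sup>2 - 1 / (8 * m) * (4 * m * (real j - real r) - 2 * m + real (2 * \<kappa>))\<^sup>2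
        = (x + 1) * (of_int (int j))\<^sup>2 - (2 * x * of_int (int j) + x - 2 * of_int (n * (1 + int r) + - int \<kappa>))\<^sup>2 / (4 * x)"
      by (simp only:) (simp add: mx)
    moreover have "(4 * m * real r + 2 * m - real (2 * \<kappa>)) / 2 = of_int (n * (1 + int r) + - int \<kappa>) - x / 2"
      by (simp add: mx x_def field_simps)
    moreover have "- (4 * m * real r + 2 * m - real (2 * \<kappa>)) / 2 = x / 2 - of_int (n * (1 + int r) + - int \<kappa>)"
      by (simp add: mx x_def field_simps)
    moreover have "alt (int j) * ee (of_real ((of_int (int \<kappa>))\<^sup>2 / x) * \<tau>)
        = alt (int j) * ee (of_real ((of_int (- int \<kappa>))\<^sup>2 / x) * \<tau>)"
      by simp
    ultimately show "pre * (qmonomial d 0 \<tau> 0 0 ((2 * m + 1) * (real j)\<^sup>2 - 1 / (8 * m) * (4 * m * (real j - real r) - 2 * m + real (2 * \<kappa>))\<^sup>2)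
        * qmonomial d 0 \<tau> ((4 * m * real r + 2 * m - real (2 * \<kappa>)) / 2) 0 (- (4 * m * real r + 2 * m - real (2 * \<kappa>)) / 2)
        * (alt (int j) * ee (of_real ((of_int (int \<kappa>))\<^sup>2 / x) * \<tau>))) = theta_factor \<tau> n d * lattice_term \<tau> n d (- int \<kappa>) (1 + int r) (int j)"
      by (simp only:) (rule trm, simp add: x_def)
    have "(4 * m * (real j - real r) - 2 * m + real (2 * \<kappa>))\<^sup>2 = (2 * x * of_int (- int j) + x - 2 * of_int (n * (- int r) + int \<kappa>))\<^sup>2"
      by (simp add: mx x_def power2_eq_square algebra_simps)
    then have "(2 * m + 1) * (real j)\<^sup>2 - 1 / (8 * m) * (4 * m * (real j - real r) - 2 * m + real (2 * \<kappa>))\<^sup>2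
        = (x + 1) * (of_int (- int j))\<^sup>2 - (2 * x * of_int (- int j) + x - 2 * of_int (n * (- int r) + int \<kappa>))\<^sup>2 / (4 * x)"
      by (simp only:) (simp add: mx)
    moreover have "- (4 * m * real r + 2 * m - real (2 * \<kappa>)) / 2 = of_int (n * (- int r) + int \<kappa>) - x / 2"
      by (simp add: mx x_def field_simps)
    moreover have "(4 * m * real r + 2 * m - real (2 * \<kappa>)) / 2 = x / 2 - of_int (n * (- int r) + int \<kappa>)"
      by (simp add: mx x_def field_simps)
    moreover have "alt (int j) = alt (- int j)" by simp
    ultimately show "pre * (qmonomial d 0 \<tau> 0 0 ((2 * m + 1) * (real j)\<^sup>2 - 1 / (8 * m) * (4 * m * (real j - real r) - 2 * m + real (2 * \<kappa>))\<^sup>2)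
        * qmonomial d 0 \<tau> (- (4 * m * real r + 2 * m - real (2 * \<kappa>)) / 2) 0 ((4 * m * real r + 2 * m - real (2 * \<kappa>)) / 2)
        * (alt (int j) * ee (of_real ((of_int (int \<kappa>))\<^sup>2 / x) * \<tau>))) = theta_factor \<tau> n d * lattice_term \<tau> n d (int \<kappa>) (- int r) (- int j)"
      by (simp only:) (rule trm, simp add: x_def)
  qed
qed

text \<open>
  The index \<open>k = 0\<close> contributes nothing because \<open>class_diff\<close> vanishes there.
\<close>

lemma false_theta_double_sums:
  fixes M :: nat and m :: real and d \<tau> :: complex
  assumes tau: "Im \<tau> > 0" and n: "n = 2 * int M + 1" and m: "m = of_int n / 2"
  defines "pre \<equiv> qpow \<tau> (- (m / (2 * (2 * m + 1)))) * exp (2 * of_real pi * \<i> * of_real m / of_real (2 * m + 1) * d)"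
  shows "pre * (\<Sum>\<^sub>\<infinity>j::nat\<in>{1..}. \<Sum>r::nat\<in>{1..j}. \<Sum>k::nat\<in>{k. real k \<le> 2 * m - 1 \<and> even k}.
            (-1) ^ j
            * qpow \<tau> ((2 * m + 1) * (real j)\<^sup>2 - 1 / (8 * m) * (4 * m * (real j - real r) + 2 * m - real k)\<^sup>2)
            * (exp (of_real pi * \<i> * of_real (4 * m * real r - 2 * m + real k) * d)
                 * qpow \<tau> (- (1 / 2) * (4 * m * real r - 2 * m + real k))
               + exp (- of_real pi * \<i> * of_real (4 * m * real r - 2 * m + real k) * d)
                 * qpow \<tau> (1 / 2 * (4 * m * real r - 2 * m + real k)))
            * theta_diff (real k) (2 * m) \<tau> s)
      = theta_factor \<tau> n d * (\<Sum>k=1..M. class_diff \<tau> n s (int k)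
          * (upper_cone_sum \<tau> n d (int k) + lower_cone_sum \<tau> n d (- int k)))"
    and "pre * (\<Sum>\<^sub>\<infinity>j::nat\<in>{1..}. \<Sum>r::nat\<in>{0..j - 1}. \<Sum>k::nat\<in>{k. real k \<le> 2 * m - 1 \<and> even k}.
            (-1) ^ j
            * qpow \<tau> ((2 * m + 1) * (real j)\<^sup>2 - 1 / (8 * m) * (4 * m * (real j - real r) - 2 * m + real k)\<^sup>2)
            * (exp (of_real pi * \<i> * of_real (4 * m * real r + 2 * m - real k) * d)
                 * qpow \<tau> (- (1 / 2) * (4 * m * real r + 2 * m - real k))
               + exp (- of_real pi * \<i> * of_real (4 * m * real r + 2 * m - real k) * d)
                 * qpow \<tau> (1 / 2 * (4 * m * real r + 2 * m - real k)))
            * theta_diff (real k) (2 * m) \<tau> s)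
      = theta_factor \<tau> n d * (\<Sum>k=1..M. class_diff \<tau> n s (int k)
          * (upper_cone_sum \<tau> n d (- int k) + lower_cone_sum \<tau> n d (int k)))"
proof -
  have n1: "n \<ge> 1" using n by simp
  have K: "{k::nat. real k \<le> 2 * m - 1 \<and> even k} = (\<lambda>\<kappa>. 2 * \<kappa>) ` {0..M}"
  proof -
    have "2 * m - 1 = 2 * real M" by (simp add: m n field_simps)
    then show ?thesis by (auto elim!: evenE)
  qed
  have inj: "inj_on (\<lambda>\<kappa>::nat. 2 * \<kappa>) {0..M}" by (simp add: inj_on_def)
  have drop0: "(\<Sum>\<kappa>=0..M. class_diff \<tau> n s (int \<kappa>) * f \<kappa>) = (\<Sum>\<kappa>=1..M. class_diff \<tau> n s (int \<kappa>) * f \<kappa>)" for f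
    by (rule sum.mono_neutral_right) (auto simp: Suc_le_eq)
  have shift: "(\<Sum>r=1..j. g (1 - int r)) = (\<Sum>r=0..j-1. g (- int r))"
    "(\<Sum>r=0..j-1. g (1 + int r)) = (\<Sum>r=1..j. g (int r))" if "j \<ge> 1" for g :: "int \<Rightarrow> complex" and j
  proof -
    define j' where "j' = j - 1"
    have j: "j = Suc j'" using that by (simp add: j'_def)
    show "(\<Sum>r=1..j. g (1 - int r)) = (\<Sum>r=0..j-1. g (- int r))"
      "(\<Sum>r=0..j-1. g (1 + int r)) = (\<Sum>r=1..j. g (int r))"
      unfolding j One_nat_def sum.shift_bounds_cl_Suc_ivl by simp_all
  qed
  note rows = has_sum_cone_rows[OF tau n1]
  have main: "(\<Sum>\<^sub>\<infinity>j::nat\<in>{1..}. \<Sum>r\<in>R j. \<Sum>\<kappa>=0..M. theta_factor \<tau> n d * class_diff \<tau> n s (int \<kappa>) * (f \<kappa> j r + g \<kappa> j r))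
      = theta_factor \<tau> n d * (\<Sum>\<kappa>=1..M. class_diff \<tau> n s (int \<kappa>) * (A \<kappa> + B \<kappa>))"
    if "\<And>\<kappa>. ((\<lambda>j. \<Sum>r\<in>R j. f \<kappa> j r) has_sum A \<kappa>) {1..}" "\<And>\<kappa>. ((\<lambda>j. \<Sum>r\<in>R j. g \<kappa> j r) has_sum B \<kappa>) {1..}"
    for R :: "nat \<Rightarrow> nat set" and f g :: "nat \<Rightarrow> nat \<Rightarrow> nat \<Rightarrow> complex" and A B
  proof (rule infsumI)
    have "((\<lambda>j. \<Sum>\<kappa>=0..M. theta_factor \<tau> n d * class_diff \<tau> n s (int \<kappa>) * ((\<Sum>r\<in>R j. f \<kappa> j r) + (\<Sum>r\<in>R j. g \<kappa> j r)))
        has_sum (\<Sum>\<kappa>=0..M. theta_factor \<tau> n d * class_diff \<tau> n s (int \<kappa>) * (A \<kappa> + B \<kappa>))) {1..}"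
      by (intro has_sum_finite_sum has_sum_cmult_right has_sum_add that) simp
    also have "(\<lambda>j. \<Sum>\<kappa>=0..M. theta_factor \<tau> n d * class_diff \<tau> n s (int \<kappa>) * ((\<Sum>r\<in>R j. f \<kappa> j r) + (\<Sum>r\<in>R j. g \<kappa> j r)))
        = (\<lambda>j. \<Sum>r\<in>R j. \<Sum>\<kappa>=0..M. theta_factor \<tau> n d * class_diff \<tau> n s (int \<kappa>) * (f \<kappa> j r + g \<kappa> j r))"
      unfolding sum.distrib[symmetric] sum_distrib_left by (intro ext sum.swap)
    also have "(\<Sum>\<kappa>=0..M. theta_factor \<tau> n d * class_diff \<tau> n s (int \<kappa>) * (A \<kappa> + B \<kappa>))
        = theta_factor \<tau> n d * (\<Sum>\<kappa>=1..M. class_diff \<tau> n s (int \<kappa>) * (A \<kappa> + B \<kappa>))"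
      unfolding drop0[symmetric] sum_distrib_left by (simp only: mult.assoc)
    finally show "((\<lambda>j. \<Sum>r\<in>R j. \<Sum>\<kappa>=0..M. theta_factor \<tau> n d * class_diff \<tau> n s (int \<kappa>) * (f \<kappa> j r + g \<kappa> j r))
        has_sum theta_factor \<tau> n d * (\<Sum>\<kappa>=1..M. class_diff \<tau> n s (int \<kappa>) * (A \<kappa> + B \<kappa>))) {1..}" .
  qed
  note summand = false_theta_summand[OF n1 m, where \<tau> = \<tau> and d = d and s = s, folded pre_def]
  have low: "((\<lambda>j. \<Sum>r=1..j. lattice_term \<tau> n d \<kappa> (1 - int r) (- int j)) has_sum lower_cone_sum \<tau> n d \<kappa>) {1..}" for \<kappa>
    using rows(2)[of d \<kappa>] by (rule has_sum_cong[THEN iffD1, rotated]) (rule shift(1)[symmetric], simp)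
  have up: "((\<lambda>j. \<Sum>r=0..j-1. lattice_term \<tau> n d \<kappa> (1 + int r) (int j)) has_sum upper_cone_sum \<tau> n d \<kappa>) {1..}" for \<kappa>
    using rows(1)[of d \<kappa>] by (rule has_sum_cong[THEN iffD1, rotated]) (rule shift(2)[symmetric], simp)
  show "pre * (\<Sum>\<^sub>\<infinity>j::nat\<in>{1..}. \<Sum>r::nat\<in>{1..j}. \<Sum>k::nat\<in>{k. real k \<le> 2 * m - 1 \<and> even k}.
            (-1) ^ j
            * qpow \<tau> ((2 * m + 1) * (real j)\<^sup>2 - 1 / (8 * m) * (4 * m * (real j - real r) + 2 * m - real k)\<^sup>2)
            * (exp (of_real pi * \<i> * of_real (4 * m * real r - 2 * m + real k) * d)
                 * qpow \<tau> (- (1 / 2) * (4 * m * real r - 2 * m + real k))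
               + exp (- of_real pi * \<i> * of_real (4 * m * real r - 2 * m + real k) * d)
                 * qpow \<tau> (1 / 2 * (4 * m * real r - 2 * m + real k)))
            * theta_diff (real k) (2 * m) \<tau> s)
      = theta_factor \<tau> n d * (\<Sum>k=1..M. class_diff \<tau> n s (int k)
          * (upper_cone_sum \<tau> n d (int k) + lower_cone_sum \<tau> n d (- int k)))"
    unfolding K sum.reindex[OF inj] o_def infsum_cmult_right'[symmetric] sum_distrib_left[of pre] summand(1)
    by (rule main[OF rows(1) low])
  show "pre * (\<Sum>\<^sub>\<infinity>j::nat\<in>{1..}. \<Sum>r::nat\<in>{0..j - 1}. \<Sum>k::nat\<in>{k. real k \<le> 2 * m - 1 \<and> even k}.
            (-1) ^ j
            * qpow \<tau> ((2 * m + 1) * (real j)\<^sup>2 - 1 / (8 * m) * (4 * m * (real j - real r) - 2 * m + real k)\<^sup>2)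
            * (exp (of_real pi * \<i> * of_real (4 * m * real r + 2 * m - real k) * d)
                 * qpow \<tau> (- (1 / 2) * (4 * m * real r + 2 * m - real k))
               + exp (- of_real pi * \<i> * of_real (4 * m * real r + 2 * m - real k) * d)
                 * qpow \<tau> (1 / 2 * (4 * m * real r + 2 * m - real k)))
            * theta_diff (real k) (2 * m) \<tau> s)
      = theta_factor \<tau> n d * (\<Sum>k=1..M. class_diff \<tau> n s (int k)
          * (upper_cone_sum \<tau> n d (- int k) + lower_cone_sum \<tau> n d (int k)))"
    unfolding K sum.reindex[OF inj] o_def infsum_cmult_right'[symmetric] sum_distrib_left[of pre] summand(2)
    by (rule main[OF up rows(2)])
qed

text \<open>
  The two half-integral powers of \<open>v w\<close>, one from each theta function, combine to the
  integral power with exponent \<open>(n + 1) / 2 = M + 1\<close>.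
\<close>

lemma eta_theta_part:
  assumes tau: "Im \<tau> > 0" and n: "n = 2 * int M + 1"
    and nz: "\<And>j::int. ee (d + s + 2 * of_int j * \<tau>) \<noteq> 1"
  shows "- \<i> * dedekind_eta (2 * \<tau>) ^ 3 / mumford_theta 1 1 (2 * \<tau>) (d + s)
        * theta_minus (of_int n) (of_int n + 1) \<tau> (d / of_real (of_int n + 1) + s)
      = theta_factor \<tau> n d * (ee (of_int (int M + 1) * (d + s)) * (numer_theta \<tau> n d s * theta_recip \<tau> (d + s)))"
proof -
  have n1: "n \<ge> 1" using n by simp
  have "(d + s) / 2 + of_real (of_int n / 2) * (d + s) = of_int (int M + 1) * (d + s)"
    by (simp add: n field_simps)
  then have "ee ((d + s) / 2) * ee (of_real (of_int n / 2) * (d + s)) = ee (of_int (int M + 1) * (d + s))"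
    by (simp only: flip: ee_add)
  then show ?thesis
    unfolding eta_cube_over_theta[OF tau nz] theta_minus_numer[OF n1] by (simp add: mult_ac)
qed

theorem proposition3p3:
  fixes m :: real and \<tau> z1 z2 :: complex
  assumes m: "\<exists>n::nat. odd n \<and> m = real n / 2"
    and tau: "Im \<tau> > 0"
    and z1: "\<And>a b :: int. 2 * z1 \<noteq> of_int a + of_int b * (2 * \<tau>)"
    and z2: "\<And>a b :: int. 2 * z2 \<noteq> of_int a + of_int b * (2 * \<tau>)"
  shows
    "theta_minus (- 2 * m) (2 * m + 1) \<tau> (of_real (2 * m) * (z1 - z2) / of_real (2 * m + 1))
       * Phi m 0 (2 * \<tau>) (2 * z1) (2 * z2) 0
     = - \<i> * dedekind_eta (2 * \<tau>) ^ 3 *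
         (theta_minus (2 * m) (2 * m + 1) \<tau> ((z1 - z2) / of_real (2 * m + 1) + z1 + z2)
            / mumford_theta 1 1 (2 * \<tau>) (2 * z1)
          + theta_minus (2 * m) (2 * m + 1) \<tau> ((z1 - z2) / of_real (2 * m + 1) - z1 - z2)
            / mumford_theta 1 1 (2 * \<tau>) (2 * z2))
       - qpow \<tau> (- (m / (2 * (2 * m + 1))))
         * exp (2 * of_real pi * \<i> * of_real m / of_real (2 * m + 1) * (z1 - z2)) *
         (\<Sum>\<^sub>\<infinity>j::nat\<in>{1..}. \<Sum>r::nat\<in>{1..j}. \<Sum>k::nat\<in>{k. real k \<le> 2 * m - 1 \<and> even k}.
            (-1) ^ j
            * qpow \<tau> ((2 * m + 1) * (real j)\<^sup>2 - 1 / (8 * m) * (4 * m * (real j - real r) + 2 * m - real k)\<^sup>2)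
            * (exp (of_real pi * \<i> * of_real (4 * m * real r - 2 * m + real k) * (z1 - z2))
                 * qpow \<tau> (- (1 / 2) * (4 * m * real r - 2 * m + real k))
               + exp (- of_real pi * \<i> * of_real (4 * m * real r - 2 * m + real k) * (z1 - z2))
                 * qpow \<tau> (1 / 2 * (4 * m * real r - 2 * m + real k)))
            * theta_diff (real k) (2 * m) \<tau> (z1 + z2))
       + qpow \<tau> (- (m / (2 * (2 * m + 1))))
         * exp (2 * of_real pi * \<i> * of_real m / of_real (2 * m + 1) * (z1 - z2)) *
         (\<Sum>\<^sub>\<infinity>j::nat\<in>{1..}. \<Sum>r::nat\<in>{0..j - 1}. \<Sum>k::nat\<in>{k. real k \<le> 2 * m - 1 \<and> even k}.
            (-1) ^ j
            * qpow \<tau> ((2 * m + 1) * (real j)\<^sup>2 - 1 / (8 * m) * (4 * m * (real j - real r) - 2 * m + real k)\<^sup>2)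
            * (exp (of_real pi * \<i> * of_real (4 * m * real r + 2 * m - real k) * (z1 - z2))
                 * qpow \<tau> (- (1 / 2) * (4 * m * real r + 2 * m - real k))
               + exp (- of_real pi * \<i> * of_real (4 * m * real r + 2 * m - real k) * (z1 - z2))
                 * qpow \<tau> (1 / 2 * (4 * m * real r + 2 * m - real k)))
            * theta_diff (real k) (2 * m) \<tau> (z1 + z2))
       + theta_minus (- 2 * m) (2 * m + 1) \<tau> (of_real (2 * m) * (z1 - z2) / of_real (2 * m + 1)) *
         (\<Sum>k::nat\<in>{k. 1 \<le> k \<and> real k \<le> m - 1 / 2}.
            exp (2 * of_real pi * \<i> * of_nat k * (z1 - z2)) * qpow \<tau> (- ((real k)\<^sup>2 / (2 * m)))
            * theta_diff (real k) m (2 * \<tau>) (2 * z1 + 2 * z2))"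
proof -
  obtain n' :: nat where n': "odd n'" "m = real n' / 2" using m by blast
  then obtain M where M: "n' = 2 * M + 1" by (elim oddE)
  define n where "n = 2 * int M + 1"
  have n1: "n \<ge> 1" by (simp add: n_def)
  have m_n: "m = of_int n / 2" using n' M by (simp add: n_def)
  have two_m: "2 * m = of_int n" by (simp add: m_n)
  define d where "d = z1 - z2"
  define s where "s = z1 + z2"
  have ds: "2 * z1 = d + s" "- (2 * z2) = d + - s" by (simp_all add: d_def s_def)
  have lattice: "ee (\<zeta> + 2 * of_int j * \<tau>) \<noteq> 1"
    if "\<And>a b :: int. \<zeta> \<noteq> of_int a + of_int b * (2 * \<tau>)" for \<zeta> and j :: int
  proof
    assume "ee (\<zeta> + 2 * of_int j * \<tau>) = 1"
    then have "exp (2 * of_real pi * \<i> * (\<zeta> + 2 * of_int j * \<tau>)) = 1" by (simp add: ee_def)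
    then obtain a :: int where "2 * of_real pi * \<i> * (\<zeta> + 2 * of_int j * \<tau>) = of_int (2 * a) * of_real pi * \<i>"
      unfolding exp_eq_1 by (auto simp: complex_eq_iff)
    then have "\<zeta> + 2 * of_int j * \<tau> = of_int a" by simp
    then have "\<zeta> = of_int a + of_int (- j) * (2 * \<tau>)" by (simp add: algebra_simps eq_diff_eq)
    then show False using that by blast
  qed
  have nz1: "ee (d + s + 2 * of_int j * \<tau>) \<noteq> 1" for j :: int
    unfolding ds(1)[symmetric] by (rule lattice[OF z1])
  have nz2: "ee (d + - s + 2 * of_int j * \<tau>) \<noteq> 1" for j :: int
    unfolding ds(2)[symmetric]
  proof (rule lattice)
    fix a b :: int
    show "- (2 * z2) \<noteq> of_int a + of_int b * (2 * \<tau>)"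
      using z2[of "- a" "- b"] by (simp add: minus_equation_iff[of "2 * z2"] eq_commute)
  qed

  let ?Z = "theta_factor \<tau> n d"
  let ?K = "\<lambda>k. class_diff \<tau> n s (int k)"
  let ?up = "\<lambda>k. upper_cone_sum \<tau> n d k" and ?lo = "\<lambda>k. lower_cone_sum \<tau> n d k"
  have A: "theta_minus (- 2 * m) (2 * m + 1) \<tau> (of_real (2 * m) * (z1 - z2) / of_real (2 * m + 1)) = ?Z * denom_theta \<tau> n d"
    using theta_minus_denom[OF n1, of \<tau> d] by (simp only: two_m d_def mult_minus_left)
  have Phi: "Phi m 0 (2 * \<tau>) (2 * z1) (2 * z2) 0 = appell_sum \<tau> n d s - appell_sum \<tau> n d (- s)"
    unfolding m_n Phi_eq_appell_sum d_def s_def ..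
  \<comment> \<open>Reading the second argument as \<open>- (d - s)\<close> makes the second quotient the first one at \<open>- s\<close>, up to a sign.\<close>
  have mum2: "mumford_theta 1 1 (2 * \<tau>) (2 * z2) = - mumford_theta 1 1 (2 * \<tau>) (d + - s)"
    unfolding ds(2)[symmetric] mumford_theta_11_odd by simp
  have E: "- \<i> * dedekind_eta (2 * \<tau>) ^ 3 *
         (theta_minus (2 * m) (2 * m + 1) \<tau> ((z1 - z2) / of_real (2 * m + 1) + z1 + z2)
            / mumford_theta 1 1 (2 * \<tau>) (2 * z1)
          + theta_minus (2 * m) (2 * m + 1) \<tau> ((z1 - z2) / of_real (2 * m + 1) - z1 - z2)
            / mumford_theta 1 1 (2 * \<tau>) (2 * z2))
      = ?Z * (ee (of_int (int M + 1) * (d + s)) * (numer_theta \<tau> n d s * theta_recip \<tau> (d + s)))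
        - ?Z * (ee (of_int (int M + 1) * (d + - s)) * (numer_theta \<tau> n d (- s) * theta_recip \<tau> (d + - s)))"
  proof -
    have "(z1 - z2) / of_real (2 * m + 1) + z1 + z2 = d / of_real (of_int n + 1) + s"
      "(z1 - z2) / of_real (2 * m + 1) - z1 - z2 = d / of_real (of_int n + 1) + - s"
      by (simp_all add: two_m d_def s_def)
    then show ?thesis
      unfolding eta_theta_part[OF tau n_def nz1, symmetric] eta_theta_part[OF tau n_def nz2, symmetric]
        mum2 ds(1) by (simp only: two_m) (simp add: algebra_simps)
  qed
  note S = false_theta_double_sums[OF tau n_def m_n, where d = d and s = s]
  have F: "(\<Sum>k::nat\<in>{k. 1 \<le> k \<and> real k \<le> m - 1 / 2}.
            exp (2 * of_real pi * \<i> * of_nat k * (z1 - z2)) * qpow \<tau> (- ((real k)\<^sup>2 / (2 * m)))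
            * theta_diff (real k) m (2 * \<tau>) (2 * z1 + 2 * z2))
      = (\<Sum>k=1..M. ee (of_int (int k) * d) * ?K k)"
  proof (rule sum.cong)
    show "{k. 1 \<le> k \<and> real k \<le> m - 1 / 2} = {1..M}"
    proof -
      have "m - 1 / 2 = real M" by (simp add: m_n n_def field_simps)
      then show ?thesis by auto
    qed
    fix k assume "k \<in> {1..M}"
    have "theta_diff (real k) m (2 * \<tau>) (2 * z1 + 2 * z2)
        = ee (of_real ((of_int (int k))\<^sup>2 / of_int n) * \<tau>) * ?K k"
      using theta_diff_eq_class_diff(2)[OF n1, of "int k" \<tau> s] by (simp add: m_n s_def)
    moreover have "exp (2 * of_real pi * \<i> * of_nat k * (z1 - z2)) = ee (of_int (int k) * d)"
      by (simp add: ee_def d_def mult_ac)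
    \<comment> \<open>The Gaussian prefactor is exactly the normalisation of \<open>class_theta\<close>.\<close>
    moreover have "qpow \<tau> (- ((real k)\<^sup>2 / (2 * m))) * ee (of_real ((of_int (int k))\<^sup>2 / of_int n) * \<tau>) = 1"
      unfolding qpow_eq_ee ee_add[symmetric] by (simp add: two_m)
    ultimately show "exp (2 * of_real pi * \<i> * of_nat k * (z1 - z2)) * qpow \<tau> (- ((real k)\<^sup>2 / (2 * m)))
            * theta_diff (real k) m (2 * \<tau>) (2 * z1 + 2 * z2) = ee (of_int (int k) * d) * ?K k"
      by (simp add: mult.assoc[symmetric])
  qed
  have G: "denom_theta \<tau> n d * (appell_sum \<tau> n d s - appell_sum \<tau> n d (- s))
      = ee (of_int (int M + 1) * (d + s)) * (numer_theta \<tau> n d s * theta_recip \<tau> (d + s))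
        - ee (of_int (int M + 1) * (d + - s)) * (numer_theta \<tau> n d (- s) * theta_recip \<tau> (d + - s))
        - (\<Sum>k=1..M. ?K k * (?up (int k) + ?lo (- int k)))
        + (\<Sum>k=1..M. ?K k * (?up (- int k) + ?lo (int k)))
        + denom_theta \<tau> n d * (\<Sum>k=1..M. ee (of_int (int k) * d) * ?K k)"
    unfolding appell_sum_difference[OF tau n_def nz1 nz2] sum_distrib_left
    by (simp add: sum_subtractf[symmetric] sum.distrib[symmetric] algebra_simps)
  show ?thesis
    unfolding A Phi E F S(1)[unfolded d_def s_def] S(2)[unfolded d_def s_def] mult.assoc[of ?Z] G
    by (simp add: algebra_simps d_def s_def)
qed

end
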